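(* Let $(\Omega,\mathcal F,m)$ be a localizable measure space and $1\le p,q<\infty$. Let $S,T$ be positive $C_0$-semigroups on $L_2(m)$ with generators $A_S,A_T$, respectively. Assume that $S$ also acts on $L_p(m)$ and $T$ also acts on $L_q(m)$. Let $M\ge1$, $\omega\in\mathbb R$ be such that $\|T(t)u\|_q\le Me^{\omega t}\|u\|_q$ for all $t\ge0$ and $u\in L_q(m)$. Let $0\le f\in L_p(m)$. Then the following are equivalent: (a) There exists $C\ge0$ such that for all $t\ge0$ and $0\le u\in L_2(m)\cap L_q(m)$, $$T(t)u\le S(t)u+C\int_0^te^{\omega(t-s)}\|u\|_q\,S(s)f\,ds.$$ (b) There exists $C\ge0$ such that for all $0\le u\in D(A_T)\cap L_q(m)$ and $0\le v'\in D(A_S^\sigma)\cap L_{p'}(m)$, $$\langle A_Tu,v'\rangle_{2,2}\le\langle u,A_S^\sigma v'\rangle_{2,2}+C\,\|u\|_q\,\langle f,v'\rangle_{p,p'}.$$ (c) There exists $C\ge0$ such that for all sufficiently large $\lambda\in\mathbb R$ and all $0\le u\in L_2(m)\cap L_q(m)$, $$(\lambda-A_T)^{-1}u\le(\lambda-A_S)^{-1}u+\frac{C}{\lambda-\omega}\|u\|_q\,(\lambda-A_S)^{-1}f.$$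
   Context: All vector spaces are over $\mathbb R$; inequalities between functions are understood $m$-a.e. A measure space $(\Omega,\mathcal F,m)$ is semifinite if every $A\in\mathcal F$ with $m(A)=\infty$ contains some $B\in\mathcal F$ with $0<m(B)<\infty$. It is localizable if it is semifinite and for every $\mathcal E\subseteq\mathcal F$ there is $A\in\mathcal F$ such that $m(E\setminus A)=0$ for all $E\in\mathcal E$, and $m(A\setminus B)=0$ whenever $B\in\mathcal F$ satisfies $m(E\setminus B)=0$ for all $E\in\mathcal E$. (Equivalently, $L_1(m)'=L_\infty(m)$ canonically.) For $1\le p<\infty$, $p'$ is the dual exponent, $\frac1p+\frac1{p'}=1$ (with $\frac1\infty=0$). For $\varphi\in L_p(m)$, $\psi\in L_{p'}(m)=L_p(m)'$, $\langle\varphi,\psi\rangle_{p,p'}:=\int_\Omega\varphi\psi\,dm$. A semigroup is positive if it maps nonnegative functions to nonnegative functions. A $C_0$-semigroup $T$ on $L_2(m)$ also acts on $L_q(m)$ if there are $M\ge1$, $\omega\in\mathbb R$ with $\|T(t)u\|_q\le Me^{\omega t}\|u\|_q$ for all $u\in L_2(m)\cap L_q(m)$, $t\ge0$; then $T$ extends to a $C_0$-semigroup on $L_q(m)$, again denoted by $T$ (its generator coincides with that of $T$ on common elements). Accordingly, $S(s)f$ and $(\lambda-A_S)^{-1}f$ for $f\in L_p(m)$ refer to the extension of $S$ to $L_p(m)$ and its generator. For a $C_0$-semigroup $S$ with generator $A$ on a Banach space $X$, the weak$^*$-generator of $S(\cdot)'$ is $A^\sigma:=\{(x',y')\in X'\times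 X':\ \text{w}^*\text{-}\lim_{t\downarrow0}\frac1t(S(t)'x'-x')=y'\}$ (which equals the dual operator $A'$). Here $A_S^\sigma$ is formed for $S$ on $X=L_2(m)$, with $L_2(m)'=L_2(m)$. *)

theory Defs
  imports "HOL-Analysis.Analysis" "HOL-Probability.Essential_Supremum"
begin

text \<open>
  The library locale \<^locale>\<open>semifinite_measure\<close> does not ask the subset of finite measure to be
  non-null, so that the empty set always qualifies.  The usual notion is therefore defined here.
\<close>

definition semifinite :: "'a measure \<Rightarrow> bool" where
  "semifinite M \<longleftrightarrow>
     (\<forall>A\<in>sets M. emeasure M A = \<infinity> \<longrightarrow>
        (\<exists>B\<in>sets M. B \<subseteq> A \<and> 0 < emeasure M B \<and> emeasure M B < \<infinity>))"

definition localizable :: "'a measure \<Rightarrow> bool" where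
  "localizable M \<longleftrightarrow>
     semifinite M \<and>
     (\<forall>\<E>\<subseteq>sets M. \<exists>A\<in>sets M.
        (\<forall>E\<in>\<E>. emeasure M (E - A) = 0) \<and>
        (\<forall>B\<in>sets M. (\<forall>E\<in>\<E>. emeasure M (E - B) = 0) \<longrightarrow> emeasure M (A - B) = 0))"

text \<open>
  Elements of \<open>L\<^sub>p\<close> are represented by measurable functions; identification almost
  everywhere is made explicit, and operators are maps on representatives that respect it.
  \<open>Lp_norm\<close> is real-valued and meaningful on \<open>Lp M p\<close> only: it may vanish
  outside this space, so membership is always required separately.
\<close>

definition Lp :: "'a measure \<Rightarrow> ennreal \<Rightarrow> ('a \<Rightarrow> real) set" where
  "Lp M p =
     {f \<in> borel_measurable M.
        if p = \<infinity> then esssup M (\<lambda>x. ereal \<bar>f x\<bar>) < \<infinity>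
        else integrable M (\<lambda>x. \<bar>f x\<bar> powr enn2real p)}"

definition Lp_norm :: "'a measure \<Rightarrow> ennreal \<Rightarrow> ('a \<Rightarrow> real) \<Rightarrow> real" where
  "Lp_norm M p f =
     (if p = \<infinity> then real_of_ereal (esssup M (\<lambda>x. ereal \<bar>f x\<bar>))
      else (\<integral>x. \<bar>f x\<bar> powr enn2real p \<partial>M) powr (1 / enn2real p))"

definition pairing :: "'a measure \<Rightarrow> ('a \<Rightarrow> real) \<Rightarrow> ('a \<Rightarrow> real) \<Rightarrow> real" where
  "pairing M u v = (\<integral>x. u x * v x \<partial>M)"

text \<open>
  The integral over \<open>[a, b]\<close> of an \<open>L\<^sub>p\<close>-valued function: this is
  \<open>has_integral\<close> (see the library fact \<open>has_integral_cbox\<close>) with convergence in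
  the \<open>L\<^sub>p\<close>-norm.  For continuous integrands it is the Riemann integral.
\<close>

definition has_Lp_integral ::
  "'a measure \<Rightarrow> ennreal \<Rightarrow> (real \<Rightarrow> 'a \<Rightarrow> real) \<Rightarrow> ('a \<Rightarrow> real) \<Rightarrow> real \<Rightarrow> real \<Rightarrow> bool" where
  "has_Lp_integral M p F g a b \<longleftrightarrow>
     g \<in> Lp M p \<and>
     ((\<lambda>D. Lp_norm M p (\<lambda>x. (\<Sum>(s, k)\<in>D. measure lborel k * F s x) - g x)) \<longlongrightarrow> 0)
       (division_filter (cbox a b))"

definition Lp_integral ::
  "'a measure \<Rightarrow> ennreal \<Rightarrow> real \<Rightarrow> real \<Rightarrow> (real \<Rightarrow> 'a \<Rightarrow> real) \<Rightarrow> 'a \<Rightarrow> real" where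
  "Lp_integral M p a b F = (SOME g. has_Lp_integral M p F g a b)"

definition bounded_operator ::
  "'a measure \<Rightarrow> ennreal \<Rightarrow> (('a \<Rightarrow> real) \<Rightarrow> 'a \<Rightarrow> real) \<Rightarrow> bool" where
  "bounded_operator M p B \<longleftrightarrow>
     (\<forall>u\<in>Lp M p. B u \<in> Lp M p) \<and>
     (\<forall>u\<in>Lp M p. \<forall>v\<in>Lp M p. (AE x in M. u x = v x) \<longrightarrow> (AE x in M. B u x = B v x)) \<and>
     (\<forall>u\<in>Lp M p. \<forall>v\<in>Lp M p. AE x in M. B (\<lambda>y. u y + v y) x = B u x + B v x) \<and>
     (\<forall>c. \<forall>u\<in>Lp M p. AE x in M. B (\<lambda>y. c * u y) x = c * B u x) \<and>
     (\<exists>K. \<forall>u\<in>Lp M p. Lp_norm M p (B u) \<le> K * Lp_norm M p u)"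

text \<open>Only the values at times \<open>t \<ge> 0\<close> matter.\<close>

definition C0_semigroup ::
  "'a measure \<Rightarrow> ennreal \<Rightarrow> (real \<Rightarrow> ('a \<Rightarrow> real) \<Rightarrow> 'a \<Rightarrow> real) \<Rightarrow> bool" where
  "C0_semigroup M p T \<longleftrightarrow>
     (\<forall>t\<ge>0. bounded_operator M p (T t)) \<and>
     (\<forall>u\<in>Lp M p. AE x in M. T 0 u x = u x) \<and>
     (\<forall>s\<ge>0. \<forall>t\<ge>0. \<forall>u\<in>Lp M p. AE x in M. T (s + t) u x = T s (T t u) x) \<and>
     (\<forall>u\<in>Lp M p. ((\<lambda>t. Lp_norm M p (\<lambda>x. T t u x - u x)) \<longlongrightarrow> 0) (at_right 0))"

definition positive_semigroup ::
  "'a measure \<Rightarrow> ennreal \<Rightarrow> (real \<Rightarrow> ('a \<Rightarrow> real) \<Rightarrow> 'a \<Rightarrow> real) \<Rightarrow> bool" where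
  "positive_semigroup M p T \<longleftrightarrow>
     (\<forall>t\<ge>0. \<forall>u\<in>Lp M p. (AE x in M. 0 \<le> u x) \<longrightarrow> (AE x in M. 0 \<le> T t u x))"

text \<open>The generator as a graph, closed under almost everywhere equality in both components.\<close>

definition generator ::
  "'a measure \<Rightarrow> ennreal \<Rightarrow> (real \<Rightarrow> ('a \<Rightarrow> real) \<Rightarrow> 'a \<Rightarrow> real) \<Rightarrow> (('a \<Rightarrow> real) \<times> ('a \<Rightarrow> real)) set"
  where
  "generator M p T =
     {(u, w). u \<in> Lp M p \<and> w \<in> Lp M p \<and>
        ((\<lambda>t. Lp_norm M p (\<lambda>x. (1 / t) * (T t u x - u x) - w x)) \<longlongrightarrow> 0) (at_right 0)}"

text \<open>
  \<open>resolvent M A l g\<close> is the inverse of \<open>l - A\<close> applied to \<open>g\<close>, determined up to null sets when \<open>l\<close> is in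
  the resolvent set of the operator with graph \<open>A\<close>.
\<close>

definition resolvent ::
  "'a measure \<Rightarrow> (('a \<Rightarrow> real) \<times> ('a \<Rightarrow> real)) set \<Rightarrow> real \<Rightarrow> ('a \<Rightarrow> real) \<Rightarrow> 'a \<Rightarrow> real" where
  "resolvent M A l g = (SOME u. \<exists>w. (u, w) \<in> A \<and> (AE x in M. l * u x - w x = g x))"

definition acts_on ::
  "'a measure \<Rightarrow> (real \<Rightarrow> ('a \<Rightarrow> real) \<Rightarrow> 'a \<Rightarrow> real) \<Rightarrow> ennreal \<Rightarrow> bool" where
  "acts_on M T q \<longleftrightarrow>
     (\<exists>K \<omega>. K \<ge> 1 \<and>
        (\<forall>t\<ge>0. \<forall>u\<in>Lp M 2 \<inter> Lp M q.
           T t u \<in> Lp M q \<and> Lp_norm M q (T t u) \<le> K * exp (\<omega> * t) * Lp_norm M q u))"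

text \<open>
  The extension to \<open>L\<^sub>q\<close> of a semigroup on \<open>L\<^sub>2\<close> that also acts on \<open>L\<^sub>q\<close>; for
  \<open>q < \<infinity>\<close> it is determined up to null sets, since \<open>L\<^sub>2 \<inter> L\<^sub>q\<close> is dense in \<open>L\<^sub>q\<close>.
\<close>

definition Lp_extension ::
  "'a measure \<Rightarrow> ennreal \<Rightarrow> (real \<Rightarrow> ('a \<Rightarrow> real) \<Rightarrow> 'a \<Rightarrow> real) \<Rightarrow> real \<Rightarrow> ('a \<Rightarrow> real) \<Rightarrow> 'a \<Rightarrow> real"
  where
  "Lp_extension M q T =
     (SOME T'. C0_semigroup M q T' \<and>
        (\<forall>t\<ge>0. \<forall>u\<in>Lp M 2 \<inter> Lp M q. AE x in M. T' t u x = T t u x))"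

text \<open>
  The weak*-generator on \<open>L\<^sub>2\<close>.  A function \<open>v\<close> in \<open>L\<^sub>2\<close> is identified with the
  functional \<open>u \<mapsto> pairing M u v\<close> in the dual of \<open>L\<^sub>2\<close>; the dual operator of \<open>B\<close> maps a
  functional \<open>\<phi>\<close> to \<open>\<phi> \<circ> B\<close>, and weak* convergence is pointwise convergence on \<open>L\<^sub>2\<close>.
\<close>

definition dual_operator ::
  "(('a \<Rightarrow> real) \<Rightarrow> 'a \<Rightarrow> real) \<Rightarrow> (('a \<Rightarrow> real) \<Rightarrow> real) \<Rightarrow> ('a \<Rightarrow> real) \<Rightarrow> real" where
  "dual_operator B \<phi> = (\<lambda>u. \<phi> (B u))"

definition weak_star_generator ::
  "'a measure \<Rightarrow> (real \<Rightarrow> ('a \<Rightarrow> real) \<Rightarrow> 'a \<Rightarrow> real) \<Rightarrow> (('a \<Rightarrow> real) \<times> ('a \<Rightarrow> real)) set" where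
  "weak_star_generator M S =
     {(v, z). v \<in> Lp M 2 \<and> z \<in> Lp M 2 \<and>
        (\<forall>u\<in>Lp M 2.
           ((\<lambda>t. (1 / t) * (dual_operator (S t) (\<lambda>h. pairing M h v) u - pairing M u v))
              \<longlongrightarrow> pairing M u z) (at_right 0))}"

end

theory Submission
  imports Defs "HOL-Probability.Discrete_Topology" "HOL-Real_Asymp.Real_Asymp"
begin

text \<open>
  If \<open>u\<close> and \<open>v\<close> are replaced by \<open>R(l, A\<^sub>T) u\<close> and \<open>R(l, A\<^sub>S)' v\<close>, then (b) becomes (c) paired with \<open>v\<close>; conversely,
  \<open>l (l R(l, A\<^sub>T) u - u) \<rightarrow> A\<^sub>T u\<close> and its analogue for \<open>S\<close> turn (c) into (b) as \<open>l \<rightarrow> \<infinity>\<close>.  In the same way (b) is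
  the derivative of (a) at \<open>t = 0\<close>, and (a) is recovered from (b) by integrating the derivative of
  \<open>s \<mapsto> \<langle>R(l, A\<^sub>S) S(s) T(t - s) u, v\<rangle>\<close>.  The adjoints applied to \<open>v\<close> exist in \<open>L\<^sub>2\<close> by Riesz
  representation and lie in \<open>L\<^bsub>p'\<^esub>\<close> by the converse of Hoelder's inequality.  That \<open>S\<close> extends to a
  \<open>C\<^sub>0\<close>-semigroup on \<open>L\<^sub>p\<close> rests on positivity: the vectors whose orbits are continuous in \<open>L\<^sub>p\<close> form an order ideal
  that contains all means \<open>v\<close> of orbits over \<open>[0, h]\<close>, hence also \<open>min v u\<close>, which tends to \<open>u \<ge> 0\<close> in \<open>L\<^sub>p\<close> by domination.
\<close>

section \<open>Semigroups on closed subspaces of a Banach space\<close>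

text \<open>Condition (b) asks for \<open>u\<close> in the domain of \<open>A_T\<close> and for a
  test function in the domain of the dual of \<open>A_S\<close>, and these domains are unrelated.
  Hence both arguments are regularised separately: \<open>u\<close> by a resolvent of
  \<open>A_T\<close>, the test function by the adjoint of a resolvent of \<open>A_S\<close>. The
  term with \<open>f\<close> lives in \<open>L_p\<close>, the others in \<open>L_2\<close>, and
  \<open>f\<close> need not lie in \<open>L_2\<close>. So the extension of \<open>S\<close> and its
  resolvent must be consistent with those on \<open>L_2\<close>, and functions from different spaces
  are compared through pairings. The constant \<open>C\<close> survives unchanged from (a) and from
  (c) to (b). Starting from (b) it becomes \<open>C * K\<close>, because the norm of
  \<open>T (t - s) u\<close> or of the resolvent of \<open>A_T\<close> is estimated in
  \<open>L_q\<close>; the pairing of \<open>f\<close> with a nonnegative test function is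
  nonnegative, so the estimate may be inserted. The weight in (a) is the growth of
  \<open>T (t - s)\<close>: written as \<open>exp (\<omega> * t) * exp (- (\<omega> * s))\<close>,
  it turns the integral into that of an orbit of a rescaled semigroup. Its counterpart for
  resolvents is \<open>1 / (l - \<omega>)\<close>.\<close>

lemma has_integral_in_closed_cone:
  fixes F :: "real \<Rightarrow> 'e::banach"
  assumes "closed C" and "0 \<in> C" and "\<And>x y. x \<in> C \<Longrightarrow> y \<in> C \<Longrightarrow> x + y \<in> C"
    and "\<And>c x. 0 \<le> c \<Longrightarrow> x \<in> C \<Longrightarrow> c *\<^sub>R x \<in> C"
    and "(F has_integral I) {a..b}" and F: "\<And>s. s \<in> {a..b} \<Longrightarrow> F s \<in> C"
  shows "I \<in> C"
proof -
  have lim: "((\<lambda>p. \<Sum>(x,k)\<in>p. measure lborel k *\<^sub>R F x) \<longlongrightarrow> I) (division_filter (cbox a b))"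
    using assms(5) by (metis has_integral_cbox box_real(2))
  \<comment> \<open>Tags lie in the interval and the coefficients are lengths, so every Riemann sum
    is a nonnegative combination of values of \<open>F\<close>. A cone suffices for this, which
    covers closed subspaces and nonnegative functions alike.\<close>
  have "\<forall>\<^sub>F p in division_filter (cbox a b). (\<Sum>(x,k)\<in>p. measure lborel k *\<^sub>R F x) \<in> C"
    using eventually_division_filter_tagged_division[of "cbox a b"]
  proof eventually_elim
    case (elim p)
    have mem: "(case z of (x, k) \<Rightarrow> measure lborel k *\<^sub>R F x) \<in> C" if "z \<in> p" for z
      using that tag_in_interval[OF elim] F assms(4) by (cases z) fastforce
    have "sum (\<lambda>z. case z of (x, k) \<Rightarrow> measure lborel k *\<^sub>R F x) q \<in> C" if "finite q" "q \<subseteq> p" for q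
      using that
    proof (induction q)
      case (insert z q)
      then show ?case using assms(3)[OF mem[of z]] by simp
    qed (simp add: assms(2))
    then show ?case
      using elim by blast
  qed
  then show ?thesis
    by (rule Lim_in_closed_set[OF assms(1) _ division_filter_not_empty lim])
qed

text \<open>\<open>B\<close> is linear and bounded on \<open>V\<close> only, as lifted operators are
  arbitrary elsewhere. Riemann sums stay in \<open>V\<close>, so \<open>B\<close> may be applied to
  them termwise and the bound carries the limit over.\<close>

lemma has_integral_linear_on_subspace:
  fixes F :: "real \<Rightarrow> 'e::banach" and B :: "'e \<Rightarrow> 'd::banach"
  assumes "closed V" "subspace V"
    and add: "\<And>x y. x \<in> V \<Longrightarrow> y \<in> V \<Longrightarrow> B (x + y) = B x + B y"
    and scale: "\<And>c x. x \<in> V \<Longrightarrow> B (c *\<^sub>R x) = c *\<^sub>R B x"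
    and bound: "\<And>x. x \<in> V \<Longrightarrow> norm (B x) \<le> L * norm x"
    and int: "(F has_integral I) {a..b}" and F: "\<And>s. s \<in> {a..b} \<Longrightarrow> F s \<in> V"
  shows "((\<lambda>s. B (F s)) has_integral B I) {a..b}"
proof -
  have IV: "I \<in> V"
    by (rule has_integral_in_closed_cone[OF assms(1) _ _ _ int F])
      (auto simp: subspace_0 subspace_add subspace_scale assms(2))
  have B0: "B 0 = 0"
    using scale[of 0 0] assms(2) by (simp add: subspace_0)
  let ?S = "\<lambda>p. \<Sum>(x,k)\<in>p. measure lborel k *\<^sub>R F x"
  let ?R = "\<lambda>p. \<Sum>(x,k)\<in>p. measure lborel k *\<^sub>R B (F x)"
  have lim: "(?S \<longlongrightarrow> I) (division_filter (cbox a b))"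
    using int by (metis has_integral_cbox box_real(2))
  have "\<forall>\<^sub>F p in division_filter (cbox a b). norm (?R p - B I) \<le> norm (?S p - I) * L"
    using eventually_division_filter_tagged_division[of "cbox a b"]
  proof eventually_elim
    case (elim p)
    have Fz: "F x \<in> V" if "(x, k) \<in> p" for x k
      using that tag_in_interval[OF elim] F by fastforce
    have *: "?S q \<in> V \<and> B (?S q) = ?R q" if "finite q" "q \<subseteq> p" for q
      using that
    proof (induction q)
      case (insert z q)
      obtain x k where z: "z = (x, k)" by (metis surj_pair)
      have "F x \<in> V" using Fz insert z by blast
      then show ?case
        using insert assms(2) by (simp add: z add scale subspace_add subspace_scale)
    qed (simp add: B0 subspace_0 assms(2))
    have SV: "?S p \<in> V" and BS: "B (?S p) = ?R p"
      using *[of p] elim by auto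
    have "?R p - B I = B (?S p - I)"
      using add[of "?S p - I" I] BS SV IV assms(2) by (simp add: subspace_diff algebra_simps)
    then show ?case
      using bound[of "?S p - I"] SV IV assms(2) by (simp add: subspace_diff mult.commute)
  qed
  then have "(?R \<longlongrightarrow> B I) (division_filter (cbox a b))"
    by (rule LIM_zero_cancel[OF tendsto_0_le[OF LIM_zero[OF lim]]])
  then show ?thesis
    by (metis has_integral_cbox box_real(2))
qed

section \<open>Difference quotients and derivatives\<close>

lemma has_vector_derivative_quotient:
  fixes f :: "real \<Rightarrow> 'e::real_normed_vector"
  assumes "((\<lambda>t. (1 / (t - s)) *\<^sub>R (f t - f s)) \<longlongrightarrow> D) (at s within S)"
  shows "(f has_vector_derivative D) (at s within S)"
proof -
  have "((\<lambda>t. norm ((1 / (t - s)) *\<^sub>R (f t - f s) - D)) \<longlongrightarrow> 0) (at s within S)"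
    using assms by (simp add: LIM_zero tendsto_norm_zero)
  moreover have "\<forall>\<^sub>F t in at s within S. norm ((1 / (t - s)) *\<^sub>R (f t - f s) - D)
      = norm (f t - f s - (t - s) *\<^sub>R D) / norm (t - s)"
  proof -
    have "norm ((1 / (t - s)) *\<^sub>R (f t - f s) - D) = norm (f t - f s - (t - s) *\<^sub>R D) / norm (t - s)"
      if "t \<noteq> s" for t
    proof -
      have "(1 / (t - s)) *\<^sub>R (f t - f s) - D = (1 / (t - s)) *\<^sub>R (f t - f s - (t - s) *\<^sub>R D)"
        using that by (simp add: scaleR_diff_right)
      then show ?thesis by simp
    qed
    then show ?thesis by (simp add: eventually_at_filter)
  qed
  ultimately show ?thesis
    unfolding has_vector_derivative_def has_derivative_iff_norm
    by (auto simp: bounded_linear_scaleR_left intro: Lim_transform_eventually)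
qed

lemma has_vector_derivative_quotientD:
  fixes f :: "real \<Rightarrow> 'e::real_normed_vector"
  assumes "(f has_vector_derivative D) (at s within S)"
  shows "((\<lambda>t. (1 / (t - s)) *\<^sub>R (f t - f s)) \<longlongrightarrow> D) (at s within S)"
proof -
  have "((\<lambda>t. norm (f t - f s - (t - s) *\<^sub>R D) / norm (t - s)) \<longlongrightarrow> 0) (at s within S)"
    using assms unfolding has_vector_derivative_def has_derivative_iff_norm by auto
  moreover have "\<forall>\<^sub>F t in at s within S. norm (f t - f s - (t - s) *\<^sub>R D) / norm (t - s)
      = norm ((1 / (t - s)) *\<^sub>R (f t - f s) - D)"
  proof -
    have "norm ((1 / (t - s)) *\<^sub>R (f t - f s) - D) = norm (f t - f s - (t - s) *\<^sub>R D) / norm (t - s)"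
      if "t \<noteq> s" for t
    proof -
      have "(1 / (t - s)) *\<^sub>R (f t - f s) - D = (1 / (t - s)) *\<^sub>R (f t - f s - (t - s) *\<^sub>R D)"
        using that by (simp add: scaleR_diff_right)
      then show ?thesis by simp
    qed
    then show ?thesis by (simp add: eventually_at_filter)
  qed
  ultimately have "((\<lambda>t. norm ((1 / (t - s)) *\<^sub>R (f t - f s) - D)) \<longlongrightarrow> 0) (at s within S)"
    by (rule Lim_transform_eventually)
  then show ?thesis
    by (rule LIM_zero_cancel[OF tendsto_norm_zero_cancel])
qed

text \<open>Product rule at 0. Used with opposite signs of \<open>c\<close>, it transfers the
  generator between a semigroup and its exponential rescaling in both directions.\<close>

lemma tendsto_quotient_exp_scale:
  fixes f :: "real \<Rightarrow> 'e::real_normed_vector"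
  assumes "((\<lambda>t. (1 / t) *\<^sub>R (f t - x)) \<longlongrightarrow> y) (at_right 0)"
  shows "((\<lambda>t. (1 / t) *\<^sub>R (exp (c * t) *\<^sub>R f t - x)) \<longlongrightarrow> y + c *\<^sub>R x) (at_right 0)"
proof -
  have "((\<lambda>t. exp (c * t)) \<longlongrightarrow> 1) (at_right 0)" and "((\<lambda>t. (exp (c * t) - 1) / t) \<longlongrightarrow> c) (at_right 0)"
    by real_asymp+
  then have "((\<lambda>t. exp (c * t) *\<^sub>R ((1 / t) *\<^sub>R (f t - x)) + ((exp (c * t) - 1) / t) *\<^sub>R x) \<longlongrightarrow> 1 *\<^sub>R y + c *\<^sub>R x) (at_right 0)"
    by (intro tendsto_add tendsto_scaleR assms tendsto_const)
  moreover have "exp (c * t) *\<^sub>R ((1 / t) *\<^sub>R (f t - x)) + ((exp (c * t) - 1) / t) *\<^sub>R x =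
      (1 / t) *\<^sub>R (exp (c * t) *\<^sub>R f t - x)" for t
    by (simp add: scaleR_diff_right scaleR_diff_left diff_divide_distrib)
  ultimately show ?thesis by simp
qed

lemma eventually_nonneg_at_right: "\<forall>\<^sub>F t in at_right (0::real). 0 \<le> t"
  using eventually_at_right_less[of "0::real"] by (rule eventually_mono) auto

text \<open>The space is a closed subspace of a Banach space type and \<open>U t\<close> is
  arbitrary outside it, because each \<open>L_p\<close> will be embedded as such a subspace. The
  exponential bound is assumed here; it is obtained from positivity or from the action on
  \<open>L_p\<close> when the locale is instantiated.\<close>

locale c0_semigroup =
  fixes V :: "'e::banach set" and U :: "real \<Rightarrow> 'e \<Rightarrow> 'e" and K w :: real
  assumes closed_V: "closed V" and subspace_V: "subspace V" and K_nonneg: "0 \<le> K"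
    and U_in: "0 \<le> t \<Longrightarrow> x \<in> V \<Longrightarrow> U t x \<in> V"
    and U_add: "0 \<le> t \<Longrightarrow> x \<in> V \<Longrightarrow> y \<in> V \<Longrightarrow> U t (x + y) = U t x + U t y"
    and U_scale: "0 \<le> t \<Longrightarrow> x \<in> V \<Longrightarrow> U t (c *\<^sub>R x) = c *\<^sub>R U t x"
    and U_bound: "0 \<le> t \<Longrightarrow> x \<in> V \<Longrightarrow> norm (U t x) \<le> K * exp (w * t) * norm x"
    and U_0: "x \<in> V \<Longrightarrow> U 0 x = x"
    and U_plus: "0 \<le> s \<Longrightarrow> 0 \<le> t \<Longrightarrow> x \<in> V \<Longrightarrow> U (s + t) x = U s (U t x)"
    and U_tendsto: "x \<in> V \<Longrightarrow> ((\<lambda>t. U t x) \<longlongrightarrow> x) (at_right 0)"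
begin

lemma V_add: "x \<in> V \<Longrightarrow> y \<in> V \<Longrightarrow> x + y \<in> V"
  and V_diff: "x \<in> V \<Longrightarrow> y \<in> V \<Longrightarrow> x - y \<in> V"
  and V_scale: "x \<in> V \<Longrightarrow> c *\<^sub>R x \<in> V"
  and V_0: "0 \<in> V"
  using subspace_V by (auto simp: subspace_add subspace_diff subspace_scale subspace_0)

lemma U_diff: "0 \<le> t \<Longrightarrow> x \<in> V \<Longrightarrow> y \<in> V \<Longrightarrow> U t (x - y) = U t x - U t y"
  using U_add[of t "x - y" y] V_diff by (simp add: algebra_simps)

lemma U_bound_uniform:
  assumes "0 \<le> t" "t \<le> b" "x \<in> V"
  shows "norm (U t x) \<le> K * exp (\<bar>w\<bar> * b) * norm x"
proof -
  have "w * t \<le> \<bar>w\<bar> * b"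
    using assms by (intro mult_mono) auto
  then have "K * exp (w * t) * norm x \<le> K * exp (\<bar>w\<bar> * b) * norm x"
    using K_nonneg by (intro mult_right_mono mult_left_mono) auto
  then show ?thesis using U_bound[of t x] assms by linarith
qed

lemma orbit_continuous:
  assumes x: "x \<in> V"
  shows "continuous_on {0..} (\<lambda>t. U t x)"
  unfolding continuous_on_iff
proof (intro ballI allI impI)
  fix s e :: real assume s: "s \<in> {0..}" and e: "0 < e"
  define L where "L = K * exp (\<bar>w\<bar> * s) + 1"
  have L: "L > 0" using K_nonneg by (simp add: L_def add_nonneg_pos)
  have "\<forall>\<^sub>F t in at_right 0. dist (U t x) x < e / L"
    using U_tendsto[OF x] e L by (intro tendstoD) auto
  then obtain d where d: "d > 0" "\<And>t. 0 < t \<Longrightarrow> t < d \<Longrightarrow> dist (U t x) x < e / L"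
    by (auto simp: eventually_at_right_field)
  have d': "norm (U t x - x) < e / L" if "0 \<le> t" "t < d" for t
    using d(2)[of t] that U_0[OF x] e L by (cases "t = 0") (auto simp: dist_norm)
  \<comment> \<open>The increment from \<open>a\<close> to \<open>b\<close> is \<open>U a\<close>
    applied to the increment over \<open>[0, b - a]\<close>. The condition \<open>a \<le> s\<close>
    gives one bound for \<open>U a\<close> that serves both sides of \<open>s\<close>: either
    \<open>a = s\<close> or \<open>b = s\<close>.\<close>
  have main: "norm (U b x - U a x) < e" if "0 \<le> a" "a \<le> b" "b - a < d" "a \<le> s" for a b
  proof -
    have "U b x = U a (U (b - a) x)"
      using U_plus[of a "b - a" x] that x by simp
    then have "U b x - U a x = U a (U (b - a) x - x)"
      using that x by (simp add: U_diff U_in)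
    then have "norm (U b x - U a x) \<le> (K * exp (\<bar>w\<bar> * s)) * norm (U (b - a) x - x)"
      using U_bound_uniform[of a s "U (b - a) x - x"] that x by (simp add: V_diff U_in)
    also have "\<dots> \<le> L * norm (U (b - a) x - x)"
      by (intro mult_right_mono) (auto simp: L_def)
    also have "\<dots> < L * (e / L)"
      using d'[of "b - a"] that L by (intro mult_strict_left_mono) auto
    finally show ?thesis using L by simp
  qed
  have "dist (U t x) (U s x) < e" if "t \<in> {0..}" "dist t s < d" for t
    using main[of s t] main[of t s] that s
    by (cases "t \<le> s") (auto simp: dist_norm norm_minus_commute abs_if split: if_splits)
  then show "\<exists>d>0. \<forall>x'\<in>{0..}. dist x' s < d \<longrightarrow> dist (U x' x) (U s x) < e"
    using d(1) by blast
qed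

text \<open>Strong continuity at the fixed vector \<open>x\<close> plus the uniform bound of the
  operators on \<open>[0, s + 1]\<close>. With a constant time it is the continuity of a single
  operator on \<open>V\<close>.\<close>

lemma U_tendsto_joint:
  assumes \<tau>: "(\<tau> \<longlongrightarrow> s) F" and g: "(g \<longlongrightarrow> x) F" and nn: "\<forall>\<^sub>F i in F. 0 \<le> \<tau> i" and gV: "\<forall>\<^sub>F i in F. g i \<in> V"
    and s: "0 \<le> s" and x: "x \<in> V"
  shows "((\<lambda>i. U (\<tau> i) (g i)) \<longlongrightarrow> U s x) F"
proof -
  have 1: "((\<lambda>i. U (\<tau> i) x) \<longlongrightarrow> U s x) F"
    using continuous_on_tendsto_compose[OF orbit_continuous[OF x] \<tau>] s nn by auto
  have "\<forall>\<^sub>F i in F. \<tau> i < s + 1"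
    using \<tau> by (rule order_tendstoD) simp
  then have "\<forall>\<^sub>F i in F. norm (U (\<tau> i) (g i - x)) \<le> norm (g i - x) * (K * exp (\<bar>w\<bar> * (s + 1)))"
    using nn gV
  proof eventually_elim
    case (elim i)
    then show ?case using U_bound_uniform[of "\<tau> i" "s + 1" "g i - x"] x by (simp add: V_diff mult.commute)
  qed
  moreover have "((\<lambda>i. g i - x) \<longlongrightarrow> 0) F"
    using g by (simp add: LIM_zero)
  ultimately have 2: "((\<lambda>i. U (\<tau> i) (g i - x)) \<longlongrightarrow> 0) F"
    by (rule tendsto_0_le[rotated])
  have "\<forall>\<^sub>F i in F. U (\<tau> i) (g i - x) + U (\<tau> i) x = U (\<tau> i) (g i)"
    using nn gV by eventually_elim (simp add: U_diff x)
  then show ?thesis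
    using Lim_transform_eventually[OF tendsto_add[OF 2 1]] by simp
qed

definition gen :: "'e \<Rightarrow> 'e \<Rightarrow> bool" where
  "gen x y \<longleftrightarrow> x \<in> V \<and> y \<in> V \<and> ((\<lambda>t. (1 / t) *\<^sub>R (U t x - x)) \<longlongrightarrow> y) (at_right 0)"

lemma genD: "gen x y \<Longrightarrow> x \<in> V" "gen x y \<Longrightarrow> y \<in> V"
  by (auto simp: gen_def)

lemma gen_add:
  assumes "gen x y" "gen x' y'"
  shows "gen (x + x') (y + y')"
proof -
  have "((\<lambda>t. (1 / t) *\<^sub>R (U t x - x) + (1 / t) *\<^sub>R (U t x' - x')) \<longlongrightarrow> y + y') (at_right 0)"
    using assms by (intro tendsto_add) (auto simp: gen_def)
  moreover have "\<forall>\<^sub>F t in at_right 0. (1 / t) *\<^sub>R (U t x - x) + (1 / t) *\<^sub>R (U t x' - x')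
      = (1 / t) *\<^sub>R (U t (x + x') - (x + x'))"
    using eventually_nonneg_at_right
    by eventually_elim (use assms in \<open>simp add: genD U_add algebra_simps\<close>)
  ultimately show ?thesis
    using assms Lim_transform_eventually by (fastforce simp: gen_def V_add)
qed

lemma gen_scale:
  assumes "gen x y"
  shows "gen (c *\<^sub>R x) (c *\<^sub>R y)"
proof -
  have "((\<lambda>t. c *\<^sub>R (1 / t) *\<^sub>R (U t x - x)) \<longlongrightarrow> c *\<^sub>R y) (at_right 0)"
    using assms by (intro tendsto_scaleR tendsto_const) (auto simp: gen_def)
  moreover have "\<forall>\<^sub>F t in at_right 0. c *\<^sub>R (1 / t) *\<^sub>R (U t x - x)
      = (1 / t) *\<^sub>R (U t (c *\<^sub>R x) - (c *\<^sub>R x))"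
    using eventually_nonneg_at_right
    by eventually_elim (use assms in \<open>simp add: genD U_scale algebra_simps\<close>)
  ultimately show ?thesis
    using assms Lim_transform_eventually by (fastforce simp: gen_def V_scale)
qed

lemma gen_diff: "gen x y \<Longrightarrow> gen x' y' \<Longrightarrow> gen (x - x') (y - y')"
  using gen_add[of x y "(-1) *\<^sub>R x'" "(-1) *\<^sub>R y'"] gen_scale[of x' y' "-1"] by simp

lemma gen_U:
  assumes "gen x y" "0 \<le> s"
  shows "gen (U s x) (U s y)"
proof -
  have x: "x \<in> V" and y: "y \<in> V" using assms by (auto simp: gen_def)
  have "((\<lambda>t. U s ((1 / t) *\<^sub>R (U t x - x))) \<longlongrightarrow> U s y) (at_right 0)"
    using assms eventually_nonneg_at_right
    by (intro U_tendsto_joint tendsto_const) (auto simp: gen_def V_scale V_diff U_in elim!: eventually_mono)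
  moreover have "\<forall>\<^sub>F t in at_right 0. U s ((1 / t) *\<^sub>R (U t x - x)) = (1 / t) *\<^sub>R (U t (U s x) - U s x)"
    using eventually_nonneg_at_right
  proof eventually_elim
    case (elim t)
    have "U t (U s x) = U s (U t x)"
      using U_plus[of s t x] U_plus[of t s x] elim assms x by (simp add: add.commute)
    then show ?case using elim assms x by (simp add: U_scale U_diff V_diff U_in)
  qed
  ultimately show ?thesis
    using x y assms Lim_transform_eventually by (fastforce simp: gen_def U_in)
qed

text \<open>From either side of \<open>s\<close> the difference quotient is
  \<open>U (min t s)\<close> applied to the right difference quotient at 0 with step |t - s|. Joint
  continuity then gives the two-sided derivative.\<close>

lemma orbit_derivative:
  assumes "gen x y" "0 \<le> s"
  shows "((\<lambda>t. U t x) has_vector_derivative U s y) (at s within {0..})"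
proof -
  have x: "x \<in> V" and y: "y \<in> V" using assms by (auto simp: gen_def)
  let ?F = "at s within {0..}"
  have "filterlim (\<lambda>t. \<bar>t - s\<bar>) (at_right 0) ?F"
    unfolding filterlim_at by (auto intro!: tendsto_eq_intros simp: eventually_at_filter)
  then have lim: "((\<lambda>t. (1 / \<bar>t - s\<bar>) *\<^sub>R (U \<bar>t - s\<bar> x - x)) \<longlongrightarrow> y) ?F"
    using assms filterlim_compose[of "\<lambda>t. (1 / t) *\<^sub>R (U t x - x)" "nhds y" "at_right 0"] unfolding gen_def by blast
  have ms: "((\<lambda>t. min t s) \<longlongrightarrow> s) ?F"
    using tendsto_min[OF tendsto_ident_at tendsto_const, of s s "{0..}"] by simp
  have ev: "\<forall>\<^sub>F t in ?F. 0 \<le> t"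
    by (auto simp: eventually_at_filter)
  have "((\<lambda>t. U (min t s) ((1 / \<bar>t - s\<bar>) *\<^sub>R (U \<bar>t - s\<bar> x - x))) \<longlongrightarrow> U s y) ?F"
    by (rule U_tendsto_joint[OF ms lim])
      (use ev assms(2) x y in \<open>auto simp: V_scale V_diff U_in elim: eventually_mono\<close>)
  moreover have "\<forall>\<^sub>F t in ?F. U (min t s) ((1 / \<bar>t - s\<bar>) *\<^sub>R (U \<bar>t - s\<bar> x - x)) = (1 / (t - s)) *\<^sub>R (U t x - U s x)"
    using ev
  proof eventually_elim
    case (elim t)
    have "U (min t s + \<bar>t - s\<bar>) x = U (min t s) (U \<bar>t - s\<bar> x)"
      using elim assms x by (intro U_plus) auto
    moreover have "U (min t s) ((1 / \<bar>t - s\<bar>) *\<^sub>R (U \<bar>t - s\<bar> x - x)) =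
       (1 / \<bar>t - s\<bar>) *\<^sub>R (U (min t s) (U \<bar>t - s\<bar> x) - U (min t s) x)"
      using elim assms x by (simp add: U_scale U_diff V_diff U_in)
    ultimately have eq: "U (min t s) ((1 / \<bar>t - s\<bar>) *\<^sub>R (U \<bar>t - s\<bar> x - x)) =
       (1 / \<bar>t - s\<bar>) *\<^sub>R (U (min t s + \<bar>t - s\<bar>) x - U (min t s) x)" by simp
    show ?case
    proof (cases "s \<le> t")
      case True
      then show ?thesis unfolding eq by (simp add: min_def)
    next
      case False
      then have *: "min t s + \<bar>t - s\<bar> = s" "min t s = t" "\<bar>t - s\<bar> = - (t - s)" by auto
      have "(1 / \<bar>t - s\<bar>) *\<^sub>R (U s x - U t x) = (1 / (t - s)) *\<^sub>R (U t x - U s x)"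
        unfolding *(3) by (metis divide_minus_right minus_diff_eq scaleR_minus_left scaleR_minus_right)
      then show ?thesis using eq *(1,2) by simp
    qed
  qed
  ultimately have "((\<lambda>t. (1 / (t - s)) *\<^sub>R (U t x - U s x)) \<longlongrightarrow> U s y) ?F"
    by (rule Lim_transform_eventually)
  then show ?thesis
    by (rule has_vector_derivative_quotient)
qed

section \<open>Integrals of orbits, and the inverse of a stable generator\<close>

definition orbit_integral :: "'e \<Rightarrow> real \<Rightarrow> 'e" where
  "orbit_integral x t = integral {0..t} (\<lambda>s. U s x)"

lemma orbit_integrable: "x \<in> V \<Longrightarrow> 0 \<le> a \<Longrightarrow> (\<lambda>s. U s x) integrable_on {a..b}"
  by (rule integrable_continuous_interval) (auto intro: continuous_on_subset[OF orbit_continuous])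

lemma orbit_integral_in: 
  assumes "x \<in> V"
  shows "orbit_integral x t \<in> V"
  unfolding orbit_integral_def
  by (rule has_integral_in_closed_cone[OF closed_V _ _ _ integrable_integral[OF orbit_integrable]])
    (auto simp: V_0 V_add V_scale U_in assms)

lemma orbit_integral_derivative:
  assumes x: "x \<in> V" and h: "0 \<le> h"
  shows "((\<lambda>k. (1 / k) *\<^sub>R (orbit_integral x (h + k) - orbit_integral x h)) \<longlongrightarrow> U h x) (at_right 0)"
proof -
  have "((\<lambda>t. integral {0..t} (\<lambda>s. U s x)) has_vector_derivative U h x) (at h within {0..h+1})"
    using h by (intro integral_has_vector_derivative) (auto intro: continuous_on_subset[OF orbit_continuous[OF x]])
  then have "((\<lambda>t. orbit_integral x t) has_vector_derivative U h x) (at h within {h..h+1})"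
    unfolding orbit_integral_def by (rule has_vector_derivative_within_subset) (use h in auto)
  then have "((\<lambda>t. (1 / (t - h)) *\<^sub>R (orbit_integral x t - orbit_integral x h)) \<longlongrightarrow> U h x) (at h within {h..h+1})"
    by (rule has_vector_derivative_quotientD)
  then have "((\<lambda>t. (1 / (t - h)) *\<^sub>R (orbit_integral x t - orbit_integral x h)) \<longlongrightarrow> U h x) (at_right h)"
    by (simp add: at_within_Icc_at_right)
  then show ?thesis
    unfolding filterlim_at_right_to_0[of _ _ h] by (simp add: add.commute)
qed

text \<open>Pulled under the integral, \<open>U k\<close> shifts the interval of integration to
  \<open>[k, k + h]\<close>.\<close>

lemma U_orbit_integral:
  assumes x: "x \<in> V" and "0 \<le> k" "0 \<le> h"
  shows "U k (orbit_integral x h) = orbit_integral x (k + h) - orbit_integral x k"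
proof -
  have "((\<lambda>s. U k (U s x)) has_integral U k (orbit_integral x h)) {0..h}"
    unfolding orbit_integral_def
    by (rule has_integral_linear_on_subspace[OF closed_V subspace_V _ _ _ integrable_integral[OF orbit_integrable], 
      where L="K * exp (w * k)"])
      (use assms in \<open>auto simp: U_add U_scale U_bound U_in\<close>)
  moreover have "((\<lambda>s. U k (U s x)) has_integral I) {0..h} \<longleftrightarrow> (((\<lambda>s. U s x) \<circ> ((+) k)) has_integral I) {0..h}" for I
    using assms by (intro has_integral_cong) (auto simp: U_plus)
  ultimately have "((\<lambda>s. U s x) has_integral U k (orbit_integral x h)) {k..k+h}"
    unfolding has_integral_shift_Icc_real by (simp add: add.commute)
  moreover have "((\<lambda>s. U s x) has_integral orbit_integral x k) {0..k}"
    "((\<lambda>s. U s x) has_integral orbit_integral x (k + h)) {0..k+h}"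
    unfolding orbit_integral_def using x by (auto intro!: integrable_integral orbit_integrable)
  ultimately show ?thesis
    using has_integral_combine[of 0 k "k + h" "\<lambda>s. U s x"] assms
    by (metis add_diff_cancel_left' add_increasing2 has_integral_unique le_add_same_cancel1)
qed

text \<open>By the shift formula the difference quotient of the semigroup at the integral is the
  difference of the right difference quotients of the integral itself at \<open>h\<close> and at
  0.\<close>

lemma gen_orbit_integral:
  assumes x: "x \<in> V" and h: "0 \<le> h"
  shows "gen (orbit_integral x h) (U h x - x)"
proof -
  let ?P = "orbit_integral x"
  have "((\<lambda>k. (1 / k) *\<^sub>R (?P (h + k) - ?P h) - (1 / k) *\<^sub>R (?P (0 + k) - ?P 0)) \<longlongrightarrow> U h x - U 0 x) (at_right 0)"
    using h by (intro tendsto_diff orbit_integral_derivative x) auto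
  moreover have "\<forall>\<^sub>F k in at_right 0. (1 / k) *\<^sub>R (?P (h + k) - ?P h) - (1 / k) *\<^sub>R (?P (0 + k) - ?P 0)
     = (1 / k) *\<^sub>R (U k (?P h) - ?P h)"
    using eventually_nonneg_at_right
  proof eventually_elim
    case (elim k)
    have "?P 0 = 0" by (simp add: orbit_integral_def)
    then have "(?P (h + k) - ?P h) - (?P (0 + k) - ?P 0) = U k (?P h) - ?P h"
      using U_orbit_integral[OF x elim h] by (simp add: add.commute)
    then show ?case by (metis scaleR_diff_right)
  qed
  ultimately have "((\<lambda>k. (1 / k) *\<^sub>R (U k (?P h) - ?P h)) \<longlongrightarrow> U h x - U 0 x) (at_right 0)"
    by (rule Lim_transform_eventually)
  then show ?thesis
    using x h by (simp add: gen_def U_0 orbit_integral_in V_diff U_in)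
qed

text \<open>The means of the orbit over \<open>[0, k]\<close> lie in the domain and tend to
  \<open>x\<close>.\<close>

lemma gen_dense:
  assumes "x \<in> V" "0 < e"
  shows "\<exists>r y. gen r y \<and> norm (r - x) < e"
proof -
  have "((\<lambda>k. (1 / k) *\<^sub>R (orbit_integral x (0 + k) - orbit_integral x 0)) \<longlongrightarrow> U 0 x) (at_right 0)"
    using assms by (intro orbit_integral_derivative) auto
  then have "((\<lambda>k. (1 / k) *\<^sub>R orbit_integral x k) \<longlongrightarrow> x) (at_right 0)"
    using assms by (simp add: U_0 orbit_integral_def)
  then have "\<forall>\<^sub>F k in at_right 0. dist ((1 / k) *\<^sub>R orbit_integral x k) x < e"
    using assms by (intro tendstoD)
  then have "\<forall>\<^sub>F k in at_right 0. dist ((1 / k) *\<^sub>R orbit_integral x k) x < e \<and> 0 \<le> k"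
    using eventually_nonneg_at_right by (rule eventually_conj)
  then obtain k where "dist ((1 / k) *\<^sub>R orbit_integral x k) x < e" "0 \<le> k"
    using eventually_happens trivial_limit_at_right_real by blast
  then show ?thesis
    using gen_scale[OF gen_orbit_integral[OF assms(1), of k]] by (auto simp: dist_norm)
qed

lemma gen_integral:
  assumes "gen x y" "0 \<le> t"
  shows "((\<lambda>s. U s y) has_integral (U t x - x)) {0..t}"
  using fundamental_theorem_of_calculus[of 0 t "\<lambda>s. U s x" "\<lambda>s. U s y"] assms
    has_vector_derivative_within_subset[OF orbit_derivative[OF assms(1)]]
  by (force simp: U_0 genD)

lemma exp_has_integral:
  assumes "(c::real) \<noteq> 0" "0 \<le> t"
  shows "((\<lambda>s. exp (c * s)) has_integral (exp (c * t) - 1) / c) {0..t}"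
proof -
  have "((\<lambda>s. exp (c * s)) has_integral (exp (c * t) / c - exp (c * 0) / c)) {0..t}"
    using assms
    by (intro fundamental_theorem_of_calculus)
      (auto intro!: derivative_eq_intros simp: has_real_derivative_iff_has_vector_derivative[symmetric])
  then show ?thesis by (simp add: diff_divide_distrib)
qed

lemma orbit_integral_bound:
  assumes x: "x \<in> V" and w: "w < 0" and t: "0 \<le> t"
  shows "norm (orbit_integral x t) \<le> K / (- w) * norm x"
proof -
  have int: "((\<lambda>s. K * norm x * exp (w * s)) has_integral K * norm x * ((exp (w * t) - 1) / w)) {0..t}"
    using w t by (intro has_integral_mult_right exp_has_integral) auto
  have "norm (orbit_integral x t) \<le> integral {0..t} (\<lambda>s. K * norm x * exp (w * s))"
    unfolding orbit_integral_def
    by (rule integral_norm_bound_integral[OF orbit_integrable[OF x order_refl] has_integral_integrable[OF int]])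
      (use x U_bound in \<open>auto simp: mult_ac\<close>)
  also have "\<dots> = K * norm x * ((exp (w * t) - 1) / w)"
    using int by (rule integral_unique)
  also have "(exp (w * t) - 1) / w \<le> 1 / (- w)"
    using w by (simp add: divide_simps)
  then have "K * norm x * ((exp (w * t) - 1) / w) \<le> K * norm x * (1 / (- w))"
    using K_nonneg by (intro mult_left_mono) auto
  finally show ?thesis by simp
qed

lemma exp_stable_tendsto:
  assumes "w < 0"
  shows "((\<lambda>t. exp (w * t)) \<longlongrightarrow> 0) at_top"
proof -
  have "filterlim (\<lambda>t. w * t) at_bot at_top"
    using assms by (intro filterlim_tendsto_neg_mult_at_bot[OF tendsto_const _ filterlim_ident])
  then show ?thesis
    by (rule filterlim_compose[OF exp_at_bot])
qed

text \<open>Integrating the orbit of \<open>y\<close> gives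
  \<open>r = U t r - orbit_integral y t\<close>. As \<open>t\<close> grows, the first term decays
  and the second stays bounded, so the generator is injective with this bound on its
  inverse.\<close>

lemma stable_estimate:
  assumes g: "gen r y" and w: "w < 0"
  shows "norm r \<le> K / (- w) * norm y"
proof -
  have *: "norm r \<le> K * exp (w * t) * norm r + K / (- w) * norm y" if "0 \<le> t" for t
  proof -
    have "U t r - r = orbit_integral y t"
      unfolding orbit_integral_def using gen_integral[OF g that] by (simp add: integral_unique)
    then have "norm (U t r - r) \<le> K / (- w) * norm y"
      using orbit_integral_bound[OF _ w that, of y] g by (simp add: genD)
    moreover have "norm r \<le> norm (U t r) + norm (U t r - r)"
      by (metis norm_triangle_sub norm_minus_commute)
    ultimately show ?thesis using U_bound[OF that, of r] g genD by fastforce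
  qed
  have lim: "((\<lambda>t. K * exp (w * t) * norm r + K / (- w) * norm y) \<longlongrightarrow> K * 0 * norm r + K / (- w) * norm y) at_top"
    by (rule tendsto_add[OF tendsto_mult[OF tendsto_mult[OF tendsto_const exp_stable_tendsto[OF w]] tendsto_const] tendsto_const])
  have "\<forall>\<^sub>F t in at_top. norm r \<le> K * exp (w * t) * norm r + K / (- w) * norm y"
    using eventually_ge_at_top[of "0::real"] by (rule eventually_mono) (rule *)
  then show ?thesis
    using tendsto_lowerbound[OF lim] by simp
qed

text \<open>Surjectivity: the candidate is the integral of the orbit over the half line, taken along
  integer times. Exponential decay of the tails makes the sequence Cauchy.\<close>

lemma stable_inverse:
  assumes x: "x \<in> V" and w: "w < 0"
  shows "\<exists>r. gen r (- x) \<and> (\<lambda>n. orbit_integral x (real n)) \<longlonglongrightarrow> r"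
proof -
  let ?P = "orbit_integral x"
  define c where "c = K * (K / (- w) * norm x)"
  have bd: "norm (?P (m + h) - ?P m) \<le> c * exp (w * m)" if "0 \<le> m" "0 \<le> h" for m h
  proof -
    have "norm (?P (m + h) - ?P m) \<le> K * exp (w * m) * norm (?P h)"
      using U_orbit_integral[OF x, of m h] U_bound[of m "?P h"] x that by (simp add: orbit_integral_in)
    also have "\<dots> \<le> K * exp (w * m) * (K / (- w) * norm x)"
      using K_nonneg by (intro mult_left_mono orbit_integral_bound x w that) auto
    finally show ?thesis by (simp add: c_def mult_ac)
  qed
  have lim0: "(\<lambda>n. c * exp (w * real n)) \<longlonglongrightarrow> 0"
    by (rule tendsto_mult_right_zero[OF filterlim_compose[OF exp_stable_tendsto[OF w] filterlim_real_sequentially]])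
  have "Cauchy (\<lambda>n. ?P (real n))"
  proof (rule CauchyI')
    fix e :: real assume "0 < e"
    then have "\<forall>\<^sub>F n in sequentially. c * exp (w * real n) < e"
      using order_tendstoD(2)[OF lim0] by blast
    then obtain N where N: "\<And>n. N \<le> n \<Longrightarrow> c * exp (w * real n) < e"
      by (auto simp: eventually_sequentially)
    have "dist (?P (real m)) (?P (real n)) < e" if "N \<le> m" "m < n" for m n
      using N[OF that(1)] bd[of "real m" "real n - real m"] that
      by (simp add: dist_norm norm_minus_commute)
    then show "\<exists>M. \<forall>m\<ge>M. \<forall>n>m. dist (?P (real m)) (?P (real n)) < e" by blast
  qed
  then obtain r where r: "(\<lambda>n. ?P (real n)) \<longlonglongrightarrow> r"
    by (auto simp: Cauchy_convergent_iff convergent_def)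
  have rV: "r \<in> V"
    using closed_V r x by (meson closed_sequentially orbit_integral_in)
  \<comment> \<open>The limit of the shift formula. Since the right derivative of \<open>?P\<close>
    at 0 is \<open>x\<close>, this identity puts \<open>r\<close> into the domain with value
    \<open>- x\<close>.\<close>
  have eq: "U k r = r - ?P k" if "0 \<le> k" for k
  proof (rule LIMSEQ_unique)
    show "(\<lambda>n. U k (?P (real n))) \<longlonglongrightarrow> U k r"
      using r that rV x by (intro U_tendsto_joint) (auto simp: orbit_integral_in)
    have "(\<lambda>n. ?P (real n + k) - ?P (real n)) \<longlonglongrightarrow> 0"
      by (rule Lim_null_comparison[OF _ lim0]) (use bd that in auto)
    then have "(\<lambda>n. ?P (real n + k)) \<longlonglongrightarrow> r"
      using tendsto_add[OF _ r] by fastforce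
    then have "(\<lambda>n. ?P (real n + k) - ?P k) \<longlonglongrightarrow> r - ?P k"
      by (rule tendsto_diff[OF _ tendsto_const])
    then show "(\<lambda>n. U k (?P (real n))) \<longlonglongrightarrow> r - ?P k"
      using U_orbit_integral x that by (simp add: add.commute)
  qed
  have "((\<lambda>k. - ((1 / k) *\<^sub>R (?P (0 + k) - ?P 0))) \<longlongrightarrow> - U 0 x) (at_right 0)"
    by (intro tendsto_minus orbit_integral_derivative x) auto
  moreover have "\<forall>\<^sub>F k in at_right 0. - ((1 / k) *\<^sub>R (?P (0 + k) - ?P 0)) = (1 / k) *\<^sub>R (U k r - r)"
    using eventually_nonneg_at_right
    by eventually_elim (simp add: eq, simp add: orbit_integral_def)
  ultimately have "((\<lambda>k. (1 / k) *\<^sub>R (U k r - r)) \<longlongrightarrow> - U 0 x) (at_right 0)"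
    by (rule Lim_transform_eventually)
  then have "gen r (- x)"
    using x rV V_scale[of x "-1"] by (simp add: gen_def U_0)
  then show ?thesis using r by blast
qed

text \<open>For \<open>l > w\<close> the rescaled semigroup has negative growth, so that the
  resolvent at \<open>l\<close> is minus the inverse of a stable generator.\<close>

lemma rescaled: "c0_semigroup V (\<lambda>t x. exp (- (l * t)) *\<^sub>R U t x) K (w - l)"
proof
  show "norm (exp (- (l * t)) *\<^sub>R U t x) \<le> K * exp ((w - l) * t) * norm x" if "0 \<le> t" "x \<in> V" for t x
  proof -
    have "exp ((w - l) * t) = exp (- (l * t)) * exp (w * t)"
      by (simp add: exp_add[symmetric] algebra_simps)
    then show ?thesis
      using mult_left_mono[OF U_bound[OF that], of "exp (- (l * t))"] by (simp add: mult_ac)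
  qed
  show "((\<lambda>t. exp (- (l * t)) *\<^sub>R U t x) \<longlongrightarrow> x) (at_right 0)" if "x \<in> V" for x
  proof -
    have "((\<lambda>t. exp (- (l * t)) *\<^sub>R U t x) \<longlongrightarrow> exp (- (l * 0)) *\<^sub>R x) (at_right 0)"
      by (intro tendsto_scaleR U_tendsto that tendsto_exp tendsto_minus tendsto_mult tendsto_const tendsto_ident_at)
    then show ?thesis by simp
  qed
  show "exp (- (l * (s + t))) *\<^sub>R U (s + t) x = exp (- (l * s)) *\<^sub>R U s (exp (- (l * t)) *\<^sub>R U t x)"
    if "0 \<le> s" "0 \<le> t" "x \<in> V" for s t x
    using that by (simp add: U_plus U_scale U_in exp_add[symmetric] algebra_simps)
qed (auto simp: closed_V subspace_V K_nonneg U_in U_add U_scale U_0 V_scale scaleR_add_right)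

lemma rescaled_gen:
  "c0_semigroup.gen V (\<lambda>t x. exp (- (l * t)) *\<^sub>R U t x) x (y - l *\<^sub>R x) \<longleftrightarrow> gen x y"
proof -
  interpret R: c0_semigroup V "\<lambda>t x. exp (- (l * t)) *\<^sub>R U t x" K "w - l" by (rule rescaled)
  have "((\<lambda>t. (1 / t) *\<^sub>R (exp (- (l * t)) *\<^sub>R U t x - x)) \<longlongrightarrow> y - l *\<^sub>R x) (at_right 0) \<longleftrightarrow>
     ((\<lambda>t. (1 / t) *\<^sub>R (U t x - x)) \<longlongrightarrow> y) (at_right 0)"
    using tendsto_quotient_exp_scale[of "\<lambda>t. U t x" x y "- l"]
      tendsto_quotient_exp_scale[of "\<lambda>t. exp (- (l * t)) *\<^sub>R U t x" x "y - l *\<^sub>R x" l]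
    by (auto simp: exp_add[symmetric])
  moreover have "x \<in> V \<Longrightarrow> y - l *\<^sub>R x \<in> V \<longleftrightarrow> y \<in> V"
    using V_diff[of y "l *\<^sub>R x"] V_add[of "y - l *\<^sub>R x" "l *\<^sub>R x"] V_scale by auto
  ultimately show ?thesis
    unfolding R.gen_def gen_def by blast
qed

section \<open>Resolvents as Laplace transforms, and their strong limits\<close>

definition resolv :: "real \<Rightarrow> 'e \<Rightarrow> 'e" where
  "resolv l x = (SOME r. gen r (l *\<^sub>R r - x))"

lemma resolv_estimate:
  assumes "w < l" "gen r y"
  shows "norm r \<le> K / (l - w) * norm (l *\<^sub>R r - y)"
proof -
  interpret R: c0_semigroup V "\<lambda>t x. exp (- (l * t)) *\<^sub>R U t x" K "w - l" by (rule rescaled)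
  show ?thesis
    using R.stable_estimate[of r "y - l *\<^sub>R r"] assms by (simp add: rescaled_gen norm_minus_commute)
qed

lemma resolv_unique:
  assumes "w < l" "gen r y" "gen r' y'" "l *\<^sub>R r - y = l *\<^sub>R r' - y'"
  shows "r = r'"
proof -
  have "l *\<^sub>R (r - r') - (y - y') = 0"
    using assms(4) by (simp add: algebra_simps)
  then have "norm (r - r') \<le> K / (l - w) * 0"
    using resolv_estimate[OF assms(1) gen_diff[OF assms(2,3)]] by simp
  then show ?thesis by simp
qed

lemma resolv_limit_gen:
  assumes l: "w < l" and x: "x \<in> V"
  shows "gen (resolv l x) (l *\<^sub>R resolv l x - x) \<and>
    (\<lambda>n. integral {0..real n} (\<lambda>s. exp (- (l * s)) *\<^sub>R U s x)) \<longlonglongrightarrow> resolv l x"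
proof -
  interpret R: c0_semigroup V "\<lambda>t x. exp (- (l * t)) *\<^sub>R U t x" K "w - l" by (rule rescaled)
  obtain r where r: "R.gen r (- x)" "(\<lambda>n. R.orbit_integral x (real n)) \<longlonglongrightarrow> r"
    using R.stable_inverse[OF x] l by auto
  then have g: "gen r (l *\<^sub>R r - x)"
    using rescaled_gen[where l = l and x = r and y = "l *\<^sub>R r - x"] by simp
  then have g': "gen (resolv l x) (l *\<^sub>R resolv l x - x)"
    unfolding resolv_def by (rule someI)
  then have "resolv l x = r"
    using resolv_unique[OF l g' g] by simp
  then show ?thesis
    using g' r(2) by (simp add: R.orbit_integral_def)
qed

lemma gen_resolv: "w < l \<Longrightarrow> x \<in> V \<Longrightarrow> gen (resolv l x) (l *\<^sub>R resolv l x - x)"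
  and resolv_limit: "w < l \<Longrightarrow> x \<in> V \<Longrightarrow>
    (\<lambda>n. integral {0..real n} (\<lambda>s. exp (- (l * s)) *\<^sub>R U s x)) \<longlonglongrightarrow> resolv l x"
  using resolv_limit_gen by auto

lemma resolv_in: "w < l \<Longrightarrow> x \<in> V \<Longrightarrow> resolv l x \<in> V"
  using gen_resolv genD by blast

lemma resolv_eqI:
  assumes l: "w < l" and g: "gen r y" and eq: "l *\<^sub>R r - y = x"
  shows "r = resolv l x"
proof -
  have "x \<in> V" using genD[OF g] V_diff V_scale eq by blast
  then show ?thesis
    using resolv_unique[OF l g gen_resolv[OF l]] eq by simp
qed

lemma resolv_bound: "w < l \<Longrightarrow> x \<in> V \<Longrightarrow> norm (resolv l x) \<le> K / (l - w) * norm x"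
  using resolv_estimate[OF _ gen_resolv, of l l x] by simp

lemma resolv_add:
  assumes "w < l" "x \<in> V" "y \<in> V"
  shows "resolv l (x + y) = resolv l x + resolv l y"
  using resolv_eqI[OF assms(1) gen_add[OF gen_resolv[OF assms(1,2)] gen_resolv[OF assms(1,3)]], of "x + y"]
  by (simp add: algebra_simps)

lemma resolv_scale:
  assumes "w < l" "x \<in> V"
  shows "resolv l (c *\<^sub>R x) = c *\<^sub>R resolv l x"
  using resolv_eqI[OF assms(1) gen_scale[OF gen_resolv[OF assms(1,2)]], of c "c *\<^sub>R x"]
  by (simp add: algebra_simps)

lemma resolv_diff:
  assumes "w < l" "x \<in> V" "y \<in> V"
  shows "resolv l (x - y) = resolv l x - resolv l y"
  using resolv_add[OF assms(1,2), of "(-1) *\<^sub>R y"] resolv_scale[OF assms(1,3), of "-1"] assms V_scale[of y "-1"] by simp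

lemma U_resolv:
  assumes "w < l" "x \<in> V" "0 \<le> t"
  shows "U t (resolv l x) = resolv l (U t x)"
  using resolv_eqI[OF assms(1) gen_U[OF gen_resolv[OF assms(1,2)] assms(3)], of "U t x"] assms
  by (simp add: U_diff U_scale V_scale resolv_in)

lemma resolv_gen:
  assumes "w < l" "gen x y"
  shows "resolv l y = l *\<^sub>R resolv l x - x"
proof -
  have "x \<in> V" "y \<in> V" using assms(2) by (auto dest: genD)
  moreover have "x = resolv l (l *\<^sub>R x - y)" using resolv_eqI[OF assms] by simp
  ultimately have "x = l *\<^sub>R resolv l x - resolv l y"
    using assms(1) by (simp add: resolv_diff resolv_scale V_scale)
  then show ?thesis by (simp add: algebra_simps)
qed

text \<open>The Laplace integrals have values in the cone. For nonnegative functions this is the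
  positivity of the resolvent.\<close>

lemma resolv_cone:
  assumes C: "closed C" "C \<subseteq> V" "0 \<in> C" "\<And>x y. x \<in> C \<Longrightarrow> y \<in> C \<Longrightarrow> x + y \<in> C"
    "\<And>c x. 0 \<le> c \<Longrightarrow> x \<in> C \<Longrightarrow> c *\<^sub>R x \<in> C"
    and U: "\<And>t x. 0 \<le> t \<Longrightarrow> x \<in> C \<Longrightarrow> U t x \<in> C"
    and l: "w < l" and x: "x \<in> C"
  shows "resolv l x \<in> C"
proof -
  interpret R: c0_semigroup V "\<lambda>t x. exp (- (l * t)) *\<^sub>R U t x" K "w - l" by (rule rescaled)
  have xV: "x \<in> V" using C x by auto
  have "integral {0..real n} (\<lambda>s. exp (- (l * s)) *\<^sub>R U s x) \<in> C" for n
    by (rule has_integral_in_closed_cone[OF C(1,3,4,5) integrable_integral[OF R.orbit_integrable[OF xV order_refl]]])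
      (auto intro!: C(5) U x)
  then show ?thesis
    using closed_sequentially[OF C(1) _ resolv_limit[OF l xV]] by blast
qed

text \<open>On the domain the error \<open>l *\<^sub>R resolv l r - r\<close> equals
  \<open>resolv l y\<close>, which is of order \<open>1 / l\<close>. Density of the domain and a
  bound on \<open>l *\<^sub>R resolv l\<close> uniform in large \<open>l\<close> do the
  rest.\<close>

lemma resolv_approx:
  assumes x: "x \<in> V"
  shows "((\<lambda>l. l *\<^sub>R resolv l x) \<longlongrightarrow> x) at_top"
proof (rule tendstoI)
  fix e :: real assume e: "0 < e"
  \<comment> \<open>For \<open>l > 2 * \<bar>w\<bar> + 1\<close> one has
    \<open>l \<le> 2 * (l - w)\<close>, so \<open>l *\<^sub>R resolv l\<close> has norm at most
    \<open>2 * K\<close>. The added 1 keeps \<open>L\<close> positive when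
    \<open>K = 0\<close>.\<close>
  define L where "L = 2 * K + 1"
  have L: "0 < L" using K_nonneg by (simp add: L_def)
  obtain r y where r: "gen r y" "norm (r - x) < e / (2 * (L + 1))"
    using gen_dense[OF x, of "e / (2 * (L + 1))"] e L by auto
  have lim: "((\<lambda>l. K / (l - w) * norm y) \<longlongrightarrow> 0) at_top"
    by real_asymp
  have "\<forall>\<^sub>F l in at_top. K / (l - w) * norm y < e / 2"
    using order_tendstoD(2)[OF lim, of "e / 2"] e by simp
  moreover have "\<forall>\<^sub>F l in at_top. 2 * \<bar>w\<bar> + 1 < l" by (rule eventually_gt_at_top)
  ultimately show "\<forall>\<^sub>F l in at_top. dist (l *\<^sub>R resolv l x) x < e"
  proof eventually_elim
    case (elim l)
    have l: "w < l" "0 < l" and l2: "l \<le> 2 * (l - w)" using elim by (auto simp: abs_if split: if_splits)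
    have rV: "r \<in> V" using r genD by blast
    have "l *\<^sub>R resolv l x - x = l *\<^sub>R resolv l (x - r) + resolv l y - (x - r)"
      using resolv_gen[OF l(1) r(1)] resolv_diff[OF l(1) x rV] by (simp add: scaleR_diff_right)
    then have "norm (l *\<^sub>R resolv l x - x) = norm (l *\<^sub>R resolv l (x - r) + resolv l y - (x - r))"
      by (rule arg_cong)
    then have "norm (l *\<^sub>R resolv l x - x) \<le> norm (l *\<^sub>R resolv l (x - r)) + norm (resolv l y) + norm (x - r)"
      using norm_triangle_ineq4[of "l *\<^sub>R resolv l (x - r) + resolv l y" "x - r"]
        norm_triangle_ineq[of "l *\<^sub>R resolv l (x - r)" "resolv l y"] by linarith
    moreover have "norm (l *\<^sub>R resolv l (x - r)) \<le> L * norm (x - r)"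
    proof -
      have "norm (l *\<^sub>R resolv l (x - r)) \<le> l * (K / (l - w) * norm (x - r))"
        using mult_left_mono[OF resolv_bound[OF l(1) V_diff[OF x rV]], of l] l by simp
      also have "\<dots> = (l / (l - w)) * K * norm (x - r)" by simp
      also have "l / (l - w) \<le> 2" using l l2 by (simp add: divide_simps)
      then have "(l / (l - w)) * K * norm (x - r) \<le> 2 * K * norm (x - r)"
        using K_nonneg by (intro mult_right_mono) auto
      also have "\<dots> \<le> L * norm (x - r)" by (intro mult_right_mono) (auto simp: L_def)
      finally show ?thesis .
    qed
    moreover have "norm (resolv l y) < e / 2"
      using resolv_bound[OF l(1) genD(2)[OF r(1)]] elim(1) by linarith
    moreover have "(L + 1) * norm (x - r) < e / 2"
      using r(2) L by (simp add: norm_minus_commute field_simps)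
    ultimately show ?case by (simp add: dist_norm algebra_simps)
  qed
qed

lemma resolv_approx_gen:
  assumes g: "gen x y"
  shows "((\<lambda>l. l *\<^sub>R (l *\<^sub>R resolv l x - x)) \<longlongrightarrow> y) at_top"
proof -
  have "\<forall>\<^sub>F l in at_top. l *\<^sub>R resolv l y = l *\<^sub>R (l *\<^sub>R resolv l x - x)"
    using eventually_gt_at_top[of w] by (rule eventually_mono) (simp add: resolv_gen g)
  then show ?thesis
    by (rule Lim_transform_eventually[OF resolv_approx[OF genD(2)[OF g]]])
qed

lemma resolv_tendsto:
  assumes l: "w < l" and g: "(g \<longlongrightarrow> x) F" "\<forall>\<^sub>F i in F. g i \<in> V" and x: "x \<in> V"
  shows "((\<lambda>i. resolv l (g i)) \<longlongrightarrow> resolv l x) F"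
proof (rule LIM_zero_cancel[OF tendsto_0_le[OF LIM_zero[OF g(1)]]])
  show "\<forall>\<^sub>F i in F. norm (resolv l (g i) - resolv l x) \<le> norm (g i - x) * (K / (l - w))"
    using g(2)
    by (rule eventually_mono)
      (metis l mult.commute resolv_bound resolv_diff V_diff x)
qed

end

text \<open>A product rule for two different semigroups. \<open>T (t - s) u\<close> lies in the
  domain of the generator of \<open>T\<close> only; applying \<open>R\<close> first brings it into
  the domain of the generator of \<open>S\<close>, so that both factors can be
  differentiated.\<close>

lemma mixed_orbit_derivative:
  assumes S: "c0_semigroup V S K w" and T: "c0_semigroup V T K' w'" and l: "w < l"
    and u: "c0_semigroup.gen V T u y" and s: "s \<in> {0..t}"
  defines "R \<equiv> c0_semigroup.resolv V S l"
  shows "((\<lambda>s. S s (R (T (t - s) u))) has_vector_derivative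
      S s (l *\<^sub>R R (T (t - s) u) - T (t - s) u) - S s (R (T (t - s) y))) (at s within {0..t})"
proof (rule has_vector_derivative_quotient)
  interpret S: c0_semigroup V S K w by (rule S)
  interpret T: c0_semigroup V T K' w' by (rule T)
  let ?F = "at s within {0..t}"
  define z where "z = T (t - s) u"
  have uV: "u \<in> V" and yV: "y \<in> V" using T.genD[OF u] .
  have zV: "z \<in> V" using s uV by (simp add: z_def T.U_in)
  have ev: "\<forall>\<^sub>F r in ?F. r \<in> {0..t}" by (auto simp: eventually_at_filter)
  \<comment> \<open>The quotient of the inner factor. The reversed time \<open>t - r\<close> is the
    origin of the sign in its limit; the outer operator at time \<open>r\<close> is then handled by
    joint continuity.\<close>
  define q where "q = (\<lambda>r. (1 / (r - s)) *\<^sub>R (T (t - r) u - z))"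
  have "(\<lambda>r. t - r) ` {0..t} = {0..t}" by auto
  then have "((\<lambda>r. T r u) has_vector_derivative T (t - s) y) (at (t - s) within (\<lambda>r. t - r) ` {0..t})"
    using has_vector_derivative_within_subset[OF T.orbit_derivative[OF u, of "t - s"], of "{0..t}"] s by auto
  moreover have "((\<lambda>r. t - r) has_vector_derivative - 1) ?F"
    by (auto intro!: derivative_eq_intros simp: has_real_derivative_iff_has_vector_derivative[symmetric])
  ultimately have "((\<lambda>r. T r u) \<circ> (\<lambda>r. t - r) has_vector_derivative (- 1) *\<^sub>R T (t - s) y) ?F"
    by (intro vector_diff_chain_within)
  then have q: "(q \<longlongrightarrow> (- 1) *\<^sub>R T (t - s) y) ?F"
    using has_vector_derivative_quotientD[of "(\<lambda>r. T r u) \<circ> (\<lambda>r. t - r)"] by (simp add: q_def z_def o_def)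
  have qV: "\<forall>\<^sub>F r in ?F. q r \<in> V"
    using ev by (rule eventually_mono) (auto simp: q_def S.V_scale S.V_diff T.U_in uV zV)
  have TyV: "T (t - s) y \<in> V" using s yV by (simp add: T.U_in)
  have Rq: "((\<lambda>r. R (q r)) \<longlongrightarrow> R ((- 1) *\<^sub>R T (t - s) y)) ?F"
    unfolding R_def by (intro S.resolv_tendsto l q qV S.V_scale TyV)
  have 1: "((\<lambda>r. S r (R (q r))) \<longlongrightarrow> S s (R ((- 1) *\<^sub>R T (t - s) y))) ?F"
  proof (rule S.U_tendsto_joint[OF tendsto_ident_at Rq])
    show "\<forall>\<^sub>F r in ?F. R (q r) \<in> V"
      using qV by (rule eventually_mono) (simp add: R_def S.resolv_in l)
    show "R ((- 1) *\<^sub>R T (t - s) y) \<in> V"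
      unfolding R_def by (intro S.resolv_in l S.V_scale TyV)
  qed (use ev s in \<open>auto elim: eventually_mono\<close>)
  have "((\<lambda>r. S r (R z)) has_vector_derivative S s (l *\<^sub>R R z - z)) ?F"
    using s has_vector_derivative_within_subset[OF S.orbit_derivative[OF S.gen_resolv[OF l zV], of s], of "{0..t}"]
    by (auto simp: R_def)
  then have 2: "((\<lambda>r. (1 / (r - s)) *\<^sub>R (S r (R z) - S s (R z))) \<longlongrightarrow> S s (l *\<^sub>R R z - z)) ?F"
    by (rule has_vector_derivative_quotientD)
  have ev_eq: "\<forall>\<^sub>F r in ?F. S r (R (q r)) + (1 / (r - s)) *\<^sub>R (S r (R z) - S s (R z)) =
     (1 / (r - s)) *\<^sub>R (S r (R (T (t - r) u)) - S s (R (T (t - s) u)))"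
    using ev
  proof (rule eventually_mono)
    fix r assume r: "r \<in> {0..t}"
    then have TV: "T (t - r) u \<in> V" by (simp add: T.U_in uV)
    have "S r (R (q r)) = (1 / (r - s)) *\<^sub>R (S r (R (T (t - r) u)) - S r (R z))"
      using r unfolding q_def R_def
      by (simp add: S.resolv_scale S.resolv_diff S.U_scale S.U_diff S.resolv_in l TV zV S.V_diff)
    then show "S r (R (q r)) + (1 / (r - s)) *\<^sub>R (S r (R z) - S s (R z)) =
     (1 / (r - s)) *\<^sub>R (S r (R (T (t - r) u)) - S s (R (T (t - s) u)))"
      by (simp add: z_def scaleR_diff_right)
  qed
  show "((\<lambda>r. (1 / (r - s)) *\<^sub>R (S r (R (T (t - r) u)) - S s (R (T (t - s) u)))) \<longlongrightarrow>
     S s (l *\<^sub>R R (T (t - s) u) - T (t - s) u) - S s (R (T (t - s) y))) ?F"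
  proof -
    have "R ((- 1) *\<^sub>R T (t - s) y) = (- 1) *\<^sub>R R (T (t - s) y)"
      unfolding R_def by (rule S.resolv_scale[OF l TyV])
    then have "S s (R ((- 1) *\<^sub>R T (t - s) y)) = - S s (R (T (t - s) y))"
      using S.U_scale[of s "R (T (t - s) y)" "- 1"] s S.resolv_in[OF l TyV] by (simp add: R_def)
    then show ?thesis
      using Lim_transform_eventually[OF tendsto_add[OF 1 2] ev_eq] by (simp add: z_def)
  qed
qed

text \<open>Extension by continuity from a dense invariant subspace. All algebraic laws pass to the
  limit along approximating sequences; strong continuity needs the bound to be uniform for small
  times.\<close>

lemma c0_semigroup_extension:
  fixes U :: "real \<Rightarrow> 'e::banach \<Rightarrow> 'e"
  assumes closed_V: "closed V" and subspace_V: "subspace V" and K: "0 \<le> K"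
    and D: "D \<subseteq> V" "subspace D" "V \<subseteq> closure D"
    and U_in: "\<And>t x. 0 \<le> t \<Longrightarrow> x \<in> D \<Longrightarrow> U t x \<in> D"
    and U_add: "\<And>t x y. 0 \<le> t \<Longrightarrow> x \<in> D \<Longrightarrow> y \<in> D \<Longrightarrow> U t (x + y) = U t x + U t y"
    and U_scale: "\<And>t x c. 0 \<le> t \<Longrightarrow> x \<in> D \<Longrightarrow> U t (c *\<^sub>R x) = c *\<^sub>R U t x"
    and U_bound: "\<And>t x. 0 \<le> t \<Longrightarrow> x \<in> D \<Longrightarrow> norm (U t x) \<le> K * exp (w * t) * norm x"
    and U_0: "\<And>x. x \<in> D \<Longrightarrow> U 0 x = x"
    and U_plus: "\<And>s t x. 0 \<le> s \<Longrightarrow> 0 \<le> t \<Longrightarrow> x \<in> D \<Longrightarrow> U (s + t) x = U s (U t x)"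
    and U_tendsto: "\<And>x. x \<in> D \<Longrightarrow> ((\<lambda>t. U t x) \<longlongrightarrow> x) (at_right 0)"
  shows "\<exists>U'. c0_semigroup V U' K w \<and> (\<forall>t\<ge>0. \<forall>x\<in>D. U' t x = U t x)"
proof -
  let ?c = "\<lambda>t. K * exp (w * t)"
  have U_diff: "U t (x - y) = U t x - U t y" if "0 \<le> t" "x \<in> D" "y \<in> D" for t x y
    using U_add[of t "x - y" y] that D(2) by (simp add: subspace_diff algebra_simps)
  have dist_U: "norm (U t x - U t y) \<le> ?c t * norm (x - y)" if "0 \<le> t" "x \<in> D" "y \<in> D" for t x y
    using U_bound[of t "x - y"] that D(2) by (simp add: U_diff subspace_diff)
  have approx: "\<exists>d. (\<forall>n. d n \<in> D) \<and> d \<longlonglongrightarrow> x" if "x \<in> V" for x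
    using that D(3) by (auto simp: closure_sequential)
  have ex: "\<exists>z. \<forall>d\<in>D. norm (z - U t d) \<le> ?c t * norm (x - d)" if x: "x \<in> V" and t: "0 \<le> t" for t x
  proof -
    obtain d where d: "\<And>n. d n \<in> D" "d \<longlonglongrightarrow> x" using approx[OF x] by blast
    have "Cauchy (\<lambda>n. U t (d n))"
    proof (rule metric_CauchyI)
      fix e :: real assume e: "0 < e"
      have "Cauchy d" using d(2) by (rule LIMSEQ_imp_Cauchy)
      then obtain N where N: "\<And>m n. N \<le> m \<Longrightarrow> N \<le> n \<Longrightarrow> dist (d m) (d n) < e / (?c t + 1)"
        using e K unfolding Cauchy_def by (metis add_nonneg_pos divide_pos_pos exp_ge_zero mult_nonneg_nonneg zero_less_one)
      have "dist (U t (d m)) (U t (d n)) < e" if "N \<le> m" "N \<le> n" for m n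
      proof -
        have "dist (U t (d m)) (U t (d n)) \<le> ?c t * dist (d m) (d n)"
          using dist_U[OF t d(1) d(1)] by (simp add: dist_norm)
        also have "\<dots> \<le> (?c t + 1) * dist (d m) (d n)" by (simp add: distrib_right)
        also have "\<dots> < (?c t + 1) * (e / (?c t + 1))"
          using N[OF that] K by (intro mult_strict_left_mono) (auto intro: add_nonneg_pos)
        also have "\<dots> = e" using K by (simp add: add_nonneg_eq_0_iff)
        finally show ?thesis .
      qed
      then show "\<exists>M. \<forall>m\<ge>M. \<forall>n\<ge>M. dist (U t (d m)) (U t (d n)) < e" by blast
    qed
    then obtain z where z: "(\<lambda>n. U t (d n)) \<longlonglongrightarrow> z"
      by (auto simp: Cauchy_convergent_iff convergent_def)
    have "norm (z - U t b) \<le> ?c t * norm (x - b)" if b: "b \<in> D" for b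
    proof (rule LIMSEQ_le)
      show "(\<lambda>n. norm (U t (d n) - U t b)) \<longlonglongrightarrow> norm (z - U t b)" by (intro tendsto_intros z)
      show "(\<lambda>n. ?c t * norm (d n - b)) \<longlonglongrightarrow> ?c t * norm (x - b)" by (intro tendsto_intros d)
    qed (use dist_U[OF t d(1) b] in auto)
    then show ?thesis by blast
  qed
  \<comment> \<open>The value is pinned down by its distance to the values on \<open>D\<close>, a
    condition that mentions no particular sequence. The fact \<open>lim\<close> below recovers it as
    the limit along every approximating sequence.\<close>
  define U' where "U' = (\<lambda>t x. SOME z. \<forall>d\<in>D. norm (z - U t d) \<le> ?c t * norm (x - d))"
  have U': "norm (U' t x - U t d) \<le> ?c t * norm (x - d)" if "x \<in> V" "0 \<le> t" "d \<in> D" for t x d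
    using someI_ex[OF ex[OF that(1,2)]] that(3) unfolding U'_def by blast
  have lim: "(\<lambda>n. U t (d n)) \<longlonglongrightarrow> U' t x" if "x \<in> V" "0 \<le> t" "\<And>n. d n \<in> D" "d \<longlonglongrightarrow> x" for t x d
  proof (rule LIM_zero_cancel[OF tendsto_0_le[OF LIM_zero[OF that(4)]]])
    show "\<forall>\<^sub>F n in sequentially. norm (U t (d n) - U' t x) \<le> norm (d n - x) * ?c t"
      using U'[OF that(1,2,3)] by (simp add: norm_minus_commute mult.commute)
  qed
  have agree: "U' t x = U t x" if "x \<in> D" "0 \<le> t" for t x
    using U'[of x t x] that D by auto
  have U'_in: "U' t x \<in> V" if t: "0 \<le> t" and x: "x \<in> V" for t x
  proof -
    obtain a where a: "\<And>n. a n \<in> D" "a \<longlonglongrightarrow> x"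
      using approx x by metis
    show ?thesis
      by (rule closed_sequentially[OF closed_V _ lim[OF x t a]]) (use U_in[OF t a(1)] D(1) in auto)
  qed
  have "c0_semigroup V U' K w"
  proof
    show "U' t x \<in> V" if "0 \<le> t" "x \<in> V" for t x
      using that by (rule U'_in)
    show "U' t (x + y) = U' t x + U' t y" if t: "0 \<le> t" and xy: "x \<in> V" "y \<in> V" for t x y
    proof -
      obtain a b where a: "\<And>n. a n \<in> D" "a \<longlonglongrightarrow> x" and b: "\<And>n. b n \<in> D" "b \<longlonglongrightarrow> y"
        using approx xy by metis
      have "(\<lambda>n. U t (a n + b n)) \<longlonglongrightarrow> U' t (x + y)"
        by (rule lim[OF _ t]) (use xy a b D subspace_V in \<open>auto simp: subspace_add intro: tendsto_add\<close>)
      moreover have "(\<lambda>n. U t (a n) + U t (b n)) \<longlonglongrightarrow> U' t x + U' t y"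
        by (intro tendsto_add lim xy t a b)
      ultimately show ?thesis
        using a b t by (auto simp: U_add intro: LIMSEQ_unique)
    qed
    show "U' t (c *\<^sub>R x) = c *\<^sub>R U' t x" if t: "0 \<le> t" and x: "x \<in> V" for t x c
    proof -
      obtain a where a: "\<And>n. a n \<in> D" "a \<longlonglongrightarrow> x"
        using approx x by metis
      have "(\<lambda>n. U t (c *\<^sub>R a n)) \<longlonglongrightarrow> U' t (c *\<^sub>R x)"
        by (rule lim[OF _ t]) (use x a D subspace_V in \<open>auto simp: subspace_scale intro: tendsto_scaleR\<close>)
      moreover have "(\<lambda>n. c *\<^sub>R U t (a n)) \<longlonglongrightarrow> c *\<^sub>R U' t x"
        by (intro tendsto_scaleR tendsto_const lim x t a)
      ultimately show ?thesis
        using a t by (auto simp: U_scale intro: LIMSEQ_unique)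
    qed
    show bd: "norm (U' t x) \<le> ?c t * norm x" if "0 \<le> t" "x \<in> V" for t x
      using U'[of x t 0] U_scale[of t 0 0] that D(2) by (simp add: subspace_0)
    show "U' 0 x = x" if x: "x \<in> V" for x
    proof -
      obtain a where a: "\<And>n. a n \<in> D" "a \<longlonglongrightarrow> x"
        using approx x by metis
      then show ?thesis
        using lim[OF x order_refl a] by (auto simp: U_0 intro: LIMSEQ_unique)
    qed
    show "U' (s + t) x = U' s (U' t x)" if st: "0 \<le> s" "0 \<le> t" and x: "x \<in> V" for s t x
    proof -
      obtain a where a: "\<And>n. a n \<in> D" "a \<longlonglongrightarrow> x"
        using approx x by metis
      have "(\<lambda>n. U s (U t (a n))) \<longlonglongrightarrow> U' s (U' t x)"
        by (rule lim[OF U'_in[OF st(2) x] st(1) U_in[OF st(2) a(1)] lim[OF x st(2) a]])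
      moreover have "(\<lambda>n. U (s + t) (a n)) \<longlonglongrightarrow> U' (s + t) x"
        by (rule lim) (use x a st in auto)
      ultimately show ?thesis
        using a st by (auto simp: U_plus intro: LIMSEQ_unique)
    qed
    show "((\<lambda>t. U' t x) \<longlongrightarrow> x) (at_right 0)" if x: "x \<in> V" for x
    proof (rule tendstoI)
      fix e :: real assume e: "0 < e"
      \<comment> \<open>Three errors: replacing \<open>x\<close> by \<open>d\<close> under the
        operator costs at most \<open>K * exp \<bar>w\<bar>\<close> times \<open>e / L\<close>, the
        motion of \<open>d\<close> and the distance from \<open>d\<close> to \<open>x\<close> cost
        less than \<open>e / L\<close> each.\<close>
      define L where "L = K * exp \<bar>w\<bar> + 2"
      have L: "0 < L" using K by (simp add: L_def add_nonneg_pos)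
      have "0 < e / L" using e L by simp
      then obtain d where d: "d \<in> D" "dist d x < e / L"
        using x D(3) by (metis closure_approachable subsetD)
      have "\<forall>\<^sub>F t in at_right 0. dist (U t d) d < e / L"
        using U_tendsto[OF d(1)] \<open>0 < e / L\<close> by (rule tendstoD)
      moreover have "\<forall>\<^sub>F t in at_right (0::real). 0 < t \<and> t < 1"
        using eventually_at_right_real[of 0 1] by (rule eventually_mono) auto
      ultimately show "\<forall>\<^sub>F t in at_right 0. dist (U' t x) x < e"
      proof eventually_elim
        case (elim t)
        have "w * t \<le> \<bar>w\<bar> * 1" using elim by (intro mult_mono) auto
        then have "?c t * norm (x - d) \<le> K * exp \<bar>w\<bar> * norm (x - d)"
          using K by (intro mult_right_mono mult_left_mono) auto
        then have "norm (U' t x - U t d) \<le> K * exp \<bar>w\<bar> * norm (x - d)"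
          using U'[of x t d] x d elim by auto
        also have "\<dots> \<le> K * exp \<bar>w\<bar> * (e / L)"
          using d K by (intro mult_left_mono) (auto simp: dist_norm norm_minus_commute)
        finally have "dist (U' t x) (U t d) \<le> K * exp \<bar>w\<bar> * (e / L)" by (simp add: dist_norm)
        moreover have "K * exp \<bar>w\<bar> * (e / L) + 2 * (e / L) = L * (e / L)"
          unfolding L_def by (rule distrib_right[symmetric])
        moreover have "L * (e / L) = e" using L by simp
        moreover have "dist (U' t x) x \<le> dist (U' t x) (U t d) + dist (U t d) d + dist d x"
          by (meson add_right_mono dist_triangle order_trans)
        ultimately show ?case using elim d(2) by linarith
      qed
    qed
  qed (use closed_V subspace_V K in auto)
  then show ?thesis using agree by blast
qed

section \<open>The spaces \<open>L\<^sub>p\<close>\<close>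

lemma ennreal_exponent:
  fixes p :: ennreal
  assumes "1 \<le> p" "p < \<infinity>"
  shows "1 \<le> enn2real p" "p = ennreal (enn2real p)" "p \<noteq> \<infinity>"
proof -
  show "p = ennreal (enn2real p)" using assms by (simp add: less_top)
  show "1 \<le> enn2real p" using assms enn2real_mono[of 1 p] by (simp add: less_top)
qed (use assms in auto)

text \<open>The case split behind every duality argument: either \<open>p = 1\<close> and the dual
  norm is an essential supremum, or both exponents are finite and greater than 1 and the calculus of
  real powers applies.\<close>

lemma conjugate_exponent_cases:
  fixes p p' :: ennreal
  assumes "1 \<le> p" "p < \<infinity>" "1 / p + 1 / p' = 1"
  obtains (inf) "p' = \<infinity>" "enn2real p = 1"
  | (fin) "1 \<le> p'" "p' < \<infinity>" "1 < enn2real p" "1 < enn2real p'" "1 / enn2real p + 1 / enn2real p' = 1"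
proof (cases "p' = \<infinity>")
  case True
  define r where "r = enn2real p"
  have r: "1 \<le> r" "p = ennreal r" using ennreal_exponent[OF assms(1,2)] by (auto simp: r_def)
  have "1 / p = 1" using assms(3) True by simp
  then have "ennreal (1 / r) = ennreal 1" using r divide_ennreal[of 1 r] by simp
  then have "1 / r = 1" using r by (subst (asm) ennreal_inj) auto
  then show ?thesis using inf True by (simp add: r_def)
next
  case False
  define r where "r = enn2real p"
  define s where "s = enn2real p'"
  have r: "1 \<le> r" "p = ennreal r" using ennreal_exponent[OF assms(1,2)] by (auto simp: r_def)
  have s: "0 \<le> s" "p' = ennreal s" using False by (auto simp: s_def less_top)
  \<comment> \<open>In \<open>ennreal\<close> the quotient \<open>1 / 0\<close> is infinite, so the
    sum could not be 1.\<close>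
  have "p' \<noteq> 0" using assms(3) by (auto simp: ennreal_divide_zero top_unique)
  then have s0: "0 < s" using s by (cases "s = 0") auto
  have "ennreal (1 / r + 1 / s) = ennreal 1"
    using assms(3) r s s0 divide_ennreal[of 1 r] divide_ennreal[of 1 s] by (simp add: ennreal_plus)
  then have eq: "1 / r + 1 / s = 1" using r s0 by (subst (asm) ennreal_inj) auto
  have "0 < 1 / s" using s0 by simp
  then have "1 / r < 1" using eq by linarith
  then have r1: "1 < r" using r by (simp add: divide_simps split: if_splits)
  have "0 < 1 / r" using r1 by simp
  then have "1 / s < 1" using eq by linarith
  then have s1: "1 < s" using s0 by (simp add: divide_simps split: if_splits)
  have "1 \<le> p'" using s1 s by (simp add: ennreal_ge_1)
  then show ?thesis using fin False r1 s1 eq by (simp add: r_def s_def less_top)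
qed

lemma conjugate_exponent_sym: 
  fixes p p' :: ennreal
  shows "1 / p + 1 / p' = 1 \<Longrightarrow> 1 / p' + 1 / p = 1"
  by (simp add: add.commute)

lemma conjugate_exponent_exists:
  fixes p :: ennreal
  assumes "1 \<le> p" "p < \<infinity>"
  shows "\<exists>p'::ennreal. 1 / p + 1 / p' = 1"
proof (cases "enn2real p = 1")
  case True
  then have "p = 1" using ennreal_exponent[OF assms] by simp
  then show ?thesis by (intro exI[of _ \<infinity>]) (simp add: divide_ennreal_def)
next
  case False
  define r where "r = enn2real p"
  have r: "1 < r" using ennreal_exponent(1)[OF assms] False unfolding r_def by linarith
  have pr: "p = ennreal r" using ennreal_exponent(2)[OF assms] by (simp add: r_def)
  have "1 / p + 1 / ennreal (r / (r - 1)) = ennreal (1 / r + 1 / (r / (r - 1)))"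
    using r divide_ennreal[of 1 r] divide_ennreal[of 1 "r / (r - 1)"] by (simp add: pr ennreal_plus)
  also have "1 / r + 1 / (r / (r - 1)) = 1" using r by (simp add: field_simps)
  finally show ?thesis by auto
qed

section \<open>Order and linear structure of the spaces L_p\<close>

lemma Lp_measurable: "u \<in> Lp M p \<Longrightarrow> u \<in> borel_measurable M"
  by (simp add: Lp_def)

lemma Lp_finite_iff:
  "p \<noteq> \<infinity> \<Longrightarrow> u \<in> Lp M p \<longleftrightarrow> u \<in> borel_measurable M \<and> integrable M (\<lambda>x. \<bar>u x\<bar> powr enn2real p)"
  by (simp add: Lp_def)

lemma Lp_norm_nonneg: "0 \<le> Lp_norm M p u"
proof (cases "p = \<infinity>")
  case True
  let ?e = "esssup M (\<lambda>x. ereal \<bar>u x\<bar>)"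
  have "0 \<le> real_of_ereal ?e"
  proof (cases "0 \<le> ?e")
    case False
    \<comment> \<open>A negative essential supremum of absolute values is possible only if the whole
      space is null. Then it is minus infinity, which \<open>real_of_ereal\<close> maps to
      0.\<close>
    have neg: "AE x in M. False"
      using esssup_AE[where M = M and f = "\<lambda>x. ereal \<bar>u x\<bar>"]
    proof eventually_elim
      case (elim x)
      have "0 \<le> ereal \<bar>u x\<bar>" by simp
      then show ?case using elim False order_trans by blast
    qed
    have "(\<lambda>x. ereal \<bar>u x\<bar>) \<in> borel_measurable M"
      using esssup_non_measurable[of "\<lambda>x. ereal \<bar>u x\<bar>" M] False by fastforce
    then have "?e \<le> - \<infinity>" by (rule esssup_I) (use neg in \<open>auto elim: AE_mp\<close>)
    then show ?thesis by simp
  qed (rule real_of_ereal_pos)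
  then show ?thesis using True by (simp add: Lp_norm_def)
qed (simp add: Lp_norm_def)

lemma Lp_norm_powr:
  assumes "1 \<le> p" "p < \<infinity>"
  shows "Lp_norm M p u powr enn2real p = (\<integral>x. \<bar>u x\<bar> powr enn2real p \<partial>M)"
  using ennreal_exponent[OF assms] by (simp add: Lp_norm_def powr_powr)

lemma Lp_norm_le_iff:
  assumes "1 \<le> p" "p < \<infinity>" "0 \<le> c"
  shows "Lp_norm M p u \<le> c \<longleftrightarrow> (\<integral>x. \<bar>u x\<bar> powr enn2real p \<partial>M) \<le> c powr enn2real p"
proof -
  have "Lp_norm M p u \<le> c \<longleftrightarrow> Lp_norm M p u powr enn2real p \<le> c powr enn2real p"
    using ennreal_exponent[OF assms(1,2)] assms(3) powr_mono2[of "enn2real p" "Lp_norm M p u" c]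
      powr_less_mono2[of "enn2real p" c "Lp_norm M p u"] Lp_norm_nonneg[of M p u]
    by (auto simp: not_le[symmetric])
  then show ?thesis by (simp add: Lp_norm_powr[OF assms(1,2)])
qed

lemma Lp_norm_cong_AE:
  assumes "u \<in> borel_measurable M" "v \<in> borel_measurable M" "AE x in M. u x = v x"
  shows "Lp_norm M p u = Lp_norm M p v"
proof (cases "p = \<infinity>")
  case True
  have "esssup M (\<lambda>x. ereal \<bar>u x\<bar>) = esssup M (\<lambda>x. ereal \<bar>v x\<bar>)"
    using assms by (intro esssup_AE_cong) auto
  then show ?thesis using True by (simp add: Lp_norm_def)
next
  case False
  have "(\<integral>x. \<bar>u x\<bar> powr enn2real p \<partial>M) = (\<integral>x. \<bar>v x\<bar> powr enn2real p \<partial>M)"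
    using assms by (intro integral_cong_AE) auto
  then show ?thesis using False by (simp add: Lp_norm_def)
qed

lemma Lp_dominated:
  assumes p: "1 \<le> p" "p < \<infinity>" and g: "g \<in> Lp M p" and u: "u \<in> borel_measurable M"
    and le: "AE x in M. \<bar>u x\<bar> \<le> \<bar>g x\<bar>"
  shows "u \<in> Lp M p" "Lp_norm M p u \<le> Lp_norm M p g"
proof -
  have r: "1 \<le> enn2real p" "p \<noteq> \<infinity>" using ennreal_exponent[OF p] by auto
  have g': "integrable M (\<lambda>x. \<bar>g x\<bar> powr enn2real p)" using g r by (simp add: Lp_finite_iff)
  have le': "AE x in M. \<bar>u x\<bar> powr enn2real p \<le> \<bar>g x\<bar> powr enn2real p"
    using le by (rule AE_mp) (use r in \<open>auto intro!: AE_I2 powr_mono2\<close>)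
  have i: "integrable M (\<lambda>x. \<bar>u x\<bar> powr enn2real p)"
    by (rule Bochner_Integration.integrable_bound[OF g']) (use u le' in auto)
  then show "u \<in> Lp M p" using u r by (simp add: Lp_finite_iff)
  have "(\<integral>x. \<bar>u x\<bar> powr enn2real p \<partial>M) \<le> (\<integral>x. \<bar>g x\<bar> powr enn2real p \<partial>M)"
    using le' by (intro integral_mono_AE i g')
  then show "Lp_norm M p u \<le> Lp_norm M p g"
    unfolding Lp_norm_le_iff[OF p Lp_norm_nonneg] Lp_norm_powr[OF p] .
qed

text \<open>Only membership is shown here, from the crude bound of a sum by twice the maximum. The
  triangle inequality for the norm comes later from the isometric embedding.\<close>

lemma Lp_add:
  assumes p: "1 \<le> p" "p < \<infinity>" and u: "u \<in> Lp M p" and v: "v \<in> Lp M p"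
  shows "(\<lambda>x. u x + v x) \<in> Lp M p"
proof -
  define r where "r = enn2real p"
  have r: "1 \<le> r" "p \<noteq> \<infinity>" using ennreal_exponent[OF p] by (auto simp: r_def)
  have i: "integrable M (\<lambda>x. 2 powr r * (\<bar>u x\<bar> powr r + \<bar>v x\<bar> powr r))"
    using u v r by (intro integrable_mult_right integrable_add) (auto simp: Lp_finite_iff r_def)
  have "\<bar>u x + v x\<bar> powr r \<le> 2 powr r * (\<bar>u x\<bar> powr r + \<bar>v x\<bar> powr r)" for x
  proof -
    have "\<bar>u x + v x\<bar> powr r \<le> (2 * max \<bar>u x\<bar> \<bar>v x\<bar>) powr r"
      using r by (intro powr_mono2) auto
    also have "\<dots> = 2 powr r * (max \<bar>u x\<bar> \<bar>v x\<bar>) powr r" by (rule powr_mult)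
    also have "(max \<bar>u x\<bar> \<bar>v x\<bar>) powr r \<le> \<bar>u x\<bar> powr r + \<bar>v x\<bar> powr r" by (auto simp: max_def)
    finally show ?thesis by simp
  qed
  then have "AE x in M. norm (\<bar>u x + v x\<bar> powr r) \<le> norm (2 powr r * (\<bar>u x\<bar> powr r + \<bar>v x\<bar> powr r))"
    by (intro AE_I2) simp
  moreover have "(\<lambda>x. \<bar>u x + v x\<bar> powr r) \<in> borel_measurable M"
    using Lp_measurable[OF u] Lp_measurable[OF v] by measurable
  ultimately have "integrable M (\<lambda>x. \<bar>u x + v x\<bar> powr r)"
    using i by (rule_tac Bochner_Integration.integrable_bound)
  then show ?thesis using u v r Lp_measurable[of _ M p] by (auto simp: Lp_finite_iff r_def)
qed

lemma Lp_scale: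
  assumes p: "1 \<le> p" "p < \<infinity>" and u: "u \<in> Lp M p"
  shows "(\<lambda>x. c * u x) \<in> Lp M p"
  using u ennreal_exponent[OF p] by (auto simp: Lp_finite_iff abs_mult powr_mult)

lemma Lp_diff:
  assumes p: "1 \<le> p" "p < \<infinity>" and u: "u \<in> Lp M p" and v: "v \<in> Lp M p"
  shows "(\<lambda>x. u x - v x) \<in> Lp M p"
  using Lp_add[OF p u Lp_scale[OF p v, of "-1"]] by simp

lemma Lp_zero: "1 \<le> p \<Longrightarrow> p < \<infinity> \<Longrightarrow> (\<lambda>x. 0) \<in> Lp M p"
  using ennreal_exponent(3)[of p] by (simp add: Lp_finite_iff)

lemma Lp_abs: "1 \<le> p \<Longrightarrow> p < \<infinity> \<Longrightarrow> u \<in> Lp M p \<Longrightarrow> (\<lambda>x. \<bar>u x\<bar>) \<in> Lp M p"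
  using ennreal_exponent(3)[of p] by (auto simp: Lp_finite_iff)

lemma Lp_AE_cong:
  assumes p: "1 \<le> p" "p < \<infinity>" and u: "u \<in> Lp M p" and v: "v \<in> borel_measurable M" and "AE x in M. u x = v x"
  shows "v \<in> Lp M p"
  by (rule Lp_dominated[OF p u v]) (use assms(5) in auto)

lemma Lp_norm_scale:
  assumes p: "1 \<le> p" "p < \<infinity>"
  shows "Lp_norm M p (\<lambda>x. c * u x) = \<bar>c\<bar> * Lp_norm M p u"
  using ennreal_exponent[OF p] by (simp add: Lp_norm_def abs_mult powr_mult powr_powr)

lemma Lp_norm_eq_0_iff:
  assumes p: "1 \<le> p" "p < \<infinity>" and u: "u \<in> Lp M p"
  shows "Lp_norm M p u = 0 \<longleftrightarrow> (AE x in M. u x = 0)"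
proof -
  have r: "1 \<le> enn2real p" "p \<noteq> \<infinity>" using ennreal_exponent[OF p] by auto
  have "Lp_norm M p u = 0 \<longleftrightarrow> (\<integral>x. \<bar>u x\<bar> powr enn2real p \<partial>M) = 0"
    using r by (simp add: Lp_norm_def)
  also have "\<dots> \<longleftrightarrow> (AE x in M. \<bar>u x\<bar> powr enn2real p = 0)"
    using u r by (intro integral_nonneg_eq_0_iff_AE) (auto simp: Lp_finite_iff)
  finally show ?thesis by simp
qed

lemma Linf_AE_bound:
  assumes "u \<in> Lp M \<infinity>"
  shows "AE x in M. \<bar>u x\<bar> \<le> Lp_norm M \<infinity> u"
proof -
  have "esssup M (\<lambda>x. ereal \<bar>u x\<bar>) < \<infinity>" using assms by (simp add: Lp_def)
  then show ?thesis
    using esssup_AE[where M = M and f = "\<lambda>x. ereal \<bar>u x\<bar>"]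
    by (cases "esssup M (\<lambda>x. ereal \<bar>u x\<bar>)") (auto simp: Lp_norm_def elim: AE_mp)
qed

lemma LinfI:
  assumes "u \<in> borel_measurable M" "AE x in M. \<bar>u x\<bar> \<le> c" 
  shows "u \<in> Lp M \<infinity>" "0 \<le> c \<Longrightarrow> Lp_norm M \<infinity> u \<le> c"
proof -
  have le: "esssup M (\<lambda>x. ereal \<bar>u x\<bar>) \<le> ereal c"
    using assms by (intro esssup_I) auto
  then show "u \<in> Lp M \<infinity>" using assms by (auto simp: Lp_def intro: le_less_trans)
  show "Lp_norm M \<infinity> u \<le> c" if "0 \<le> c"
    using le that by (cases "esssup M (\<lambda>x. ereal \<bar>u x\<bar>)") (auto simp: Lp_norm_def)
qed

section \<open>Hoelder's inequality and its extremal functions\<close>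

lemma Holder_inequality:
  assumes p: "1 \<le> p" "p < \<infinity>" and conj: "1 / p + 1 / p' = 1"
    and u: "u \<in> Lp M p" and v: "v \<in> Lp M p'"
  shows "integrable M (\<lambda>x. u x * v x)" "\<bar>\<integral>x. u x * v x \<partial>M\<bar> \<le> Lp_norm M p u * Lp_norm M p' v"
proof -
  note [measurable] = Lp_measurable[OF u] Lp_measurable[OF v]
  note pinf = ennreal_exponent(3)[OF p]
  have "integrable M (\<lambda>x. u x * v x) \<and> \<bar>\<integral>x. u x * v x \<partial>M\<bar> \<le> Lp_norm M p u * Lp_norm M p' v"
  proof (rule conjugate_exponent_cases[OF p conj])
    assume inf: "p' = \<infinity>" "enn2real p = 1"
    define B where "B = Lp_norm M p' v"
    have bd: "AE x in M. \<bar>v x\<bar> \<le> B" using Linf_AE_bound[of v M] v unfolding B_def inf(1) by blast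
    have ui: "integrable M (\<lambda>x. \<bar>u x\<bar>)" using u pinf inf by (simp add: Lp_finite_iff)
    have nu: "Lp_norm M p u = (\<integral>x. \<bar>u x\<bar> \<partial>M)" using pinf inf by (simp add: Lp_norm_def)
    have le: "AE x in M. \<bar>u x * v x\<bar> \<le> B * \<bar>u x\<bar>"
      using bd by (rule AE_mp) (auto intro!: AE_I2 simp: abs_mult mult.commute[of B] intro: mult_left_mono)
    have i: "integrable M (\<lambda>x. u x * v x)"
      by (rule Bochner_Integration.integrable_bound[OF integrable_mult_right[OF ui, of B]]) (use le in auto)
    have "\<bar>\<integral>x. u x * v x \<partial>M\<bar> \<le> (\<integral>x. \<bar>u x * v x\<bar> \<partial>M)" by (rule integral_abs_bound)
    also have "\<dots> \<le> (\<integral>x. B * \<bar>u x\<bar> \<partial>M)"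
      using le i ui by (intro integral_mono_AE) auto
    also have "\<dots> = Lp_norm M p u * B" by (simp add: nu)
    finally show ?thesis using i by (simp add: B_def)
  next
    assume fin: "1 \<le> p'" "p' < \<infinity>" "1 < enn2real p" "1 < enn2real p'" "1 / enn2real p + 1 / enn2real p' = 1"
    define r s where "r = enn2real p" and "s = enn2real p'"
    note p'inf = ennreal_exponent(3)[OF fin(1,2)]
    have rs: "1 < r" "1 < s" "1 / r + 1 / s = 1" using fin by (auto simp: r_def s_def)
    have ui: "integrable M (\<lambda>x. \<bar>u x\<bar> powr r)" using u pinf by (simp add: Lp_finite_iff r_def)
    have vi: "integrable M (\<lambda>x. \<bar>v x\<bar> powr s)" using v p'inf by (simp add: Lp_finite_iff s_def)
    have i: "integrable M (\<lambda>x. u x * v x)"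
      by (rule Bochner_Integration.integrable_bound[of M "\<lambda>x. \<bar>u x\<bar> powr r / r + \<bar>v x\<bar> powr s / s"])
        (use ui vi rs Youngs_inequality[OF rs] in \<open>auto intro!: AE_I2 simp: abs_mult\<close>)
    define a b where "a = Lp_norm M p u" and "b = Lp_norm M p' v"
    have ab: "0 \<le> a" "0 \<le> b" unfolding a_def b_def by (rule Lp_norm_nonneg Lp_norm_nonneg)+
    show ?thesis
    proof (cases "a = 0 \<or> b = 0")
      case True
      then have "AE x in M. u x * v x = 0"
        using Lp_norm_eq_0_iff[OF p u] Lp_norm_eq_0_iff[OF fin(1,2) v] by (auto simp: a_def b_def)
      then have "(\<integral>x. u x * v x \<partial>M) = 0" by (intro integral_eq_zero_AE)
      then show ?thesis using i True by (auto simp: a_def b_def)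
    next
      case False
      then have ab: "0 < a" "0 < b" using ab by auto
      have au: "(\<integral>x. \<bar>u x\<bar> powr r \<partial>M) = a powr r" and bv: "(\<integral>x. \<bar>v x\<bar> powr s \<partial>M) = b powr s"
        by (simp_all add: a_def b_def r_def s_def Lp_norm_powr[OF p] Lp_norm_powr[OF fin(1,2)])
      \<comment> \<open>Young's inequality for the functions divided by their norms, which are
        nonzero in this case.\<close>
      have young: "\<bar>u x * v x\<bar> \<le> a * b * (\<bar>u x\<bar> powr r / (a powr r * r) + \<bar>v x\<bar> powr s / (b powr s * s))" for x
      proof -
        have "(\<bar>u x\<bar> / a) * (\<bar>v x\<bar> / b) \<le> (\<bar>u x\<bar> / a) powr r / r + (\<bar>v x\<bar> / b) powr s / s"
          using ab by (intro Youngs_inequality rs) auto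
        then have "a * b * ((\<bar>u x\<bar> / a) * (\<bar>v x\<bar> / b)) \<le> a * b * ((\<bar>u x\<bar> / a) powr r / r + (\<bar>v x\<bar> / b) powr s / s)"
          using ab by (intro mult_left_mono) auto
        then show ?thesis using ab by (simp add: abs_mult powr_divide)
      qed
      have "\<bar>\<integral>x. u x * v x \<partial>M\<bar> \<le> (\<integral>x. \<bar>u x * v x\<bar> \<partial>M)" by (rule integral_abs_bound)
      also have "\<dots> \<le> (\<integral>x. a * b * (\<bar>u x\<bar> powr r / (a powr r * r) + \<bar>v x\<bar> powr s / (b powr s * s)) \<partial>M)"
        using i ui vi young by (intro integral_mono) auto
      also have "\<dots> = a * b * (a powr r / (a powr r * r) + b powr s / (b powr s * s))"
        using ui vi by (simp add: au bv)
      also have "\<dots> = a * b * (1 / r + 1 / s)" using ab by simp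
      also have "\<dots> = a * b" using rs by simp
      finally show ?thesis using i by (simp add: a_def b_def)
    qed
  qed
  then show "integrable M (\<lambda>x. u x * v x)" "\<bar>\<integral>x. u x * v x \<partial>M\<bar> \<le> Lp_norm M p u * Lp_norm M p' v" by auto
qed

text \<open>The extremal function of Hoelder's inequality: an element of the dual unit ball whose
  pairing with \<open>u\<close> is the norm of \<open>u\<close>. If that norm is 0, the convention
  \<open>0 powr _ = 0\<close> and division by zero make it the zero function.\<close>

definition norming :: "'a measure \<Rightarrow> ennreal \<Rightarrow> ('a \<Rightarrow> real) \<Rightarrow> 'a \<Rightarrow> real" where
  "norming M p u x = sgn (u x) * \<bar>u x\<bar> powr (enn2real p - 1) / Lp_norm M p u powr (enn2real p - 1)"

lemma norming_measurable [measurable]: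
  assumes [measurable]: "u \<in> borel_measurable M"
  shows "norming M p u \<in> borel_measurable M"
  unfolding norming_def sgn_if by measurable

lemma norming:
  assumes p: "1 \<le> p" "p < \<infinity>" and conj: "1 / p + 1 / p' = 1" and u: "u \<in> Lp M p"
  shows "norming M p u \<in> Lp M p'" "Lp_norm M p' (norming M p u) \<le> 1"
    "(\<integral>x. u x * norming M p u x \<partial>M) = Lp_norm M p u"
proof -
  note [measurable] = Lp_measurable[OF u]
  note pinf = ennreal_exponent(3)[OF p]
  define r a where "r = enn2real p" and "a = Lp_norm M p u"
  have a0: "0 \<le> a" unfolding a_def by (rule Lp_norm_nonneg)
  have au: "(\<integral>x. \<bar>u x\<bar> powr r \<partial>M) = a powr r"
    by (simp add: a_def r_def Lp_norm_powr[OF p])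
  have ui: "integrable M (\<lambda>x. \<bar>u x\<bar> powr r)" using u pinf by (simp add: Lp_finite_iff r_def)
  have nf: "norming M p u x = sgn (u x) * \<bar>u x\<bar> powr (r - 1) / a powr (r - 1)" for x
    by (simp add: norming_def r_def a_def)
  have "u x * norming M p u x = \<bar>u x\<bar> powr r / a powr (r - 1)" for x
  proof (cases "u x = 0")
    case False
    have "u x * sgn (u x) = \<bar>u x\<bar>" by (simp add: abs_sgn)
    then have "u x * sgn (u x) * \<bar>u x\<bar> powr (r - 1) = \<bar>u x\<bar> powr 1 * \<bar>u x\<bar> powr (r - 1)"
      by simp
    also have "\<dots> = \<bar>u x\<bar> powr r" by (subst powr_add[symmetric]) simp
    finally show ?thesis by (simp add: nf mult.assoc)
  qed (simp add: nf)
  then have "(\<integral>x. u x * norming M p u x \<partial>M) = a powr r / a powr (r - 1)"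
    by (simp add: au)
  also have "\<dots> = a"
  proof (cases "a = 0")
    case False
    then have "a powr r / a powr (r - 1) = a powr (r - (r - 1))" by (simp only: powr_diff)
    then show ?thesis using a0 False by simp
  qed simp
  finally show "(\<integral>x. u x * norming M p u x \<partial>M) = Lp_norm M p u" by (simp add: a_def)
  have "norming M p u \<in> Lp M p' \<and> Lp_norm M p' (norming M p u) \<le> 1"
  proof (rule conjugate_exponent_cases[OF p conj])
    assume inf: "p' = \<infinity>" "enn2real p = 1"
    have "\<bar>norming M p u x\<bar> \<le> 1" for x
      unfolding nf r_def inf(2) by (cases "u x = 0"; cases "a = 0") (auto simp: abs_mult sgn_if)
    then show ?thesis using LinfI[of "norming M p u" M 1] unfolding inf(1) by simp
  next
    assume fin: "1 \<le> p'" "p' < \<infinity>" "1 < enn2real p" "1 < enn2real p'" "1 / enn2real p + 1 / enn2real p' = 1"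
    define s where "s = enn2real p'"
    note p'inf = ennreal_exponent(3)[OF fin(1,2)]
    have rs: "1 < r" "1 < s" "1 / r + 1 / s = 1" using fin by (auto simp: r_def s_def)
    have rs1: "(r - 1) * s = r"
      using rs by (simp add: field_simps)
    have pw: "\<bar>norming M p u x\<bar> powr s = \<bar>u x\<bar> powr r / a powr r" for x
    proof (cases "u x = 0")
      case False
      have "\<bar>norming M p u x\<bar> = \<bar>u x\<bar> powr (r - 1) / a powr (r - 1)"
        using False by (simp add: nf abs_mult abs_sgn_eq)
      then show ?thesis using a0 by (simp add: powr_divide powr_powr rs1)
    qed (use rs in \<open>simp add: nf\<close>)
    have "integrable M (\<lambda>x. \<bar>norming M p u x\<bar> powr s)" using ui by (simp add: pw)
    then have "norming M p u \<in> Lp M p'" using p'inf by (simp add: Lp_finite_iff s_def)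
    moreover have "(\<integral>x. \<bar>norming M p u x\<bar> powr s \<partial>M) \<le> 1 powr s"
      by (simp add: pw au)
    then have "Lp_norm M p' (norming M p u) \<le> 1"
      using Lp_norm_le_iff[OF fin(1,2), of 1 M "norming M p u"] by (simp add: s_def)
    ultimately show ?thesis by blast
  qed
  then show "norming M p u \<in> Lp M p'" "Lp_norm M p' (norming M p u) \<le> 1" by auto
qed

lemma Lp_Fatou:
  assumes p: "1 \<le> p" "p < \<infinity>" and w: "\<And>n::nat. w n \<in> Lp M p" "\<And>n. Lp_norm M p (w n) \<le> c"
    and u: "u \<in> borel_measurable M" and lim: "AE x in M. (\<lambda>n. w n x) \<longlonglongrightarrow> u x"
  shows "u \<in> Lp M p" "Lp_norm M p u \<le> c"
proof -
  define r where "r = enn2real p"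
  have r: "1 \<le> r" "p \<noteq> \<infinity>" using ennreal_exponent[OF p] by (auto simp: r_def)
  have c: "0 \<le> c" using order_trans[OF Lp_norm_nonneg w(2)] .
  note [measurable] = u Lp_measurable[OF w(1)]
  have wn: "(\<integral>\<^sup>+x. ennreal (\<bar>w n x\<bar> powr r) \<partial>M) \<le> ennreal (c powr r)" for n
  proof -
    have "(\<integral>\<^sup>+x. ennreal (\<bar>w n x\<bar> powr r) \<partial>M) = ennreal (\<integral>x. \<bar>w n x\<bar> powr r \<partial>M)"
      using w(1)[of n] r by (intro nn_integral_eq_integral) (auto simp: Lp_finite_iff r_def)
    also have "\<dots> \<le> ennreal (c powr r)"
      using Lp_norm_le_iff[OF p c, where u = "w n" and M = M] w(2)[of n] by (intro ennreal_leI) (simp add: r_def)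
    finally show ?thesis .
  qed
  have "(\<integral>\<^sup>+x. ennreal (\<bar>u x\<bar> powr r) \<partial>M) = (\<integral>\<^sup>+x. liminf (\<lambda>n. ennreal (\<bar>w n x\<bar> powr r)) \<partial>M)"
  proof (rule nn_integral_cong_AE, use lim in eventually_elim)
    case (elim x)
    have "(\<lambda>n. \<bar>w n x\<bar> powr r) \<longlonglongrightarrow> \<bar>u x\<bar> powr r"
      using elim r by (intro tendsto_powr' tendsto_rabs tendsto_const) auto
    then have "(\<lambda>n. ennreal (\<bar>w n x\<bar> powr r)) \<longlonglongrightarrow> ennreal (\<bar>u x\<bar> powr r)"
      by (rule tendsto_ennrealI)
    then show ?case by (intro lim_imp_Liminf[symmetric]) auto
  qed
  also have "\<dots> \<le> liminf (\<lambda>n. \<integral>\<^sup>+x. ennreal (\<bar>w n x\<bar> powr r) \<partial>M)"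
    by (rule nn_integral_liminf) measurable
  also have "\<dots> \<le> ennreal (c powr r)"
    using Liminf_mono[of "\<lambda>n. \<integral>\<^sup>+x. ennreal (\<bar>w n x\<bar> powr r) \<partial>M" "\<lambda>n. ennreal (c powr r)" sequentially] wn
    by (simp add: Liminf_const)
  finally have le: "(\<integral>\<^sup>+x. ennreal (\<bar>u x\<bar> powr r) \<partial>M) \<le> ennreal (c powr r)" .
  then have i: "integrable M (\<lambda>x. \<bar>u x\<bar> powr r)"
    by (intro integrableI_bounded) (auto intro: le_less_trans)
  then show "u \<in> Lp M p" using r u by (simp add: Lp_finite_iff r_def)
  have "ennreal (\<integral>x. \<bar>u x\<bar> powr r \<partial>M) \<le> ennreal (c powr r)"
    using le i by (simp add: nn_integral_eq_integral)
  then have "(\<integral>x. \<bar>u x\<bar> powr r \<partial>M) \<le> c powr r" by (simp add: ennreal_le_iff)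
  then show "Lp_norm M p u \<le> c" using Lp_norm_le_iff[OF p c, where u = u and M = M] by (simp add: r_def)
qed

section \<open>The embedding of L_p into a Banach space type\<close>

instance bcontfun :: (metric_space, banach) banach ..

type_synonym 'a lp_rep = "('a \<Rightarrow> real) discrete \<Rightarrow>\<^sub>C real"

text \<open>
  The spaces \<open>L\<^sub>p\<close> are not types.  Pairing with the functionals below embeds each of them isometrically,
  as a closed subspace, into one Banach space type, so that the vector-valued calculus of the library applies.
\<close>

definition unit_duals :: "'a measure \<Rightarrow> ennreal \<Rightarrow> ('a \<Rightarrow> real) set" where
  "unit_duals M p = {v \<in> borel_measurable M.
     \<forall>u\<in>Lp M p. integrable M (\<lambda>x. u x * v x) \<and> \<bar>\<integral>x. u x * v x \<partial>M\<bar> \<le> Lp_norm M p u}"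

text \<open>The arguments are all functions under the discrete topology, so that continuity is
  automatic and only boundedness has to be checked. The value 0 outside \<open>unit_duals\<close>
  makes this one type serve all measures and exponents.\<close>

definition emb :: "'a measure \<Rightarrow> ennreal \<Rightarrow> ('a \<Rightarrow> real) \<Rightarrow> 'a lp_rep" where
  "emb M p u = Bcontfun (\<lambda>v. if of_discrete v \<in> unit_duals M p then pairing M u (of_discrete v) else 0)"

lemma continuous_on_discrete: "continuous_on A (f :: 'a discrete \<Rightarrow> 'b::topological_space)"
proof -
  have "continuous_on UNIV f"
    by (auto simp: continuous_on_open_vimage open_discrete)
  then show ?thesis by (rule continuous_on_subset) simp
qed

lemma emb_apply:
  assumes p: "1 \<le> p" "p < \<infinity>" and u: "u \<in> Lp M p"
  shows "apply_bcontfun (emb M p u) v = (if of_discrete v \<in> unit_duals M p then pairing M u (of_discrete v) else 0)"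
proof -
  have "(\<lambda>v. if of_discrete v \<in> unit_duals M p then pairing M u (of_discrete v) else 0) \<in> bcontfun"
    by (rule bcontfun_normI[OF continuous_on_discrete, where b = "Lp_norm M p u"])
      (use u Lp_norm_nonneg in \<open>auto simp: unit_duals_def pairing_def\<close>)
  then show ?thesis by (simp add: emb_def Bcontfun_inverse)
qed

lemma emb_eval:
  assumes "1 \<le> p" "p < \<infinity>" "u \<in> Lp M p" "v \<in> unit_duals M p"
  shows "apply_bcontfun (emb M p u) (discrete v) = pairing M u v"
  using emb_apply[OF assms(1-3), of "discrete v"] assms(4) by (simp add: discrete_inverse)

lemma unit_dualsI:
  assumes p: "1 \<le> p" "p < \<infinity>" and conj: "1 / p + 1 / p' = 1" and v: "v \<in> Lp M p'" "Lp_norm M p' v \<le> 1"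
  shows "v \<in> unit_duals M p"
proof -
  have "\<bar>\<integral>x. u x * v x \<partial>M\<bar> \<le> Lp_norm M p u" if u: "u \<in> Lp M p" for u
    using Holder_inequality(2)[OF p conj u v(1)] mult_left_mono[OF v(2) Lp_norm_nonneg[of M p u]] by simp
  then show ?thesis
    using Holder_inequality(1)[OF p conj _ v(1)] Lp_measurable[OF v(1)] by (simp add: unit_duals_def)
qed

lemma norming_unit_dual:
  assumes "1 \<le> p" "p < \<infinity>" "u \<in> Lp M p"
  shows "norming M p u \<in> unit_duals M p"
  using conjugate_exponent_exists[OF assms(1,2)] norming(1,2)[OF assms(1,2) _ assms(3)] unit_dualsI[OF assms(1,2)]
  by blast

text \<open>The upper bound is built into \<open>unit_duals\<close>; the lower bound is attained at
  the norming function.\<close>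

lemma norm_emb:
  assumes p: "1 \<le> p" "p < \<infinity>" and u: "u \<in> Lp M p"
  shows "norm (emb M p u) = Lp_norm M p u"
proof (rule antisym)
  show "norm (emb M p u) \<le> Lp_norm M p u"
    by (rule norm_bound) (use u Lp_norm_nonneg in \<open>auto simp: emb_apply[OF p u] unit_duals_def pairing_def\<close>)
  obtain p' :: ennreal where p': "1 / p + 1 / p' = 1" using conjugate_exponent_exists[OF p] by blast
  have "Lp_norm M p u = apply_bcontfun (emb M p u) (discrete (norming M p u))"
    using emb_eval[OF p u norming_unit_dual[OF p u]] norming(3)[OF p p' u] by (simp add: pairing_def)
  also have "\<dots> \<le> norm (emb M p u)" using norm_bounded[of "emb M p u" "discrete (norming M p u)"] by simp
  finally show "Lp_norm M p u \<le> norm (emb M p u)" .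
qed

lemma emb_add:
  assumes p: "1 \<le> p" "p < \<infinity>" and u: "u \<in> Lp M p" and v: "v \<in> Lp M p"
  shows "emb M p (\<lambda>x. u x + v x) = emb M p u + emb M p v"
  using u v by (intro bcontfun_eqI)
    (auto simp: emb_apply[OF p u] emb_apply[OF p v] emb_apply[OF p Lp_add[OF p u v]] pairing_def unit_duals_def distrib_right)

lemma emb_scale:
  assumes p: "1 \<le> p" "p < \<infinity>" and u: "u \<in> Lp M p"
  shows "emb M p (\<lambda>x. c * u x) = c *\<^sub>R emb M p u"
  using u by (intro bcontfun_eqI)
    (auto simp: emb_apply[OF p u] emb_apply[OF p Lp_scale[OF p u]] pairing_def mult.assoc)

lemma emb_diff:
  assumes p: "1 \<le> p" "p < \<infinity>" and u: "u \<in> Lp M p" and v: "v \<in> Lp M p"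
  shows "emb M p (\<lambda>x. u x - v x) = emb M p u - emb M p v"
  using emb_add[OF p u Lp_scale[OF p v, of "-1"]] emb_scale[OF p v, of "-1"] by simp

lemma Lp_norm_diff:
  assumes p: "1 \<le> p" "p < \<infinity>" and u: "u \<in> Lp M p" and v: "v \<in> Lp M p"
  shows "Lp_norm M p (\<lambda>x. u x - v x) = norm (emb M p u - emb M p v)"
  using norm_emb[OF p Lp_diff[OF p u v]] emb_diff[OF p u v] by simp

lemma emb_eq_iff:
  assumes p: "1 \<le> p" "p < \<infinity>" and u: "u \<in> Lp M p" and v: "v \<in> Lp M p"
  shows "emb M p u = emb M p v \<longleftrightarrow> (AE x in M. u x = v x)"
  using Lp_norm_diff[OF p u v] Lp_norm_eq_0_iff[OF p Lp_diff[OF p u v]] by simp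

lemma Lp_norm_triangle:
  assumes p: "1 \<le> p" "p < \<infinity>" and u: "u \<in> Lp M p" and v: "v \<in> Lp M p"
  shows "Lp_norm M p (\<lambda>x. u x + v x) \<le> Lp_norm M p u + Lp_norm M p v"
  using norm_triangle_ineq[of "emb M p u" "emb M p v"] emb_add[OF p u v]
    norm_emb[OF p u] norm_emb[OF p v] norm_emb[OF p Lp_add[OF p u v]] by simp

lemma subspace_emb:
  assumes p: "1 \<le> p" "p < \<infinity>"
  shows "subspace (emb M p ` Lp M p)"
proof (rule subspaceI)
  have "emb M p (\<lambda>x. 0) = 0"
    using norm_emb[OF p Lp_zero[OF p], of M] Lp_norm_eq_0_iff[OF p Lp_zero[OF p], of M] by simp
  then show "0 \<in> emb M p ` Lp M p" using Lp_zero[OF p] by (metis imageI)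
qed (auto simp: emb_add[OF p, symmetric] emb_scale[OF p, symmetric] Lp_add[OF p] Lp_scale[OF p])

text \<open>The step of Riesz and Fischer: monotone convergence bounds the integral of the supremum
  of the powers of the partial sums, so this supremum is finite almost everywhere.\<close>

lemma Lp_absolutely_summable:
  assumes p: "1 \<le> p" "p < \<infinity>" and d: "\<And>k::nat. d k \<in> Lp M p" and sums: "\<And>N. (\<Sum>k<N. Lp_norm M p (d k)) \<le> c"
  shows "AE x in M. summable (\<lambda>k. \<bar>d k x\<bar>)"
proof -
  define r where "r = enn2real p"
  have r: "1 \<le> r" "p \<noteq> \<infinity>" using ennreal_exponent[OF p] by (auto simp: r_def)
  define G where "G = (\<lambda>N x. \<Sum>k<N. \<bar>d k x\<bar>)"
  have c0: "0 \<le> c" using sums[of 0] by simp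
  have G: "G N \<in> Lp M p \<and> Lp_norm M p (G N) \<le> (\<Sum>k<N. Lp_norm M p (d k))" for N
  proof (induction N)
    case 0
    have "Lp_norm M p (\<lambda>x. 0) = 0" using Lp_norm_eq_0_iff[OF p Lp_zero[OF p, of M]] by simp
    then show ?case using Lp_zero[OF p] by (simp add: G_def)
  next
    case (Suc N)
    have eq: "G (Suc N) = (\<lambda>x. G N x + \<bar>d N x\<bar>)" by (simp add: G_def)
    have "Lp_norm M p (\<lambda>x. \<bar>d N x\<bar>) = Lp_norm M p (d N)" using r by (simp add: Lp_norm_def)
    then show ?case
      using Suc Lp_add[OF p, of "G N" M "\<lambda>x. \<bar>d N x\<bar>"] Lp_abs[OF p d[of N]]
        Lp_norm_triangle[OF p, of "G N" M "\<lambda>x. \<bar>d N x\<bar>"] by (simp add: eq)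
  qed
  have [measurable]: "G N \<in> borel_measurable M" for N using G Lp_measurable by blast
  have Gn: "(\<integral>\<^sup>+x. ennreal (G N x powr r) \<partial>M) \<le> ennreal (c powr r)" for N
  proof -
    have nn: "0 \<le> G N x" for x by (simp add: G_def sum_nonneg)
    have "(\<integral>\<^sup>+x. ennreal (G N x powr r) \<partial>M) = ennreal (\<integral>x. \<bar>G N x\<bar> powr r \<partial>M)"
      using G[of N] r nn by (subst nn_integral_eq_integral[symmetric]) (auto simp: Lp_finite_iff r_def)
    also have "\<dots> \<le> ennreal (c powr r)"
      using Lp_norm_le_iff[OF p c0, of M "G N"] order_trans[OF _ sums[of N]] G[of N] by (intro ennreal_leI) (simp add: r_def)
    finally show ?thesis .
  qed
  have "(\<integral>\<^sup>+x. (SUP N. ennreal (G N x powr r)) \<partial>M) = (SUP N. \<integral>\<^sup>+x. ennreal (G N x powr r) \<partial>M)"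
  proof (rule nn_integral_monotone_convergence_SUP)
    show "incseq (\<lambda>N x. ennreal (G N x powr r))"
      unfolding incseq_def le_fun_def
      using r by (auto simp: G_def intro!: ennreal_leI powr_mono2 sum_mono2 sum_nonneg)
  qed measurable
  also have "\<dots> \<le> ennreal (c powr r)" by (intro SUP_least Gn)
  finally have "(\<integral>\<^sup>+x. (SUP N. ennreal (G N x powr r)) \<partial>M) \<noteq> \<infinity>"
    by (auto simp: top_unique)
  then have "AE x in M. (SUP N. ennreal (G N x powr r)) \<noteq> \<infinity>"
    by (intro nn_integral_PInf_AE) auto
  then show ?thesis
  proof (rule AE_mp, intro AE_I2 impI)
    fix x assume "(SUP N. ennreal (G N x powr r)) \<noteq> \<infinity>"
    then obtain B where B: "0 \<le> B" "(SUP N. ennreal (G N x powr r)) = ennreal B"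
      by (cases "SUP N. ennreal (G N x powr r)") auto
    have "(\<Sum>k<N. \<bar>d k x\<bar>) \<le> B powr (1 / r)" for N
    proof -
      have "ennreal (G N x powr r) \<le> ennreal B" unfolding B(2)[symmetric] by (rule SUP_upper) simp
      then have "G N x powr r \<le> B" using B(1) by (simp add: ennreal_le_iff)
      then have "(G N x powr r) powr (1 / r) \<le> B powr (1 / r)" using r by (intro powr_mono2) auto
      then show ?thesis using r by (simp add: powr_powr G_def sum_nonneg)
    qed
    then show "summable (\<lambda>k. \<bar>d k x\<bar>)"
      by (intro summableI_nonneg_bounded) auto
  qed
qed

lemma closed_emb:
  assumes p: "1 \<le> p" "p < \<infinity>"
  shows "closed (emb M p ` Lp M p)"
  unfolding closed_sequential_limits
proof (intro allI impI, elim conjE)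
  fix e l assume e: "\<forall>n. e n \<in> emb M p ` Lp M p" and lim: "e \<longlonglongrightarrow> l"
  \<comment> \<open>Closeness to \<open>l\<close> is all that is required of the chosen indices,
    which need not increase. The factor 1/4 makes consecutive terms differ by less than
    \<open>(1/2) ^ n\<close>.\<close>
  have "\<exists>m. dist (e m) l < (1/2) ^ n / 4" for n
    using lim[unfolded lim_sequentially, rule_format, of "(1/2) ^ n / 4"] by auto
  then obtain f where fl: "\<And>n. dist (e (f n)) l < (1/2) ^ n / 4" by metis
  have f: "dist (e (f (Suc n))) (e (f n)) < (1/2) ^ n" for n
    using dist_triangle2[of "e (f (Suc n))" "e (f n)" l] fl[of n] fl[of "Suc n"] zero_less_power[of "1/2::real" n]
    unfolding power_Suc by linarith
  have "\<forall>n. \<exists>u\<in>Lp M p. e (f n) = emb M p u" using e by blast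
  then obtain u where u: "\<And>n. u n \<in> Lp M p" "\<And>n. e (f n) = emb M p (u n)" by metis
  define d where "d = (\<lambda>k x. u (Suc k) x - u k x)"
  have dL: "d k \<in> Lp M p" for k unfolding d_def by (intro Lp_diff p u)
  have dn: "Lp_norm M p (d k) \<le> (1/2) ^ k" for k
    using f[of k] unfolding d_def Lp_norm_diff[OF p u(1) u(1)] by (simp add: u(2) dist_norm)
  have "AE x in M. summable (\<lambda>k. \<bar>d k x\<bar>)"
  proof (rule Lp_absolutely_summable[OF p dL])
    fix N
    have "(\<Sum>k<N. Lp_norm M p (d k)) \<le> (\<Sum>k<N. (1/2) ^ k)" by (intro sum_mono dn)
    also have "\<dots> \<le> 2" by (simp add: sum_gp_strict)
    finally show "(\<Sum>k<N. Lp_norm M p (d k)) \<le> 2" .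
  qed
  then have conv: "AE x in M. (\<lambda>n. u n x) \<longlonglongrightarrow> lim (\<lambda>n. u n x)"
  proof (rule AE_mp, intro AE_I2 impI)
    fix x assume "summable (\<lambda>k. \<bar>d k x\<bar>)"
    then have "summable (\<lambda>k. d k x)" by (rule summable_rabs_cancel)
    then have "convergent (\<lambda>n. u 0 x + (\<Sum>k<n. d k x))"
      unfolding summable_iff_convergent by (intro convergent_add convergent_const)
    moreover have "u 0 x + (\<Sum>k<n. d k x) = u n x" for n
      using sum_lessThan_telescope[of "\<lambda>k. u k x" n] by (simp add: d_def)
    ultimately show "(\<lambda>n. u n x) \<longlonglongrightarrow> lim (\<lambda>n. u n x)"
      by (simp add: convergent_LIMSEQ_iff)
  qed
  \<comment> \<open>Off the set of convergence \<open>lim\<close> returns some value; this set is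
    null, and the function is measurable in any case.\<close>
  define v where "v = (\<lambda>x. lim (\<lambda>n. u n x))"
  have vm: "v \<in> borel_measurable M"
    unfolding v_def by (intro borel_measurable_lim_metric Lp_measurable[OF u(1)])
  have ed: "dist (emb M p (u n)) (emb M p (u (n + k))) \<le> 2 * (1/2) ^ n" for n k
  proof -
    have "dist (emb M p (u n)) (emb M p (u (n + k))) \<le> (\<Sum>j<k. (1/2) ^ (n + j))"
    proof (induction k)
      case (Suc k)
      have "dist (emb M p (u n)) (emb M p (u (n + Suc k))) \<le>
         dist (emb M p (u n)) (emb M p (u (n + k))) + dist (emb M p (u (n + k))) (emb M p (u (n + Suc k)))"
        by (rule dist_triangle)
      moreover have "dist (emb M p (u (n + k))) (emb M p (u (n + Suc k))) \<le> (1/2) ^ (n + k)"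
        using f[of "n + k"] by (simp add: u(2) dist_commute)
      ultimately show ?case using Suc by simp
    qed simp
    also have "\<dots> = (1/2) ^ n * (\<Sum>j<k. (1/2) ^ j)" by (simp add: power_add sum_distrib_left)
    also have "\<dots> \<le> (1/2) ^ n * 2" by (intro mult_left_mono) (auto simp: sum_gp_strict)
    finally show ?thesis by simp
  qed
  \<comment> \<open>Fatou's lemma in \<open>k\<close>, applied to \<open>u n - u (n + k)\<close>,
    yields at once that \<open>u n - v\<close> lies in the space and how fast it tends to 0.\<close>
  have vn: "(\<lambda>x. u n x - v x) \<in> Lp M p \<and> Lp_norm M p (\<lambda>x. u n x - v x) \<le> 2 * (1/2) ^ n" for n
  proof -
    have 1: "AE x in M. (\<lambda>k. u n x - u (n + k) x) \<longlonglongrightarrow> u n x - v x"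
      using conv
    proof eventually_elim
      case (elim x)
      then have "(\<lambda>k. u (k + n) x) \<longlonglongrightarrow> v x" unfolding v_def by (rule LIMSEQ_ignore_initial_segment)
      then show ?case by (intro tendsto_diff tendsto_const) (simp add: add.commute)
    qed
    have 2: "Lp_norm M p (\<lambda>x. u n x - u (n + k) x) \<le> 2 * (1/2) ^ n" for k
      using ed[of n k] by (simp add: Lp_norm_diff[OF p u(1) u(1)] dist_norm)
    have 3: "(\<lambda>x. u n x - v x) \<in> borel_measurable M"
      by (intro borel_measurable_diff vm Lp_measurable[OF u(1)])
    have 4: "(\<lambda>x. u n x - u (n + k) x) \<in> Lp M p" for k by (rule Lp_diff[OF p u(1) u(1)])
    show ?thesis
      using Lp_Fatou(1)[OF p, where w = "\<lambda>k x. u n x - u (n + k) x", OF 4 2 3 1]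
        Lp_Fatou(2)[OF p, where w = "\<lambda>k x. u n x - u (n + k) x", OF 4 2 3 1] by blast
  qed
  then have vL: "v \<in> Lp M p" using Lp_diff[OF p u(1)[of 0], of "\<lambda>x. u 0 x - v x"] by simp
  have "(\<lambda>n. emb M p (u n)) \<longlonglongrightarrow> emb M p v"
  proof (rule LIM_zero_cancel, rule Lim_null_comparison)
    show "\<forall>\<^sub>F n in sequentially. norm (emb M p (u n) - emb M p v) \<le> 2 * (1/2) ^ n"
      using vn by (simp add: Lp_norm_diff[OF p u(1) vL])
    show "(\<lambda>n. 2 * (1/2::real) ^ n) \<longlonglongrightarrow> 0"
      by (intro tendsto_mult_right_zero LIMSEQ_power_zero) simp
  qed
  moreover have "(\<lambda>n. emb M p (u n)) \<longlonglongrightarrow> l"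
  proof (rule LIM_zero_cancel, rule Lim_null_comparison)
    show "\<forall>\<^sub>F n in sequentially. norm (emb M p (u n) - l) \<le> (1/2) ^ n / 4"
      by (intro always_eventually allI) (metis u(2) dist_norm less_imp_le fl)
    show "(\<lambda>n. (1/2::real) ^ n / 4) \<longlonglongrightarrow> 0"
      by (intro tendsto_divide_zero LIMSEQ_power_zero) simp
  qed
  ultimately have "l = emb M p v" by (rule LIMSEQ_unique[rotated])
  then show "l \<in> emb M p ` Lp M p" using vL by blast
qed

section \<open>Truncation and domination\<close>

lemma Lp_level_set_finite:
  assumes p: "1 \<le> p" "p < \<infinity>" and u: "u \<in> Lp M p" and e: "0 < e"
  shows "emeasure M {x \<in> space M. e \<le> \<bar>u x\<bar>} < \<infinity>"
proof -
  define r where "r = enn2real p"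
  have r: "1 \<le> r" "p \<noteq> \<infinity>" using ennreal_exponent[OF p] by (auto simp: r_def)
  note [measurable] = Lp_measurable[OF u]
  let ?A = "{x \<in> space M. e \<le> \<bar>u x\<bar>}"
  have "integrable M (\<lambda>x. \<bar>u x\<bar> powr r / e powr r)"
    using u r by (auto simp: Lp_finite_iff r_def)
  then have "integrable M (indicator ?A :: 'a \<Rightarrow> real)"
  proof (rule Bochner_Integration.integrable_bound)
    have "e powr r \<le> \<bar>u x\<bar> powr r" if "e \<le> \<bar>u x\<bar>" for x using that e r by (intro powr_mono2) auto
    then show "AE x in M. norm (indicator ?A x :: real) \<le> norm (\<bar>u x\<bar> powr r / e powr r)"
      using e by (intro AE_I2) (auto simp: indicator_def)
  qed measurable
  moreover have "?A \<inter> space M = ?A" by auto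
  ultimately show ?thesis by (metis integrable_indicator_iff)
qed

lemma bounded_finite_support_Lp:
  assumes p: "1 \<le> p" and u: "u \<in> borel_measurable M" and B: "\<And>x. \<bar>u x\<bar> \<le> B"
    and fin: "emeasure M {x \<in> space M. u x \<noteq> 0} < \<infinity>"
  shows "u \<in> Lp M p"
proof (cases "p = \<infinity>")
  case True
  then show ?thesis using LinfI(1)[OF u AE_I2[OF B]] by simp
next
  case False
  define r where "r = enn2real p"
  have r: "1 \<le> r" using ennreal_exponent[of p] p False by (auto simp: r_def less_top)
  note [measurable] = u
  let ?A = "{x \<in> space M. u x \<noteq> 0}"
  have "integrable M (indicator ?A :: 'a \<Rightarrow> real)" 
    using fin by (intro integrable_real_indicator) auto
  then have "integrable M (\<lambda>x. B powr r * indicator ?A x)" by (rule integrable_mult_right)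
  then have "integrable M (\<lambda>x. \<bar>u x\<bar> powr r)"
  proof (rule Bochner_Integration.integrable_bound)
    have "\<bar>u x\<bar> powr r \<le> B powr r" for x using B r by (intro powr_mono2) auto
    then show "AE x in M. norm (\<bar>u x\<bar> powr r) \<le> norm (B powr r * indicator ?A x)"
      by (intro AE_I2) (auto simp: indicator_def)
  qed measurable
  then show ?thesis using False u by (simp add: Lp_finite_iff r_def)
qed

lemma indicator_Lp:
  assumes "1 \<le> p" "A \<in> sets M" "emeasure M A < \<infinity>"
  shows "indicator A \<in> Lp M p"
proof (rule bounded_finite_support_Lp[where B = 1])
  have "{x \<in> space M. (indicator A x :: real) \<noteq> 0} = A"
    using sets.sets_into_space[OF assms(2)] by (auto simp: indicator_def)
  then show "emeasure M {x \<in> space M. (indicator A x :: real) \<noteq> 0} < \<infinity>" using assms by simp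
qed (use assms in \<open>auto simp: indicator_def\<close>)

text \<open>Small values are cut off as well as large ones. The support of the truncation of an L_p
  function then has finite measure, so the truncation lies in every L_q and in particular in
  L_2.\<close>

definition trunc :: "nat \<Rightarrow> ('a \<Rightarrow> real) \<Rightarrow> 'a \<Rightarrow> real" where
  "trunc n u x = (if 1 / (real n + 1) \<le> \<bar>u x\<bar> \<and> \<bar>u x\<bar> \<le> real n + 1 then u x else 0)"

lemma trunc_measurable [measurable]:
  assumes [measurable]: "u \<in> borel_measurable M"
  shows "trunc n u \<in> borel_measurable M"
  unfolding trunc_def by measurable

lemma trunc_abs_le: "\<bar>trunc n u x\<bar> \<le> \<bar>u x\<bar>" "\<bar>trunc n u x\<bar> \<le> real n + 1"
  by (auto simp: trunc_def)

lemma trunc_tendsto: "(\<lambda>n. trunc n u x) \<longlonglongrightarrow> u x"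
proof (cases "u x = 0")
  case False
  obtain N where N: "max \<bar>u x\<bar> (1 / \<bar>u x\<bar>) < real N" using reals_Archimedean2 by blast
  have "trunc n u x = u x" if "N \<le> n" for n
  proof -
    have le: "\<bar>u x\<bar> \<le> real n + 1" "1 / \<bar>u x\<bar> \<le> real n + 1" using N that by auto
    then have "1 \<le> (real n + 1) * \<bar>u x\<bar>" using False by (simp add: divide_simps)
    then have "1 / (real n + 1) \<le> \<bar>u x\<bar>" by (simp add: divide_simps mult.commute)
    then show ?thesis using le by (simp add: trunc_def)
  qed
  then show ?thesis by (intro tendsto_eventually) (auto simp: eventually_sequentially)
qed (simp add: trunc_def)

lemma trunc_support_finite:
  assumes p: "1 \<le> p" "p < \<infinity>" and u: "u \<in> Lp M p"
  shows "emeasure M {x \<in> space M. trunc n u x \<noteq> 0} < \<infinity>"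
proof -
  note [measurable] = Lp_measurable[OF u]
  have "emeasure M {x \<in> space M. trunc n u x \<noteq> 0} \<le> emeasure M {x \<in> space M. 1 / (real n + 1) \<le> \<bar>u x\<bar>}"
    by (intro emeasure_mono) (auto simp: trunc_def split: if_splits)
  also have "\<dots> < \<infinity>" by (rule Lp_level_set_finite[OF p u]) simp
  finally show ?thesis .
qed

lemma trunc_Lp:
  assumes p: "1 \<le> p" "p < \<infinity>" and u: "u \<in> Lp M p" and q: "1 \<le> q"
  shows "trunc n u \<in> Lp M q"
  using bounded_finite_support_Lp[OF q trunc_measurable[OF Lp_measurable[OF u]] trunc_abs_le(2) trunc_support_finite[OF p u]] .

lemma Lp_dominated_convergence:
  assumes p: "1 \<le> p" "p < \<infinity>" and w: "\<And>n::nat. w n \<in> borel_measurable M" and u: "u \<in> borel_measurable M"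
    and g: "g \<in> Lp M p" and bd: "\<And>n. AE x in M. \<bar>w n x - u x\<bar> \<le> g x"
    and lim: "AE x in M. (\<lambda>n. w n x) \<longlonglongrightarrow> u x"
  shows "(\<lambda>n. Lp_norm M p (\<lambda>x. w n x - u x)) \<longlonglongrightarrow> 0"
proof -
  define r where "r = enn2real p"
  have r: "1 \<le> r" "p \<noteq> \<infinity>" using ennreal_exponent[OF p] by (auto simp: r_def)
  note [measurable] = w u Lp_measurable[OF g]
  have "(\<lambda>n. \<integral>x. \<bar>w n x - u x\<bar> powr r \<partial>M) \<longlonglongrightarrow> (\<integral>x. 0 \<partial>M)"
  proof (rule integral_dominated_convergence)
    show "integrable M (\<lambda>x. \<bar>g x\<bar> powr r)" using g r by (simp add: Lp_finite_iff r_def)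
    show "AE x in M. (\<lambda>n. \<bar>w n x - u x\<bar> powr r) \<longlonglongrightarrow> 0"
      using lim
    proof eventually_elim
      case (elim x)
      then have "(\<lambda>n. \<bar>w n x - u x\<bar>) \<longlonglongrightarrow> 0" by (intro tendsto_rabs_zero LIM_zero)
      then have "(\<lambda>n. \<bar>w n x - u x\<bar> powr r) \<longlonglongrightarrow> 0 powr r" using r by (intro tendsto_powr' tendsto_const) auto
      then show ?case by simp
    qed
    show "AE x in M. norm (\<bar>w n x - u x\<bar> powr r) \<le> \<bar>g x\<bar> powr r" for n
      using bd[of n] by (rule AE_mp) (use r in \<open>auto intro!: AE_I2 powr_mono2\<close>)
  qed measurable
  then have "(\<lambda>n. (\<integral>x. \<bar>w n x - u x\<bar> powr r \<partial>M) powr (1 / r)) \<longlonglongrightarrow> 0 powr (1 / r)"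
    using r by (intro tendsto_powr' tendsto_const) auto
  then show ?thesis using r by (simp add: Lp_norm_def r_def)
qed

lemma trunc_approx:
  assumes p: "1 \<le> p" "p < \<infinity>" and u: "u \<in> Lp M p"
  shows "(\<lambda>n. emb M p (trunc n u)) \<longlonglongrightarrow> emb M p u"
proof -
  have "(\<lambda>n. Lp_norm M p (\<lambda>x. trunc n u x - u x)) \<longlonglongrightarrow> 0"
    by (rule Lp_dominated_convergence[OF p _ _ Lp_scale[OF p Lp_abs[OF p u], of 2]])
      (use Lp_measurable[OF u] in \<open>auto intro!: AE_I2 trunc_tendsto trunc_measurable, auto simp: trunc_def\<close>)
  then have "(\<lambda>n. norm (emb M p (trunc n u) - emb M p u)) \<longlonglongrightarrow> 0"
    by (simp add: Lp_norm_diff[OF p trunc_Lp[OF p u p(1)] u])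
  then show ?thesis by (rule LIM_zero_cancel[OF tendsto_norm_zero_cancel])
qed

text \<open>The summands may come from different spaces. Where \<open>a + b\<close> is at least
  \<open>e\<close>, one of them has absolute value at least \<open>e / 2\<close>, so this set has
  finite measure and its indicator is an admissible test, whether or not the measure is
  sigma-finite.\<close>

lemma AE_nonpos_test:
  assumes p: "1 \<le> p" "p < \<infinity>" and q: "1 \<le> q" "q < \<infinity>" and a: "a \<in> Lp M p" and b: "b \<in> Lp M q"
    and test: "\<And>A. A \<in> sets M \<Longrightarrow> emeasure M A < \<infinity> \<Longrightarrow> (\<integral>x. a x * indicator A x \<partial>M) + (\<integral>x. b x * indicator A x \<partial>M) \<le> 0"
  shows "AE x in M. a x + b x \<le> 0"
proof -
  note [measurable] = Lp_measurable[OF a] Lp_measurable[OF b]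
  define A where "A = (\<lambda>n::nat. {x \<in> space M. 1 / (real n + 1) \<le> a x + b x})"
  have As [measurable]: "A n \<in> sets M" for n unfolding A_def by measurable
  have "A n \<in> null_sets M" for n
  proof -
    define e where "e = 1 / (real n + 1)"
    have e: "0 < e" by (simp add: e_def)
    let ?B = "{x \<in> space M. e / 2 \<le> \<bar>a x\<bar>}" and ?C = "{x \<in> space M. e / 2 \<le> \<bar>b x\<bar>}"
    have "emeasure M (A n) \<le> emeasure M (?B \<union> ?C)"
      by (intro emeasure_mono) (auto simp: A_def e_def[symmetric])
    also have "\<dots> \<le> emeasure M ?B + emeasure M ?C" by (intro emeasure_subadditive) auto
    also have "\<dots> < \<infinity>"
      using Lp_level_set_finite[OF p a, of "e/2"] Lp_level_set_finite[OF q b, of "e/2"] e by simp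
    finally have fin: "emeasure M (A n) < \<infinity>" .
    obtain p' q' :: ennreal where p': "1 / p + 1 / p' = 1" and q': "1 / q + 1 / q' = 1"
      using conjugate_exponent_exists p q by blast
    have "1 \<le> p'" "1 \<le> q'" using conjugate_exponent_cases[OF p p'] conjugate_exponent_cases[OF q q'] by (metis top_greatest infinity_ennreal_def)+
    then have ia: "integrable M (\<lambda>x. a x * indicator (A n) x)" and ib: "integrable M (\<lambda>x. b x * indicator (A n) x)"
      using Holder_inequality(1)[OF p p' a] Holder_inequality(1)[OF q q' b] indicator_Lp[OF _ As fin] by blast+
    have ii: "integrable M (indicator (A n) :: 'a \<Rightarrow> real)" using fin by (intro integrable_real_indicator) auto
    have "e * measure M (A n) = (\<integral>x. e * indicator (A n) x \<partial>M)" using As by simp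
    also have "\<dots> \<le> (\<integral>x. a x * indicator (A n) x + b x * indicator (A n) x \<partial>M)"
    proof (rule integral_mono)
      show "e * indicator (A n) x \<le> a x * indicator (A n) x + b x * indicator (A n) x" for x
        by (cases "x \<in> A n") (auto simp: A_def e_def)
    qed (use ia ib ii in auto)
    also have "\<dots> \<le> 0" using test[OF As fin] ia ib by simp
    finally have "measure M (A n) = 0" using e by (simp add: mult_le_0_iff measure_le_0_iff)
    then have "emeasure M (A n) = 0" using fin by (simp add: emeasure_eq_ennreal_measure less_top)
    then show ?thesis using As by (simp add: null_sets_def)
  qed
  then have "(\<Union>n. A n) \<in> null_sets M" by (rule null_sets_UN)
  then show ?thesis
  proof (rule AE_I')
    show "{x \<in> space M. \<not> a x + b x \<le> 0} \<subseteq> (\<Union>n. A n)"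
    proof safe
      fix x assume x: "x \<in> space M" "\<not> a x + b x \<le> 0"
      then obtain n where "1 / (a x + b x) < real n" using reals_Archimedean2 by blast
      then have "1 / (real n + 1) \<le> a x + b x" using x by (simp add: field_simps)
      then show "x \<in> (\<Union>n. A n)" using x by (auto simp: A_def)
    qed
  qed
qed

section \<open>Pairings as functionals, and the cone of nonnegative functions\<close>

lemma conjugate_exponent_ge_1:
  fixes p p' :: ennreal
  assumes "1 \<le> p" "p < \<infinity>" "1 / p + 1 / p' = 1"
  shows "1 \<le> p'"
  by (rule conjugate_exponent_cases[OF assms]) auto

lemma two_ge_1: "1 \<le> (2::ennreal)" "(2::ennreal) < \<infinity>"
  by auto

lemma conjugate_exponent_2: "(1::ennreal) / 2 + 1 / 2 = 1"
proof -
  have "(1::ennreal) / 2 = ennreal (1 / 2)" using divide_ennreal[of 1 2] by simp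
  moreover have "ennreal (1 / 2) + ennreal (1 / 2) = ennreal (1 / 2 + 1 / 2)"
    by (rule ennreal_plus[symmetric]) auto
  ultimately show ?thesis by simp
qed

lemma bounded_linear_apply_bcontfun: "bounded_linear (\<lambda>e :: 'b::topological_space \<Rightarrow>\<^sub>C real. apply_bcontfun e x)"
proof (rule bounded_linear_intro[where K = 1])
  show "norm (apply_bcontfun e x) \<le> norm e * 1" for e :: "'b \<Rightarrow>\<^sub>C real" using norm_bounded[of e x] by simp
qed auto

lemma scaled_unit_dual:
  assumes p: "1 \<le> p" "p < \<infinity>" and conj: "1 / p + 1 / p' = 1" and v: "v \<in> Lp M p'"
    and c: "0 < c" "Lp_norm M p' v \<le> c"
  shows "(\<lambda>x. (1 / c) * v x) \<in> unit_duals M p"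
proof -
  have "integrable M (\<lambda>x. u x * (1 / c * v x)) \<and> \<bar>\<integral>x. u x * (1 / c * v x) \<partial>M\<bar> \<le> Lp_norm M p u" if u: "u \<in> Lp M p" for u
  proof -
    have eq: "u x * (1 / c * v x) = (1 / c) * (u x * v x)" for x by simp
    have "\<bar>\<integral>x. u x * v x \<partial>M\<bar> \<le> Lp_norm M p u * c"
      using Holder_inequality(2)[OF p conj u v] mult_left_mono[OF c(2) Lp_norm_nonneg[of M p u]] by linarith
    then have "\<bar>\<integral>x. u x * (1 / c * v x) \<partial>M\<bar> \<le> Lp_norm M p u"
      unfolding eq using c by (simp add: abs_mult divide_simps)
    then show ?thesis unfolding eq using Holder_inequality(1)[OF p conj u v] by simp
  qed
  then show ?thesis using Lp_measurable[OF v] by (simp add: unit_duals_def)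
qed

text \<open>Evaluation at a multiple of \<open>v\<close> inside the dual unit ball, scaled back. It
  is bounded and linear on the whole ambient type, so vector-valued limits, derivatives and
  integrals can be turned into real ones.\<close>

lemma pairing_functional:
  assumes p: "1 \<le> p" "p < \<infinity>" and conj: "1 / p + 1 / p' = 1" and v: "v \<in> Lp M p'"
  shows "\<exists>\<phi>. bounded_linear \<phi> \<and> (\<forall>u\<in>Lp M p. \<phi> (emb M p u) = pairing M u v)"
proof -
  \<comment> \<open>The maximum with 1 keeps the scaling factor positive when \<open>v\<close> has
    norm 0.\<close>
  define c where "c = max 1 (Lp_norm M p' v)"
  have c: "0 < c" by (simp add: c_def)
  have vc: "(\<lambda>x. (1 / c) * v x) \<in> unit_duals M p"
    by (rule scaled_unit_dual[OF p conj v c]) (simp add: c_def)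
  have "bounded_linear (\<lambda>e. c * apply_bcontfun e (discrete (\<lambda>x. (1 / c) * v x)) :: real)"
    by (intro bounded_linear_const_mult bounded_linear_apply_bcontfun)
  moreover have "c * apply_bcontfun (emb M p u) (discrete (\<lambda>x. (1 / c) * v x)) = pairing M u v" if "u \<in> Lp M p" for u
    unfolding emb_eval[OF p that vc] using c by (simp add: pairing_def)
  ultimately show ?thesis by blast
qed

definition pos_cone :: "'a measure \<Rightarrow> ennreal \<Rightarrow> 'a lp_rep set" where
  "pos_cone M p = emb M p ` {u \<in> Lp M p. AE x in M. 0 \<le> u x}"

lemma pos_cone_iff:
  assumes p: "1 \<le> p" "p < \<infinity>" and u: "u \<in> Lp M p"
  shows "emb M p u \<in> pos_cone M p \<longleftrightarrow> (AE x in M. 0 \<le> u x)"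
  using u by (force simp: pos_cone_def emb_eq_iff[OF p] elim: AE_mp)

text \<open>The cone is the intersection of the closed subspace with closed half-spaces, one for
  each nonnegative element of the dual unit ball. Multiples of indicators among these already force
  nonnegativity.\<close>

lemma closed_pos_cone:
  assumes p: "1 \<le> p" "p < \<infinity>"
  shows "closed (pos_cone M p)"
proof -
  obtain p' :: ennreal where p': "1 / p + 1 / p' = 1" using conjugate_exponent_exists[OF p] by blast
  let ?I = "{v \<in> unit_duals M p. AE x in M. 0 \<le> v x}"
  have "pos_cone M p = emb M p ` Lp M p \<inter> (\<Inter>v\<in>?I. {e. 0 \<le> apply_bcontfun e (discrete v)})"
  proof (intro equalityI subsetI)
    fix e assume "e \<in> pos_cone M p"
    then obtain u where u: "u \<in> Lp M p" "AE x in M. 0 \<le> u x" "e = emb M p u" by (auto simp: pos_cone_def)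
    have "0 \<le> pairing M u v" if "AE x in M. 0 \<le> v x" for v
      unfolding pairing_def by (rule integral_nonneg_AE, use u(2) that in eventually_elim) simp
    then show "e \<in> emb M p ` Lp M p \<inter> (\<Inter>v\<in>?I. {e. 0 \<le> apply_bcontfun e (discrete v)})"
      using u by (auto simp: emb_eval[OF p])
  next
    fix e assume e: "e \<in> emb M p ` Lp M p \<inter> (\<Inter>v\<in>?I. {e. 0 \<le> apply_bcontfun e (discrete v)})"
    then obtain u where u: "u \<in> Lp M p" "e = emb M p u" by auto
    have "AE x in M. (- 1) * u x + 0 \<le> 0"
    proof (rule AE_nonpos_test[OF p p Lp_scale[OF p u(1)] Lp_zero[OF p]])
      fix A assume A: "A \<in> sets M" "emeasure M A < \<infinity>"
      have iA: "indicator A \<in> Lp M p'" by (intro indicator_Lp conjugate_exponent_ge_1[OF p p'] A)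
      define c where "c = max 1 (Lp_norm M p' (indicator A))"
      have c: "0 < c" by (simp add: c_def)
      have vc: "(\<lambda>x. (1 / c) * indicator A x) \<in> unit_duals M p"
        by (rule scaled_unit_dual[OF p p' iA c]) (simp add: c_def)
      then have "0 \<le> apply_bcontfun e (discrete (\<lambda>x. (1 / c) * indicator A x))"
        using e c by auto
      then have "0 \<le> pairing M u (\<lambda>x. (1 / c) * indicator A x)" unfolding u(2) emb_eval[OF p u(1) vc] .
      then have "0 \<le> (\<integral>x. u x * indicator A x \<partial>M)" using c by (simp add: pairing_def zero_le_divide_iff)
      then show "(\<integral>x. (- 1) * u x * indicator A x \<partial>M) + (\<integral>x. 0 * indicator A x \<partial>M) \<le> 0" by simp
    qed
    then have "AE x in M. 0 \<le> u x" by simp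
    then show "e \<in> pos_cone M p" using u by (auto simp: pos_cone_def)
  qed
  moreover have "closed {e :: 'a lp_rep. 0 \<le> apply_bcontfun e (discrete v)}" for v
    by (intro closed_Collect_le continuous_on_const linear_continuous_on bounded_linear_apply_bcontfun)
  ultimately show ?thesis by (auto intro!: closed_Int closed_INT closed_emb[OF p])
qed

lemma pos_cone_cone:
  assumes p: "1 \<le> p" "p < \<infinity>"
  shows "pos_cone M p \<subseteq> emb M p ` Lp M p" "0 \<in> pos_cone M p"
    "\<And>x y. x \<in> pos_cone M p \<Longrightarrow> y \<in> pos_cone M p \<Longrightarrow> x + y \<in> pos_cone M p"
    "\<And>c x. 0 \<le> c \<Longrightarrow> x \<in> pos_cone M p \<Longrightarrow> c *\<^sub>R x \<in> pos_cone M p"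
proof -
  show "pos_cone M p \<subseteq> emb M p ` Lp M p" by (auto simp: pos_cone_def)
  have "emb M p (\<lambda>x. 0) = 0" using emb_scale[OF p Lp_zero[OF p], of M 0] by simp
  moreover have "emb M p (\<lambda>x. 0) \<in> pos_cone M p" using pos_cone_iff[OF p Lp_zero[OF p, of M]] by simp
  ultimately show "0 \<in> pos_cone M p" by simp
  show "x + y \<in> pos_cone M p" if xy: "x \<in> pos_cone M p" "y \<in> pos_cone M p" for x y
  proof -
    obtain u v where u: "u \<in> Lp M p" "AE x in M. 0 \<le> u x" "x = emb M p u"
      and v: "v \<in> Lp M p" "AE x in M. 0 \<le> v x" "y = emb M p v" using xy by (auto simp: pos_cone_def)
    have "AE x in M. 0 \<le> u x + v x" using u(2) v(2) by eventually_elim simp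
    then show ?thesis using pos_cone_iff[OF p Lp_add[OF p u(1) v(1)]] by (simp add: emb_add[OF p u(1) v(1)] u v)
  qed
  show "c *\<^sub>R x \<in> pos_cone M p" if cx: "0 \<le> c" "x \<in> pos_cone M p" for c x
  proof -
    obtain u where u: "u \<in> Lp M p" "AE x in M. 0 \<le> u x" "x = emb M p u"
      using cx by (auto simp: pos_cone_def)
    have "AE x in M. 0 \<le> c * u x" using u(2) by eventually_elim (simp add: cx)
    then show ?thesis using pos_cone_iff[OF p Lp_scale[OF p u(1)]] by (simp add: emb_scale[OF p u(1)] u)
  qed
qed

text \<open>The test function is the norming function of a truncation of \<open>u\<close>. It is
  bounded with support of finite measure, because \<open>u\<close> is in \<open>L_2\<close>, hence
  it is admissible; Fatou's lemma removes the truncation.\<close>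

lemma converse_Holder:
  assumes p: "1 \<le> p" "p < \<infinity>" and conj: "1 / p + 1 / p' = 1" and u: "u \<in> Lp M 2" and c: "0 \<le> c"
    and bd: "\<And>g. g \<in> Lp M 2 \<Longrightarrow> g \<in> Lp M p' \<Longrightarrow> \<bar>pairing M u g\<bar> \<le> c * Lp_norm M p' g"
  shows "u \<in> Lp M p" "Lp_norm M p u \<le> c"
proof -
  have two: "1 \<le> (2::ennreal)" "(2::ennreal) < \<infinity>" by auto
  note um = Lp_measurable[OF u]
  have tp: "trunc n u \<in> Lp M p" for n by (rule trunc_Lp[OF two u p(1)])
  have tn: "Lp_norm M p (trunc n u) \<le> c" for n
  proof -
    note nt = norming[OF p conj tp[of n]]
    let ?g = "norming M p (trunc n u)"
    have "?g \<in> Lp M 2"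
    proof (rule bounded_finite_support_Lp[OF two(1)])
      show "?g \<in> borel_measurable M" by (intro norming_measurable trunc_measurable um)
      show "\<bar>?g x\<bar> \<le> (real n + 1) powr (enn2real p - 1) / Lp_norm M p (trunc n u) powr (enn2real p - 1)" for x
      proof -
        have "\<bar>?g x\<bar> \<le> \<bar>trunc n u x\<bar> powr (enn2real p - 1) / Lp_norm M p (trunc n u) powr (enn2real p - 1)"
          by (auto simp: norming_def abs_mult sgn_if)
        also have "\<dots> \<le> (real n + 1) powr (enn2real p - 1) / Lp_norm M p (trunc n u) powr (enn2real p - 1)"
          using ennreal_exponent(1)[OF p] trunc_abs_le(2)[of n u x] by (intro divide_right_mono powr_mono2) auto
        finally show ?thesis .
      qed
      have "{x \<in> space M. ?g x \<noteq> 0} \<subseteq> {x \<in> space M. trunc n u x \<noteq> 0}" by (auto simp: norming_def)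
      then have "emeasure M {x \<in> space M. ?g x \<noteq> 0} \<le> emeasure M {x \<in> space M. trunc n u x \<noteq> 0}"
        using um by (intro emeasure_mono) auto
      then show "emeasure M {x \<in> space M. ?g x \<noteq> 0} < \<infinity>"
        using trunc_support_finite[OF two u, of n] by (rule le_less_trans)
    qed
    then have le: "\<bar>pairing M u ?g\<bar> \<le> c * Lp_norm M p' ?g"
      by (rule bd[OF _ norming(1)[OF p conj tp]])
    \<comment> \<open>The truncation is 0 wherever it differs from \<open>u\<close>, and there
      \<open>?g\<close> vanishes too.\<close>
    have "(\<lambda>x. u x * ?g x) = (\<lambda>x. trunc n u x * ?g x)" by (rule ext) (simp add: norming_def trunc_def)
    then have "pairing M u ?g = Lp_norm M p (trunc n u)"
      using nt(3) unfolding pairing_def by presburger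
    moreover have "c * Lp_norm M p' ?g \<le> c" using nt(2) c by (simp add: mult_left_le)
    ultimately show ?thesis using le by linarith
  qed
  show "u \<in> Lp M p" "Lp_norm M p u \<le> c"
    using Lp_Fatou[OF p tp tn um AE_I2[OF trunc_tendsto]] by auto
qed

text \<open>If |u| exceeded \<open>c\<close> by at least \<open>e\<close> on a set of positive
  measure, then testing with the sign of \<open>u\<close> on that set would contradict the bound.
  The set has finite measure since \<open>u\<close> is in \<open>L_2\<close>.\<close>

lemma converse_Holder_infinity:
  assumes u: "u \<in> Lp M 2" and c: "0 \<le> c"
    and bd: "\<And>g. g \<in> Lp M 2 \<Longrightarrow> g \<in> Lp M 1 \<Longrightarrow> \<bar>pairing M u g\<bar> \<le> c * Lp_norm M 1 g"
  shows "u \<in> Lp M \<infinity>"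
proof -
  have two: "1 \<le> (2::ennreal)" "(2::ennreal) < \<infinity>" by auto
  note [measurable] = Lp_measurable[OF u]
  define A where "A = (\<lambda>n::nat. {x \<in> space M. c + 1 / (real n + 1) \<le> \<bar>u x\<bar>})"
  have As [measurable]: "A n \<in> sets M" for n unfolding A_def by measurable
  have "A n \<in> null_sets M" for n
  proof -
    define e where "e = 1 / (real n + 1)"
    have e: "0 < e" by (simp add: e_def)
    have "0 < c + e" using c e by simp
    from Lp_level_set_finite[OF two u this] have fin: "emeasure M (A n) < \<infinity>"
      unfolding A_def e_def .
    define g where "g = (\<lambda>x. sgn (u x) * indicator (A n) x :: real)"
    have gm [measurable]: "g \<in> borel_measurable M" unfolding g_def sgn_if by measurable
    have gA: "\<bar>g x\<bar> = indicator (A n) x" for x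
    proof (cases "x \<in> A n")
      case True
      then have "c + e \<le> \<bar>u x\<bar>" by (simp add: A_def e_def)
      then have "u x \<noteq> 0" using c e by auto
      then show ?thesis using True by (simp add: g_def sgn_if)
    qed (simp add: g_def)
    have gL: "g \<in> Lp M q" if "1 \<le> q" for q
    proof (rule bounded_finite_support_Lp[OF that gm, where B = 1])
      show "\<bar>g x\<bar> \<le> 1" for x unfolding gA by (simp add: indicator_def)
      have "{x \<in> space M. g x \<noteq> 0} \<subseteq> A n" by (auto simp: g_def indicator_def split: if_splits)
      then show "emeasure M {x \<in> space M. g x \<noteq> 0} < \<infinity>"
        using emeasure_mono[OF _ As, of _ n] fin by (metis le_less_trans)
    qed
    have le: "\<bar>pairing M u g\<bar> \<le> c * Lp_norm M 1 g" by (intro bd gL) auto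
    have ii: "integrable M (indicator (A n) :: 'a \<Rightarrow> real)" using fin by (intro integrable_real_indicator) auto
    have ng: "Lp_norm M 1 g = measure M (A n)" using As by (simp add: Lp_norm_def gA)
     have "(c + e) * measure M (A n) \<le> pairing M u g"
    proof -
      have ug: "u x * g x = \<bar>u x\<bar> * indicator (A n) x" for x by (simp add: g_def abs_sgn)
      have "integrable M (\<lambda>x. u x * g x)"
        using Holder_inequality(1)[OF two conjugate_exponent_2 u] gL[of 2] by simp
      then have ui: "integrable M (\<lambda>x. \<bar>u x\<bar> * indicator (A n) x)" unfolding ug .
      have "(\<integral>x. (c + e) * indicator (A n) x \<partial>M) \<le> (\<integral>x. \<bar>u x\<bar> * indicator (A n) x \<partial>M)"
      proof (rule integral_mono)
        show "(c + e) * indicator (A n) x \<le> \<bar>u x\<bar> * indicator (A n) x" for x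
          by (cases "x \<in> A n") (auto simp: A_def e_def)
      qed (use ui ii in auto)
      then show ?thesis using As by (simp add: pairing_def ug)
    qed
    then have "(c + e) * measure M (A n) \<le> c * measure M (A n)" using le unfolding ng by linarith
    then have "e * measure M (A n) \<le> 0" by (simp add: distrib_right)
    then have "measure M (A n) = 0" using e by (simp add: mult_le_0_iff measure_le_0_iff)
    then have "emeasure M (A n) = 0" using fin by (simp add: emeasure_eq_ennreal_measure less_top)
    then show ?thesis using As by (simp add: null_sets_def)
  qed
  then have "(\<Union>n. A n) \<in> null_sets M" by (rule null_sets_UN)
  then have "AE x in M. \<bar>u x\<bar> \<le> c"
  proof (rule AE_I')
    show "{x \<in> space M. \<not> \<bar>u x\<bar> \<le> c} \<subseteq> (\<Union>n. A n)"
    proof safe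
      fix x assume x: "x \<in> space M" "\<not> \<bar>u x\<bar> \<le> c"
      then obtain n where "1 / (\<bar>u x\<bar> - c) < real n" using reals_Archimedean2 by blast
      then have "1 / (real n + 1) \<le> \<bar>u x\<bar> - c" using x by (simp add: field_simps)
      then have "x \<in> A n" using x by (simp add: A_def)
      then show "x \<in> (\<Union>n. A n)" by blast
    qed
  qed
  then show ?thesis by (rule LinfI(1)[rotated]) measurable
qed

section \<open>Positive semigroups on \<open>L\<^sub>p\<close>\<close>

lemma bounded_operatorD:
  assumes "bounded_operator M p B"
  shows "u \<in> Lp M p \<Longrightarrow> B u \<in> Lp M p"
    and "u \<in> Lp M p \<Longrightarrow> v \<in> Lp M p \<Longrightarrow> AE x in M. u x = v x \<Longrightarrow> AE x in M. B u x = B v x"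
    and "u \<in> Lp M p \<Longrightarrow> v \<in> Lp M p \<Longrightarrow> AE x in M. B (\<lambda>y. u y + v y) x = B u x + B v x"
    and "u \<in> Lp M p \<Longrightarrow> AE x in M. B (\<lambda>y. c * u y) x = c * B u x"
    and "\<exists>K. \<forall>u\<in>Lp M p. Lp_norm M p (B u) \<le> K * Lp_norm M p u"
  using assms unfolding bounded_operator_def by blast+

text \<open>Some representative is chosen; the choice is harmless because operators respect equality
  almost everywhere.\<close>

definition lift :: "'a measure \<Rightarrow> ennreal \<Rightarrow> (('a \<Rightarrow> real) \<Rightarrow> 'a \<Rightarrow> real) \<Rightarrow> 'a lp_rep \<Rightarrow> 'a lp_rep" where
  "lift M p B e = emb M p (B (inv_into (Lp M p) (emb M p) e))"

lemma lift_emb: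
  assumes p: "1 \<le> p" "p < \<infinity>" and B: "bounded_operator M p B" and u: "u \<in> Lp M p"
  shows "lift M p B (emb M p u) = emb M p (B u)"
proof -
  let ?v = "inv_into (Lp M p) (emb M p) (emb M p u)"
  have v: "?v \<in> Lp M p" "emb M p ?v = emb M p u"
    using inv_into_into[of "emb M p u" "emb M p" "Lp M p"] f_inv_into_f[of "emb M p u" "emb M p" "Lp M p"] u by auto
  then have "AE x in M. ?v x = u x" using emb_eq_iff[OF p v(1) u] by simp
  then have "AE x in M. B ?v x = B u x" by (rule bounded_operatorD(2)[OF B v(1) u])
  then show ?thesis
    unfolding lift_def using emb_eq_iff[OF p bounded_operatorD(1)[OF B v(1)] bounded_operatorD(1)[OF B u]] by simp
qed

lemma emb_operator_add:
  assumes p: "1 \<le> p" "p < \<infinity>" and B: "bounded_operator M p B" and u: "u \<in> Lp M p" and v: "v \<in> Lp M p"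
  shows "emb M p (B (\<lambda>x. u x + v x)) = emb M p (B u) + emb M p (B v)"
  using bounded_operatorD(3)[OF B u v] emb_eq_iff[OF p bounded_operatorD(1)[OF B Lp_add[OF p u v]]
      Lp_add[OF p bounded_operatorD(1)[OF B u] bounded_operatorD(1)[OF B v]]]
    emb_add[OF p bounded_operatorD(1)[OF B u] bounded_operatorD(1)[OF B v]] by simp

lemma emb_operator_scale:
  assumes p: "1 \<le> p" "p < \<infinity>" and B: "bounded_operator M p B" and u: "u \<in> Lp M p"
  shows "emb M p (B (\<lambda>x. c * u x)) = c *\<^sub>R emb M p (B u)"
  using bounded_operatorD(4)[OF B u] emb_eq_iff[OF p bounded_operatorD(1)[OF B Lp_scale[OF p u]]
      Lp_scale[OF p bounded_operatorD(1)[OF B u]]]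
    emb_scale[OF p bounded_operatorD(1)[OF B u]] by simp

lemma operator_diff:
  assumes p: "1 \<le> p" "p < \<infinity>" and B: "bounded_operator M p B" and u: "u \<in> Lp M p" and v: "v \<in> Lp M p"
  shows "AE x in M. B (\<lambda>x. u x - v x) x = B u x - B v x"
proof -
  have "AE x in M. B (\<lambda>x. u x + (- 1) * v x) x = B u x + B (\<lambda>x. (- 1) * v x) x"
    by (rule bounded_operatorD(3)[OF B u Lp_scale[OF p v]])
  moreover have "AE x in M. B (\<lambda>x. (- 1) * v x) x = (- 1) * B v x" by (rule bounded_operatorD(4)[OF B v])
  ultimately have "AE x in M. B (\<lambda>x. u x + (- 1) * v x) x = B u x - B v x" by eventually_elim simp
  then show ?thesis by simp
qed

lemma C0_semigroupD:
  assumes "C0_semigroup M p T"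
  shows "0 \<le> t \<Longrightarrow> bounded_operator M p (T t)"
    and "u \<in> Lp M p \<Longrightarrow> AE x in M. T 0 u x = u x"
    and "0 \<le> s \<Longrightarrow> 0 \<le> t \<Longrightarrow> u \<in> Lp M p \<Longrightarrow> AE x in M. T (s + t) u x = T s (T t u) x"
    and "u \<in> Lp M p \<Longrightarrow> ((\<lambda>t. Lp_norm M p (\<lambda>x. T t u x - u x)) \<longlongrightarrow> 0) (at_right 0)"
  using assms unfolding C0_semigroup_def by blast+

lemma C0_semigroup_in:
  "C0_semigroup M p T \<Longrightarrow> 0 \<le> t \<Longrightarrow> u \<in> Lp M p \<Longrightarrow> T t u \<in> Lp M p"
  using bounded_operatorD(1)[OF C0_semigroupD(1)] .

lemma emb_semigroup_tendsto:
  assumes p: "1 \<le> p" "p < \<infinity>" and T: "C0_semigroup M p T" and u: "u \<in> Lp M p"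
  shows "((\<lambda>t. emb M p (T t u)) \<longlongrightarrow> emb M p u) (at_right 0)"
proof -
  have "\<forall>\<^sub>F t in at_right 0. Lp_norm M p (\<lambda>x. T t u x - u x) = norm (emb M p (T t u) - emb M p u)"
    using eventually_nonneg_at_right by eventually_elim (simp add: Lp_norm_diff[OF p C0_semigroup_in[OF T _ u] u])
  then have "((\<lambda>t. norm (emb M p (T t u) - emb M p u)) \<longlongrightarrow> 0) (at_right 0)"
    by (rule Lim_transform_eventually[OF C0_semigroupD(4)[OF T u]])
  then show ?thesis by (rule LIM_zero_cancel[OF tendsto_norm_zero_cancel])
qed

lemma c0_semigroup_lift:
  assumes p: "1 \<le> p" "p < \<infinity>" and T: "C0_semigroup M p T" and K: "0 \<le> K"
    and bd: "\<And>t u. 0 \<le> t \<Longrightarrow> u \<in> Lp M p \<Longrightarrow> Lp_norm M p (T t u) \<le> K * exp (w * t) * Lp_norm M p u"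
  shows "c0_semigroup (emb M p ` Lp M p) (\<lambda>t. lift M p (T t)) K w"
proof
  note B = C0_semigroupD(1)[OF T]
  note Tin = C0_semigroup_in[OF T]
  note L = lift_emb[OF p B]
  fix s t c :: real and x y :: "'a lp_rep"
  assume "x \<in> emb M p ` Lp M p"
  then obtain u where u: "u \<in> Lp M p" "x = emb M p u" by auto
  show "lift M p (T 0) x = x"
    unfolding u(2) L[OF order_refl u(1)] emb_eq_iff[OF p Tin[OF order_refl u(1)] u(1)] by (rule C0_semigroupD(2)[OF T u(1)])
  show "((\<lambda>t. lift M p (T t) x) \<longlongrightarrow> x) (at_right 0)"
  proof (rule Lim_transform_eventually)
    show "((\<lambda>t. emb M p (T t u)) \<longlongrightarrow> x) (at_right 0)"
      unfolding u(2) by (rule emb_semigroup_tendsto[OF p T u(1)])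
    show "\<forall>\<^sub>F t in at_right 0. emb M p (T t u) = lift M p (T t) x"
      using eventually_nonneg_at_right by eventually_elim (simp add: u L)
  qed
  assume t: "0 \<le> t"
  show "lift M p (T t) x \<in> emb M p ` Lp M p"
    unfolding u(2) L[OF t u(1)] by (intro imageI Tin t u)
  show "lift M p (T t) (c *\<^sub>R x) = c *\<^sub>R lift M p (T t) x"
    unfolding u(2) L[OF t u(1)] emb_scale[OF p u(1), symmetric] L[OF t Lp_scale[OF p u(1)]]
    by (rule emb_operator_scale[OF p B[OF t] u(1)])
  show "norm (lift M p (T t) x) \<le> K * exp (w * t) * norm x"
    unfolding u(2) L[OF t u(1)] norm_emb[OF p u(1)] norm_emb[OF p Tin[OF t u(1)]] by (rule bd[OF t u(1)])
  show "lift M p (T t) (x + y) = lift M p (T t) x + lift M p (T t) y" if y: "y \<in> emb M p ` Lp M p"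
  proof -
    obtain v where v: "v \<in> Lp M p" "y = emb M p v" using y by auto
    show ?thesis
      unfolding u(2) v(2) L[OF t u(1)] L[OF t v(1)] emb_add[OF p u(1) v(1), symmetric] L[OF t Lp_add[OF p u(1) v(1)]]
      by (rule emb_operator_add[OF p B[OF t] u(1) v(1)])
  qed
  show "lift M p (T (s + t)) x = lift M p (T s) (lift M p (T t) x)" if s: "0 \<le> s"
    unfolding u(2) L[OF add_nonneg_nonneg[OF s t] u(1)] L[OF t u(1)] L[OF s Tin[OF t u(1)]]
      emb_eq_iff[OF p Tin[OF add_nonneg_nonneg[OF s t] u(1)] Tin[OF s Tin[OF t u(1)]]]
    by (rule C0_semigroupD(3)[OF T s t u(1)])
qed (simp_all add: closed_emb[OF p] subspace_emb[OF p] K)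

lemma generator_iff_gen:
  assumes p: "1 \<le> p" "p < \<infinity>" and T: "C0_semigroup M p T" and c: "c0_semigroup (emb M p ` Lp M p) (\<lambda>t. lift M p (T t)) K w"
    and u: "u \<in> Lp M p" and y: "y \<in> Lp M p"
  shows "(u, y) \<in> generator M p T \<longleftrightarrow> c0_semigroup.gen (emb M p ` Lp M p) (\<lambda>t. lift M p (T t)) (emb M p u) (emb M p y)"
proof -
  interpret c0_semigroup "emb M p ` Lp M p" "\<lambda>t. lift M p (T t)" K w by (rule c)
  have eq: "Lp_norm M p (\<lambda>x. (1 / t) * (T t u x - u x) - y x) = norm ((1 / t) *\<^sub>R (lift M p (T t) (emb M p u) - emb M p u) - emb M p y)"
    if "0 \<le> t" for t
  proof -
    note Tu = C0_semigroup_in[OF T that u]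
    show ?thesis
      unfolding lift_emb[OF p C0_semigroupD(1)[OF T that] u]
        Lp_norm_diff[OF p Lp_scale[OF p Lp_diff[OF p Tu u]] y] emb_scale[OF p Lp_diff[OF p Tu u]] emb_diff[OF p Tu u] ..
  qed
  have "((\<lambda>t. Lp_norm M p (\<lambda>x. (1 / t) * (T t u x - u x) - y x)) \<longlongrightarrow> 0) (at_right 0) \<longleftrightarrow>
     ((\<lambda>t. norm ((1 / t) *\<^sub>R (lift M p (T t) (emb M p u) - emb M p u) - emb M p y)) \<longlongrightarrow> 0) (at_right 0)"
    by (rule tendsto_cong, rule eventually_mono[OF eventually_nonneg_at_right]) (rule eq)
  also have "\<dots> \<longleftrightarrow> ((\<lambda>t. (1 / t) *\<^sub>R (lift M p (T t) (emb M p u) - emb M p u)) \<longlongrightarrow> emb M p y) (at_right 0)"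
    by (simp only: tendsto_norm_zero_iff LIM_zero_iff)
  finally show ?thesis using u y by (simp add: generator_def gen_def)
qed

text \<open>\<open>resolvent\<close> selects some solution of the equation. The resolvent on the
  embedded side supplies a solution, and uniqueness there identifies the class of the selected
  one.\<close>

lemma resolvent_eq_resolv:
  assumes p: "1 \<le> p" "p < \<infinity>" and T: "C0_semigroup M p T" and c: "c0_semigroup (emb M p ` Lp M p) (\<lambda>t. lift M p (T t)) K w"
    and l: "w < l" and u: "u \<in> Lp M p"
  defines "r \<equiv> resolvent M (generator M p T) l u"
  shows "r \<in> Lp M p" "emb M p r = c0_semigroup.resolv (emb M p ` Lp M p) (\<lambda>t. lift M p (T t)) l (emb M p u)"
    "(r, \<lambda>x. l * r x - u x) \<in> generator M p T"
proof -
  interpret c0_semigroup "emb M p ` Lp M p" "\<lambda>t. lift M p (T t)" K w by (rule c)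
  have eV: "emb M p u \<in> emb M p ` Lp M p" using u by simp
  obtain r0 where r0: "r0 \<in> Lp M p" "resolv l (emb M p u) = emb M p r0"
    using resolv_in[OF l eV] by auto
  note y0 = Lp_diff[OF p Lp_scale[OF p r0(1), of l] u]
  have "(r0, \<lambda>x. l * r0 x - u x) \<in> generator M p T"
    using gen_resolv[OF l eV] generator_iff_gen[OF p T c r0(1) y0]
    by (simp add: r0(2) emb_diff[OF p Lp_scale[OF p r0(1)] u] emb_scale[OF p r0(1)])
  then have "\<exists>r w. (r, w) \<in> generator M p T \<and> (AE x in M. l * r x - w x = u x)"
    by (intro exI[of _ r0] exI[of _ "\<lambda>x. l * r0 x - u x"]) simp
  then have "\<exists>w. (r, w) \<in> generator M p T \<and> (AE x in M. l * r x - w x = u x)"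
    unfolding r_def resolvent_def by (rule someI_ex)
  then obtain y where y: "(r, y) \<in> generator M p T" "AE x in M. l * r x - y x = u x" by blast
  have rL: "r \<in> Lp M p" and yL: "y \<in> Lp M p" using y(1) by (auto simp: generator_def)
  then show "r \<in> Lp M p" by simp
  have g: "gen (emb M p r) (emb M p y)" using y(1) generator_iff_gen[OF p T c rL yL] by simp
  have "emb M p (\<lambda>x. l * r x - y x) = emb M p u"
    using y(2) emb_eq_iff[OF p Lp_diff[OF p Lp_scale[OF p rL] yL] u] by simp
  then have eq: "l *\<^sub>R emb M p r - emb M p y = emb M p u"
    by (simp add: emb_diff[OF p Lp_scale[OF p rL] yL] emb_scale[OF p rL])
  then show er: "emb M p r = resolv l (emb M p u)"
    using resolv_eqI[OF l g] by simp
  have "emb M p (\<lambda>x. l * r x - u x) = l *\<^sub>R emb M p r - emb M p u"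
    by (simp add: emb_diff[OF p Lp_scale[OF p rL] u] emb_scale[OF p rL])
  then show "(r, \<lambda>x. l * r x - u x) \<in> generator M p T"
    using gen_resolv[OF l eV] generator_iff_gen[OF p T c rL Lp_diff[OF p Lp_scale[OF p rL] u]] er by simp
qed

section \<open>Order estimates and exponential growth\<close>

lemma positive_semigroupD:
  "positive_semigroup M p T \<Longrightarrow> 0 \<le> t \<Longrightarrow> u \<in> Lp M p \<Longrightarrow> AE x in M. 0 \<le> u x \<Longrightarrow> AE x in M. 0 \<le> T t u x"
  unfolding positive_semigroup_def by blast

lemma positive_semigroup_mono:
  assumes p: "1 \<le> p" "p < \<infinity>" and T: "C0_semigroup M p T" "positive_semigroup M p T" and t: "0 \<le> t"
    and u: "u \<in> Lp M p" and v: "v \<in> Lp M p" and le: "AE x in M. u x \<le> v x"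
  shows "AE x in M. T t u x \<le> T t v x"
proof -
  have "AE x in M. 0 \<le> v x - u x" using le by eventually_elim simp
  then have "AE x in M. 0 \<le> T t (\<lambda>x. v x - u x) x" by (rule positive_semigroupD[OF T(2) t Lp_diff[OF p v u]])
  moreover have "AE x in M. T t (\<lambda>x. v x - u x) x = T t v x - T t u x"
    by (rule operator_diff[OF p C0_semigroupD(1)[OF T(1) t] v u])
  ultimately show ?thesis by eventually_elim simp
qed

lemma positive_semigroup_abs:
  assumes p: "1 \<le> p" "p < \<infinity>" and T: "C0_semigroup M p T" "positive_semigroup M p T" and t: "0 \<le> t"
    and u: "u \<in> Lp M p"
  shows "AE x in M. \<bar>T t u x\<bar> \<le> T t (\<lambda>x. \<bar>u x\<bar>) x"
proof -
  have "AE x in M. T t u x \<le> T t (\<lambda>x. \<bar>u x\<bar>) x"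
    by (rule positive_semigroup_mono[OF p T t u Lp_abs[OF p u]]) (auto intro: AE_I2)
  moreover have "AE x in M. T t (\<lambda>x. (- 1) * u x) x \<le> T t (\<lambda>x. \<bar>u x\<bar>) x"
    by (rule positive_semigroup_mono[OF p T t Lp_scale[OF p u] Lp_abs[OF p u]]) (auto intro: AE_I2)
  moreover have "AE x in M. T t (\<lambda>x. (- 1) * u x) x = (- 1) * T t u x"
    by (rule bounded_operatorD(4)[OF C0_semigroupD(1)[OF T(1) t] u])
  ultimately show ?thesis by eventually_elim simp
qed

text \<open>The sum of the series dominates: a partial sum minus one of its terms is again a sum of
  nonnegative functions, and the cone is closed.\<close>

lemma dominating_series:
  assumes p: "1 \<le> p" "p < \<infinity>" and w: "\<And>n::nat. w n \<in> Lp M p" "\<And>n. AE x in M. 0 \<le> w n x"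
    and sm: "summable (\<lambda>n. Lp_norm M p (w n))"
  shows "\<exists>y\<in>Lp M p. \<forall>n. AE x in M. w n x \<le> y x"
proof -
  have "summable (\<lambda>n. emb M p (w n))"
  proof (rule summable_norm_cancel)
    have "(\<lambda>n. norm (emb M p (w n))) = (\<lambda>n. Lp_norm M p (w n))" by (rule ext) (rule norm_emb[OF p w(1)])
    then show "summable (\<lambda>n. norm (emb M p (w n)))" using sm by simp
  qed
  then have lim: "(\<lambda>N. \<Sum>k<N. emb M p (w k)) \<longlonglongrightarrow> (\<Sum>k. emb M p (w k))"
    by (rule summable_LIMSEQ)
  have "(\<Sum>k<N. emb M p (w k)) \<in> emb M p ` Lp M p" for N
    by (intro subspace_sum[OF subspace_emb[OF p]] imageI w)
  then have "(\<Sum>k. emb M p (w k)) \<in> emb M p ` Lp M p"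
    using closed_sequentially[OF closed_emb[OF p] _ lim] by blast
  then obtain y where y: "y \<in> Lp M p" "(\<Sum>k. emb M p (w k)) = emb M p y" by auto
  have "AE x in M. w n x \<le> y x" for n
  proof -
    \<comment> \<open>Shifted by \<open>Suc n\<close>, every partial sum contains the term with
      index \<open>n\<close>.\<close>
    have lim': "(\<lambda>N. (\<Sum>k<N + Suc n. emb M p (w k)) - emb M p (w n)) \<longlonglongrightarrow> emb M p y - emb M p (w n)"
      using LIMSEQ_ignore_initial_segment[OF lim, of "Suc n"] unfolding y(2) by (intro tendsto_diff tendsto_const)
    moreover have "(\<Sum>k<N + Suc n. emb M p (w k)) - emb M p (w n) \<in> pos_cone M p" for N
    proof -
      have "(\<Sum>k<N + Suc n. emb M p (w k)) - emb M p (w n) = (\<Sum>k\<in>{..<N + Suc n} - {n}. emb M p (w k))"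
        by (subst sum_diff1) auto
      moreover have "(\<Sum>k\<in>A. emb M p (w k)) \<in> pos_cone M p" if "finite A" for A
        using that by (induction A) (auto intro: pos_cone_cone[OF p] simp: pos_cone_iff[OF p w(1)] w(2))
      ultimately show ?thesis by simp
    qed
    ultimately have "emb M p y - emb M p (w n) \<in> pos_cone M p"
      using closed_sequentially[OF closed_pos_cone[OF p] _ lim'] by blast
    then have "AE x in M. 0 \<le> y x - w n x"
      using pos_cone_iff[OF p Lp_diff[OF p y(1) w(1)]] emb_diff[OF p y(1) w(1)] by simp
    then show ?thesis by eventually_elim simp
  qed
  then show ?thesis using y by blast
qed

text \<open>
  The uniform boundedness principle is elementary here: by positivity, unbounded orbits of unit vectors add up to
  one unbounded orbit of a dominating series.
\<close>

lemma positive_semigroup_locally_bounded: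
  assumes p: "1 \<le> p" "p < \<infinity>" and T: "C0_semigroup M p T" "positive_semigroup M p T"
  shows "\<exists>d>0. \<exists>K\<ge>1. \<forall>t\<in>{0..d}. \<forall>u\<in>Lp M p. Lp_norm M p (T t u) \<le> K * Lp_norm M p u"
proof (rule ccontr)
  assume neg: "\<not> ?thesis"
  \<comment> \<open>Once \<open>u n\<close> is scaled to norm \<open>(1 / 2) ^ n\<close>, so that
    the series of these vectors converges, the factor \<open>4 ^ n\<close> still leaves
    \<open>2 ^ n\<close>. The shrinking times lead to a contradiction with the continuity of one
    orbit at 0.\<close>
  have "\<exists>t u. t \<in> {0..1 / (real n + 1)} \<and> u \<in> Lp M p \<and> 4 ^ n * Lp_norm M p u < Lp_norm M p (T t u)" for n
  proof (rule ccontr)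
    assume "\<not> ?thesis"
    then have "\<forall>t\<in>{0..1 / (real n + 1)}. \<forall>u\<in>Lp M p. Lp_norm M p (T t u) \<le> 4 ^ n * Lp_norm M p u"
      by (meson not_le)
    then have "\<exists>d>0. \<exists>K\<ge>1. \<forall>t\<in>{0..d}. \<forall>u\<in>Lp M p. Lp_norm M p (T t u) \<le> K * Lp_norm M p u"
      by (intro exI[of _ "1 / (real n + 1)"] conjI exI[of _ "4 ^ n"]) auto
    then show False using neg by blast
  qed
  then obtain t u where tu: "\<And>n. t n \<in> {0..1 / (real n + 1)}" "\<And>n. u n \<in> Lp M p"
    "\<And>n. 4 ^ n * Lp_norm M p (u n) < Lp_norm M p (T (t n) (u n))" by metis
  have t0: "0 \<le> t n" for n using tu(1)[of n] by simp
  note Tin = C0_semigroup_in[OF T(1)]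
  have a: "0 < Lp_norm M p (u n)" for n
  proof (rule ccontr)
    assume "\<not> ?thesis"
    then have "Lp_norm M p (u n) = 0" using Lp_norm_nonneg[of M p "u n"] by simp
    moreover obtain K where "Lp_norm M p (T (t n) (u n)) \<le> K * Lp_norm M p (u n)"
      using bounded_operatorD(5)[OF C0_semigroupD(1)[OF T(1) t0[of n]]] tu(2) by blast
    ultimately show False using tu(3)[of n] by simp
  qed
  \<comment> \<open>The filter \<open>at_right 0\<close>, used at the end, sees only positive
    times.\<close>
  have tpos: "0 < t n" for n
  proof (rule ccontr)
    assume "\<not> ?thesis"
    then have "t n = 0" using t0[of n] by simp
    then have "Lp_norm M p (T (t n) (u n)) = Lp_norm M p (u n)"
      using C0_semigroupD(2)[OF T(1) tu(2)] tu(2) Tin[OF order_refl tu(2)]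
      by (intro Lp_norm_cong_AE) (auto dest: Lp_measurable)
    moreover have "Lp_norm M p (u n) \<le> 4 ^ n * Lp_norm M p (u n)"
      using a[of n] by simp
    ultimately show False using tu(3)[of n] by simp
  qed
  define c where "c = (\<lambda>n. 1 / (Lp_norm M p (u n) * 2 ^ n))"
  have c: "0 < c n" for n using a by (simp add: c_def)
  define w where "w = (\<lambda>n x. c n * \<bar>u n x\<bar>)"
  have wL: "w n \<in> Lp M p" for n unfolding w_def by (intro Lp_scale Lp_abs p tu)
  have absn: "Lp_norm M p (\<lambda>x. \<bar>v x\<bar>) = Lp_norm M p v" for v
    using ennreal_exponent(3)[OF p] by (simp add: Lp_norm_def)
  have wn: "Lp_norm M p (w n) = (1 / 2) ^ n" for n
  proof -
    have "Lp_norm M p (w n) = c n * Lp_norm M p (u n)"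
      using c[of n] by (simp add: w_def Lp_norm_scale[OF p] absn)
    then show ?thesis using a[of n] by (simp add: c_def power_divide)
  qed
  have "\<exists>y\<in>Lp M p. \<forall>n. AE x in M. w n x \<le> y x"
    using c by (intro dominating_series[OF p wL]) (auto simp: w_def[symmetric] wn, auto simp: w_def less_imp_le)
  then obtain y where y: "y \<in> Lp M p" "\<And>n. AE x in M. w n x \<le> y x" by blast
  have big: "2 ^ n < Lp_norm M p (T (t n) y)" for n
  proof -
    have ua: "(\<lambda>x. \<bar>u n x\<bar>) \<in> Lp M p" by (rule Lp_abs[OF p tu(2)])
    have 1: "AE x in M. \<bar>T (t n) (u n) x\<bar> \<le> T (t n) (\<lambda>x. \<bar>u n x\<bar>) x"
      by (rule positive_semigroup_abs[OF p T t0 tu(2)])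
    have 2: "AE x in M. T (t n) (w n) x = c n * T (t n) (\<lambda>x. \<bar>u n x\<bar>) x"
      unfolding w_def by (rule bounded_operatorD(4)[OF C0_semigroupD(1)[OF T(1) t0] ua])
    have 3: "AE x in M. T (t n) (w n) x \<le> T (t n) y x"
      by (rule positive_semigroup_mono[OF p T t0 wL y(1) y(2)])
    have "AE x in M. \<bar>c n * T (t n) (u n) x\<bar> \<le> \<bar>T (t n) y x\<bar>"
      using 1 2 3
    proof eventually_elim
      case (elim x)
      have "c n * \<bar>T (t n) (u n) x\<bar> \<le> c n * T (t n) (\<lambda>x. \<bar>u n x\<bar>) x"
        using elim(1) c[of n] by (intro mult_left_mono) auto
      moreover have "\<bar>c n * T (t n) (u n) x\<bar> = c n * \<bar>T (t n) (u n) x\<bar>" using c[of n] by (simp add: abs_mult)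
      ultimately show ?case using elim by linarith
    qed
    then have "Lp_norm M p (\<lambda>x. c n * T (t n) (u n) x) \<le> Lp_norm M p (T (t n) y)"
      using Lp_measurable[OF Lp_scale[OF p Tin[OF t0 tu(2)]]]
      by (intro Lp_dominated(2)[OF p Tin[OF t0 y(1)]]) auto
    moreover have "2 ^ n < c n * Lp_norm M p (T (t n) (u n))"
    proof -
      have "2 ^ n = c n * (4 ^ n * Lp_norm M p (u n))"
        using a[of n] by (simp add: c_def field_simps power_mult_distrib[symmetric])
      also have "\<dots> < c n * Lp_norm M p (T (t n) (u n))"
        using tu(3) c by (intro mult_strict_left_mono) auto
      finally show ?thesis .
    qed
    ultimately show ?thesis using c[of n] by (simp add: Lp_norm_scale[OF p])
  qed
  have "\<forall>\<^sub>F s in at_right 0. dist (emb M p (T s y)) (emb M p y) < 1"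
    using emb_semigroup_tendsto[OF p T(1) y(1)] by (rule tendstoD) simp
  then obtain d where d: "0 < d" "\<And>s. 0 < s \<Longrightarrow> s < d \<Longrightarrow> dist (emb M p (T s y)) (emb M p y) < 1"
    by (auto simp: eventually_at_right_field)
  obtain n :: nat where n: "max (1 / d) (Lp_norm M p y + 1) < real n" using reals_Archimedean2 by blast
  have "1 / (real n + 1) < d" using n d by (simp add: field_simps)
  then have "t n < d" using tu(1)[of n] by simp
  then have "norm (emb M p (T (t n) y)) < norm (emb M p y) + 1"
    using d(2)[OF tpos, of n] norm_triangle_sub[of "emb M p (T (t n) y)" "emb M p y"] by (simp add: dist_norm)
  then have "Lp_norm M p (T (t n) y) < Lp_norm M p y + 1"
    by (simp add: norm_emb[OF p y(1)] norm_emb[OF p Tin[OF t0 y(1)]])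
  moreover have "real n < 2 ^ n" by (rule of_nat_less_two_power)
  moreover have "Lp_norm M p y + 1 < real n" using n by simp
  ultimately show False using big[of n] by linarith
qed

lemma positive_semigroup_growth:
  assumes p: "1 \<le> p" "p < \<infinity>" and T: "C0_semigroup M p T" "positive_semigroup M p T"
  shows "\<exists>K\<ge>1. \<exists>w. \<forall>t\<ge>0. \<forall>u\<in>Lp M p. Lp_norm M p (T t u) \<le> K * exp (w * t) * Lp_norm M p u"
proof -
  obtain d K where d: "0 < d" and K: "1 \<le> K"
    and loc: "\<And>t u. 0 \<le> t \<Longrightarrow> t \<le> d \<Longrightarrow> u \<in> Lp M p \<Longrightarrow> Lp_norm M p (T t u) \<le> K * Lp_norm M p u"
    using positive_semigroup_locally_bounded[OF p T] by fastforce
  note Tin = C0_semigroup_in[OF T(1)]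
  have step: "Lp_norm M p (T (s + real n * d) u) \<le> K ^ Suc n * Lp_norm M p u"
    if s: "0 \<le> s" "s \<le> d" and u: "u \<in> Lp M p" for s u n
  proof (induction n)
    case 0
    then show ?case using loc[OF s u] by simp
  next
    case (Suc n)
    have nn: "0 \<le> s + real n * d" using s d by simp
    have "0 \<le> d" using d by simp
    then have "T (d + (s + real n * d)) u \<in> Lp M p" "T d (T (s + real n * d) u) \<in> Lp M p"
      by (auto intro: Tin[OF add_nonneg_nonneg[OF _ nn] u] Tin[OF _ Tin[OF nn u]])
    then have "Lp_norm M p (T (d + (s + real n * d)) u) = Lp_norm M p (T d (T (s + real n * d) u))"
      using C0_semigroupD(3)[OF T(1) _ nn u, of d] d by (intro Lp_norm_cong_AE) (auto dest: Lp_measurable)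
    also have "\<dots> \<le> K * Lp_norm M p (T (s + real n * d) u)"
      using d nn by (intro loc Tin u) auto
    also have "\<dots> \<le> K * (K ^ Suc n * Lp_norm M p u)" using Suc K by (intro mult_left_mono) auto
    finally show ?case by (simp add: algebra_simps)
  qed
  \<comment> \<open>The full steps of length \<open>d\<close> contained in \<open>[0, t]\<close>
    contribute at most \<open>exp (w * t)\<close>; the remainder costs one more factor
    \<open>K\<close>.\<close>
  define w where "w = ln K / d"
  have "Lp_norm M p (T t u) \<le> K * exp (w * t) * Lp_norm M p u" if t: "0 \<le> t" and u: "u \<in> Lp M p" for t u
  proof -
    define n where "n = nat \<lfloor>t / d\<rfloor>"
    have fl: "real n \<le> t / d" "t / d < real n + 1" using t d by (auto simp: n_def)
    have "Lp_norm M p (T ((t - real n * d) + real n * d) u) \<le> K ^ Suc n * Lp_norm M p u"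
      using fl d by (intro step u) (auto simp: field_simps)
    also have "K ^ n \<le> exp (w * t)"
    proof -
      have "K ^ n = exp (real n * ln K)" using K by (simp add: exp_of_nat_mult)
      also have "real n * ln K \<le> t / d * ln K" using fl(1) K by (intro mult_right_mono) auto
      then have "exp (real n * ln K) \<le> exp (t / d * ln K)" by simp
      finally show ?thesis by (simp add: w_def mult.commute)
    qed
    then have "K ^ Suc n * Lp_norm M p u \<le> K * exp (w * t) * Lp_norm M p u"
      using K Lp_norm_nonneg by (intro mult_right_mono) auto
    finally show ?thesis by simp
  qed
  then show ?thesis using K by blast
qed

section \<open>Convergence and Riesz representation in L_2\<close>

lemma enn2real_2: "enn2real 2 = 2"
  using enn2real_ennreal[of 2] by simp

lemma L2_iff: "u \<in> Lp M 2 \<longleftrightarrow> u \<in> borel_measurable M \<and> integrable M (\<lambda>x. (u x)\<^sup>2)"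
  using Lp_finite_iff[of 2 u M] by (simp add: enn2real_2 powr_numeral)

lemma L2_norm_square: "(Lp_norm M 2 u)\<^sup>2 = (\<integral>x. (u x)\<^sup>2 \<partial>M)"
  using Lp_norm_powr[OF two_ge_1, of M u] Lp_norm_nonneg[of M 2 u] by (simp add: enn2real_2 powr_numeral)

text \<open>The bridge from \<open>L_2\<close> to \<open>L_p\<close>. A subsequence staying away
  from 0 in \<open>L_p\<close> would have a further subsequence converging almost everywhere, by
  convergence in \<open>L_2\<close>, and domination by \<open>g\<close> would make its
  \<open>L_p\<close> norms tend to 0.\<close>

lemma Lp_norm_dominated_L2_null:
  assumes p: "1 \<le> p" "p < \<infinity>" and g: "g \<in> Lp M p" and h: "\<And>n::nat. h n \<in> Lp M 2"
    and dom: "\<And>n. AE x in M. \<bar>h n x\<bar> \<le> g x" and null: "(\<lambda>n. Lp_norm M 2 (h n)) \<longlonglongrightarrow> 0"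
  shows "(\<lambda>n. Lp_norm M p (h n)) \<longlonglongrightarrow> 0"
proof (rule tendstoI, rule ccontr)
  fix e :: real assume e: "0 < e" and "\<not> (\<forall>\<^sub>F n in sequentially. dist (Lp_norm M p (h n)) 0 < e)"
  then obtain r :: "nat \<Rightarrow> nat" where r: "strict_mono r" "\<And>n. \<not> dist (Lp_norm M p (h (r n))) 0 < e"
    using not_eventually_sequentiallyD by blast
  have "(\<lambda>n. (Lp_norm M 2 (h (r n)))\<^sup>2) \<longlonglongrightarrow> 0\<^sup>2"
    using LIMSEQ_subseq_LIMSEQ[OF null r(1)] by (intro tendsto_power) (simp add: o_def)
  then have "(\<lambda>n. \<integral>x. norm ((h (r n) x)\<^sup>2) \<partial>M) \<longlonglongrightarrow> 0"
    by (simp add: L2_norm_square)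
  then have "\<exists>s. strict_mono s \<and> (AE x in M. (\<lambda>n. (h (r (s n)) x)\<^sup>2) \<longlonglongrightarrow> 0)"
    by (intro tendsto_L1_AE_subseq) (use h in \<open>auto simp: L2_iff\<close>)
  then obtain s :: "nat \<Rightarrow> nat" where s: "strict_mono s" "AE x in M. (\<lambda>n. (h (r (s n)) x)\<^sup>2) \<longlonglongrightarrow> 0" by blast
  have "(\<lambda>n. Lp_norm M p (\<lambda>x. h (r (s n)) x - 0)) \<longlonglongrightarrow> 0"
  proof (rule Lp_dominated_convergence[OF p _ _ g])
    show "AE x in M. (\<lambda>n. h (r (s n)) x) \<longlonglongrightarrow> 0"
      using s(2)
    proof eventually_elim
      case (elim x)
      then have "(\<lambda>n. sqrt ((h (r (s n)) x)\<^sup>2)) \<longlonglongrightarrow> sqrt 0" by (rule tendsto_real_sqrt)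
      then have "(\<lambda>n. \<bar>h (r (s n)) x\<bar>) \<longlonglongrightarrow> 0" by simp
      then show ?case by (rule tendsto_rabs_zero_cancel)
    qed
  qed (use dom Lp_measurable[OF h] in auto)
  then have "(\<lambda>n. Lp_norm M p (h (r (s n)))) \<longlonglongrightarrow> 0" by simp
  then have "\<forall>\<^sub>F n in sequentially. dist (Lp_norm M p (h (r (s n)))) 0 < e"
    using e by (rule tendstoD)
  then show False using r(2) by simp
qed

text \<open>The representing function minimises the quadratic functional \<open>J\<close>, which is
  bounded below by completing the square. At the minimum the linear part of \<open>J\<close> along
  every direction vanishes, which is the claimed representation.\<close>

lemma Riesz_L2:
  assumes add: "\<And>u v. u \<in> Lp M 2 \<Longrightarrow> v \<in> Lp M 2 \<Longrightarrow> \<phi> (\<lambda>x. u x + v x) = \<phi> u + \<phi> v"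
    and scale: "\<And>c u. u \<in> Lp M 2 \<Longrightarrow> \<phi> (\<lambda>x. c * u x) = c * \<phi> u"
    and bd: "\<And>u. u \<in> Lp M 2 \<Longrightarrow> \<bar>\<phi> u\<bar> \<le> L * Lp_norm M 2 u"
  shows "\<exists>v\<in>Lp M 2. \<forall>u\<in>Lp M 2. \<phi> u = pairing M u v"
proof -
  note two = two_ge_1
  define N where "N = (\<lambda>u. (Lp_norm M 2 u)\<^sup>2)"
  define J where "J = (\<lambda>u. N u - 2 * \<phi> u)"
  have Nadd: "N (\<lambda>x. u x + c * v x) = N u + 2 * c * pairing M u v + c\<^sup>2 * N v"
    if u: "u \<in> Lp M 2" and v: "v \<in> Lp M 2" for u v c
  proof -
    have i: "integrable M (\<lambda>x. u x * v x)" by (rule Holder_inequality(1)[OF two conjugate_exponent_2 u v])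
    have "(\<integral>x. (u x + c * v x)\<^sup>2 \<partial>M) = (\<integral>x. (u x)\<^sup>2 + 2 * c * (u x * v x) + c\<^sup>2 * (v x)\<^sup>2 \<partial>M)"
      by (intro Bochner_Integration.integral_cong) (auto simp: power2_eq_square algebra_simps)
    also have "\<dots> = (\<integral>x. (u x)\<^sup>2 \<partial>M) + 2 * c * (\<integral>x. u x * v x \<partial>M) + c\<^sup>2 * (\<integral>x. (v x)\<^sup>2 \<partial>M)"
      using u v i by (simp add: L2_iff)
    finally show ?thesis by (simp add: N_def L2_norm_square pairing_def)
  qed
  have Jadd: "J (\<lambda>x. u x + c * v x) = J u + 2 * c * (pairing M u v - \<phi> v) + c\<^sup>2 * N v"
    if u: "u \<in> Lp M 2" and v: "v \<in> Lp M 2" for u v c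
    using Nadd[OF u v, of c] add[OF u Lp_scale[OF two v, of c]] scale[OF v, of c]
    by (simp add: J_def algebra_simps)
  have lower: "- L\<^sup>2 \<le> J u" if u: "u \<in> Lp M 2" for u
  proof -
    have "2 * \<phi> u \<le> 2 * (L * Lp_norm M 2 u)" using bd[OF u] by linarith
    moreover have "0 \<le> (Lp_norm M 2 u - L)\<^sup>2" by simp
    ultimately show ?thesis by (simp add: J_def N_def power2_diff algebra_simps)
  qed
  define m where "m = Inf (J ` Lp M 2)"
  have bdd: "bdd_below (J ` Lp M 2)" by (rule bdd_belowI2[where m = "- L\<^sup>2"]) (rule lower)
  have ne: "J ` Lp M 2 \<noteq> {}" using Lp_zero[OF two] by blast
  have m_le: "m \<le> J u" if "u \<in> Lp M 2" for u
    unfolding m_def using bdd that by (intro cInf_lower) auto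
  have "\<exists>u\<in>Lp M 2. J u < m + 1 / (real n + 1)" for n
    using cInf_lessD[OF ne, of "m + 1 / (real n + 1)"] by (auto simp: m_def[symmetric])
  then obtain u where u: "\<And>n. u n \<in> Lp M 2" "\<And>n. J (u n) < m + 1 / (real n + 1)" by metis
  \<comment> \<open>The parallelogram argument: \<open>J\<close> at the midpoint of
    \<open>u j\<close> and \<open>u k\<close> is at least \<open>m\<close>, while it is the mean of
    the two values minus a quarter of the squared distance.\<close>
  have par: "N (\<lambda>x. u j x - u k x) \<le> 4 / (real i + 1)" if "i \<le> j" "i \<le> k" for i j k
  proof -
    have dL: "(\<lambda>x. u j x - u k x) \<in> Lp M 2" by (rule Lp_diff[OF two u(1) u(1)])
    define d where "d = (\<lambda>x. u j x - u k x)"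
    define a where "a = pairing M (u k) d - \<phi> d"
    have "m \<le> J (\<lambda>x. u k x + (1/2) * d x)"
      unfolding d_def by (intro m_le Lp_add Lp_scale two u dL)
    also have "\<dots> = J (u k) + a + N d / 4"
      using Jadd[OF u(1) dL[folded d_def], of k "1/2"] by (simp add: power2_eq_square a_def)
    finally have 1: "m \<le> J (u k) + a + N d / 4" .
    have 2: "J (u j) = J (u k) + 2 * a + N d"
      using Jadd[OF u(1) dL[folded d_def], of k 1] by (simp add: d_def a_def)
    have "1 / (real j + 1) \<le> 1 / (real i + 1)" "1 / (real k + 1) \<le> 1 / (real i + 1)"
      using that by (auto simp: divide_simps)
    then have "J (u j) \<le> m + 1 / (real i + 1)" "J (u k) \<le> m + 1 / (real i + 1)"
      using u(2)[of j] u(2)[of k] by linarith+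
    then have "N d \<le> 4 * (1 / (real i + 1))" using 1 2 by linarith
    then show ?thesis by (simp add: d_def)
  qed
  have "Cauchy (\<lambda>n. emb M 2 (u n))"
  proof (rule metric_CauchyI)
    fix e :: real assume e: "0 < e"
    obtain i :: nat where i: "4 / e\<^sup>2 < real i" using reals_Archimedean2 by blast
    then have "4 < real i * e\<^sup>2" using e by (simp add: divide_less_eq)
    also have "\<dots> \<le> (real i + 1) * e\<^sup>2" by (simp add: distrib_right)
    finally have small: "4 / (real i + 1) < e\<^sup>2" by (simp add: divide_less_eq mult.commute)
    have "dist (emb M 2 (u j)) (emb M 2 (u k)) < e" if "i \<le> j" "i \<le> k" for j k
    proof -
      have "(dist (emb M 2 (u j)) (emb M 2 (u k)))\<^sup>2 < e\<^sup>2"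
        using par[OF that] small by (simp add: dist_norm N_def Lp_norm_diff[OF two u(1) u(1)])
      then show ?thesis using e by (simp add: power2_less_imp_less)
    qed
    then show "\<exists>M'. \<forall>j\<ge>M'. \<forall>k\<ge>M'. dist (emb M 2 (u j)) (emb M 2 (u k)) < e" by blast
  qed
  then obtain l where l: "(\<lambda>n. emb M 2 (u n)) \<longlonglongrightarrow> l"
    by (auto simp: Cauchy_convergent_iff convergent_def)
  then have "l \<in> emb M 2 ` Lp M 2"
    by (rule closed_sequentially[OF closed_emb[OF two], rotated]) (use u in auto)
  then obtain v where v: "v \<in> Lp M 2" "l = emb M 2 v" by auto
  have lim: "(\<lambda>n. norm (emb M 2 (u n))) \<longlonglongrightarrow> norm (emb M 2 v)"
    using l unfolding v(2) by (rule tendsto_norm)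
  have \<phi>lim: "(\<lambda>n. \<phi> (u n)) \<longlonglongrightarrow> \<phi> v"
  proof (rule LIM_zero_cancel, rule tendsto_0_le)
    show "(\<lambda>n. emb M 2 (u n) - emb M 2 v) \<longlonglongrightarrow> 0" using l unfolding v(2) by (rule LIM_zero)
    have "norm (\<phi> (u n) - \<phi> v) \<le> norm (emb M 2 (u n) - emb M 2 v) * L" for n
    proof -
      have "\<phi> (\<lambda>x. u n x - v x) = \<phi> (u n) - \<phi> v"
        using add[OF u(1) Lp_scale[OF two v(1), of "-1"], of n] scale[OF v(1), of "-1"] by simp
      then show ?thesis
        using bd[OF Lp_diff[OF two u(1) v(1)], of n] by (simp add: Lp_norm_diff[OF two u(1) v(1)] mult.commute)
    qed
    then show "\<forall>\<^sub>F n in sequentially. norm (\<phi> (u n) - \<phi> v) \<le> norm (emb M 2 (u n) - emb M 2 v) * L" by simp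
  qed
  have "(\<lambda>n. J (u n)) \<longlonglongrightarrow> J v"
    unfolding J_def N_def norm_emb[OF two u(1), symmetric] norm_emb[OF two v(1), symmetric]
    by (intro tendsto_diff tendsto_power tendsto_mult tendsto_const lim \<phi>lim)
  moreover have "(\<lambda>n. m + 1 / (real n + 1)) \<longlonglongrightarrow> m" by real_asymp
  ultimately have Jv: "J v \<le> m"
    by (rule LIMSEQ_le) (use u(2) less_imp_le in blast)
  have "\<phi> z = pairing M z v" if z: "z \<in> Lp M 2" for z
  proof -
    define b where "b = pairing M v z - \<phi> z"
    have nn: "0 \<le> 2 * c * b + c\<^sup>2 * N z" for c
      using m_le[OF Lp_add[OF two v(1) Lp_scale[OF two z, of c]]] Jadd[OF v(1) z, of c] Jv by (simp add: b_def)
    have "b = 0"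
    proof (rule ccontr)
      assume "b \<noteq> 0"
      \<comment> \<open>Close to the minimiser \<open>- b / N z\<close> of the quadratic in
        \<open>c\<close>; the added 1 avoids a zero denominator and the value is still
        negative.\<close>
      define c where "c = - b / (N z + 1)"
      have N0: "0 \<le> N z" by (simp add: N_def)
      have "2 * c * b + c\<^sup>2 * N z = - (b\<^sup>2 / (N z + 1)\<^sup>2) * (N z + 2)"
        using N0 by (simp add: c_def power2_eq_square divide_simps) (simp add: algebra_simps)
      also have "\<dots> < 0" using N0 \<open>b \<noteq> 0\<close> by (auto simp: mult_less_0_iff zero_less_divide_iff)
      finally show False using nn[of c] by simp
    qed
    then show ?thesis by (simp add: b_def pairing_def mult.commute)
  qed
  then show ?thesis using v by blast
qed

section \<open>Extension from \<open>L\<^sub>2\<close> to \<open>L\<^sub>p\<close>\<close>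

lemma filterlim_at_right_0_sequentially:
  fixes X :: "nat \<Rightarrow> real"
  assumes "\<And>i. 0 < X i" "X \<longlonglongrightarrow> 0"
  shows "filterlim X (at_right 0) sequentially"
proof -
  have "X i \<in> {0<..} \<and> X i \<noteq> 0" for i using assms(1)[of i] by auto
  then show ?thesis using assms(2) unfolding filterlim_at by (auto intro: always_eventually)
qed

text \<open>The integral exists in \<open>L_2\<close>, where the orbit is continuous; continuity in
  \<open>L_p\<close> is still unknown at this point. The \<open>L_p\<close> bound is obtained by
  duality: pairings are integrated as real functions, and the converse of Hoelder's inequality
  assembles them.\<close>

lemma L2_orbit_integral_Lp:
  assumes p: "1 \<le> p" "p < \<infinity>" and S: "C0_semigroup M 2 S"
    and c: "c0_semigroup (emb M 2 ` Lp M 2) (\<lambda>t. lift M 2 (S t)) K w"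
    and bd: "\<And>t u. 0 \<le> t \<Longrightarrow> u \<in> Lp M 2 \<Longrightarrow> u \<in> Lp M p \<Longrightarrow>
      S t u \<in> Lp M p \<and> Lp_norm M p (S t u) \<le> Kp * exp (wp * t) * Lp_norm M p u"
    and Kp: "0 \<le> Kp" and u: "u \<in> Lp M 2" "u \<in> Lp M p" and t: "0 \<le> t" and v: "v \<in> Lp M 2"
    and eq: "emb M 2 v = integral {0..t} (\<lambda>s. lift M 2 (S s) (emb M 2 u))"
  shows "v \<in> Lp M p" "Lp_norm M p v \<le> t * (Kp * exp (\<bar>wp\<bar> * t) * Lp_norm M p u)"
proof -
  interpret c0_semigroup "emb M 2 ` Lp M 2" "\<lambda>t. lift M 2 (S t)" K w by (rule c)
  obtain p' :: ennreal where p': "1 / p + 1 / p' = 1" using conjugate_exponent_exists[OF p] by blast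
  define C where "C = Kp * exp (\<bar>wp\<bar> * t) * Lp_norm M p u"
  have C0: "0 \<le> C" using Kp Lp_norm_nonneg[of M p u] by (simp add: C_def)
  have uV: "emb M 2 u \<in> emb M 2 ` Lp M 2" using u by simp
  have main: "\<bar>pairing M v g\<bar> \<le> (t * C) * Lp_norm M p' g" if g: "g \<in> Lp M 2" "g \<in> Lp M p'" for g
  proof -
    obtain \<phi> where \<phi>: "bounded_linear \<phi>" "\<And>u. u \<in> Lp M 2 \<Longrightarrow> \<phi> (emb M 2 u) = pairing M u g"
      using pairing_functional[OF two_ge_1 conjugate_exponent_2 g(1)] by blast
    have ng: "0 \<le> Lp_norm M p' g"
      by (rule Lp_norm_nonneg)
    have bound: "norm ((\<phi> \<circ> (\<lambda>s. lift M 2 (S s) (emb M 2 u))) s) \<le> C * Lp_norm M p' g" if s: "s \<in> {0..t}" for s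
    proof -
      have s0: "0 \<le> s" using s by simp
      have "\<phi> (lift M 2 (S s) (emb M 2 u)) = pairing M (S s u) g"
        using lift_emb[OF two_ge_1 C0_semigroupD(1)[OF S s0] u(1)] \<phi>(2)[OF C0_semigroup_in[OF S s0 u(1)]] by simp
      then have "norm ((\<phi> \<circ> (\<lambda>s. lift M 2 (S s) (emb M 2 u))) s) \<le> Lp_norm M p (S s u) * Lp_norm M p' g"
        using Holder_inequality(2)[OF p p' _ g(2)] bd[OF s0 u] by (simp add: pairing_def)
      also have "Lp_norm M p (S s u) \<le> C"
      proof -
        have "wp * s \<le> \<bar>wp\<bar> * t" using s by (intro mult_mono) auto
        then have "Kp * exp (wp * s) * Lp_norm M p u \<le> C"
          unfolding C_def using Kp Lp_norm_nonneg by (intro mult_right_mono mult_left_mono) auto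
        then show ?thesis using bd[OF s0 u] by linarith
      qed
      then have "Lp_norm M p (S s u) * Lp_norm M p' g \<le> C * Lp_norm M p' g" using ng by (rule mult_right_mono)
      finally show ?thesis .
    qed
    have cont: "continuous_on {0..t} (\<phi> \<circ> (\<lambda>s. lift M 2 (S s) (emb M 2 u)))"
      by (intro continuous_on_compose continuous_on_subset[OF orbit_continuous[OF uV]] linear_continuous_on \<phi>(1)) auto
    have "pairing M v g = integral {0..t} (\<phi> \<circ> (\<lambda>s. lift M 2 (S s) (emb M 2 u)))"
      using integral_linear[OF orbit_integrable[OF uV order_refl] \<phi>(1), of t] \<phi>(2)[OF v] eq by simp
    then show ?thesis
      using integral_bound[OF t cont, of "C * Lp_norm M p' g"] bound by (simp add: mult_ac)
  qed
  have "0 \<le> t * C" using t C0 by simp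
  from converse_Holder[OF p p' v this main] show "v \<in> Lp M p" "Lp_norm M p v \<le> t * (Kp * exp (\<bar>wp\<bar> * t) * Lp_norm M p u)"
    by (auto simp: C_def)
qed

lemma lift_pos_cone:
  assumes p: "1 \<le> p" "p < \<infinity>" and T: "C0_semigroup M p T" "positive_semigroup M p T"
    and t: "0 \<le> t" and x: "x \<in> pos_cone M p"
  shows "lift M p (T t) x \<in> pos_cone M p"
proof -
  obtain u where u: "u \<in> Lp M p" "AE x in M. 0 \<le> u x" "x = emb M p u" using x by (auto simp: pos_cone_def)
  show ?thesis
    unfolding u(3) lift_emb[OF p C0_semigroupD(1)[OF T(1) t] u(1)] pos_cone_iff[OF p C0_semigroup_in[OF T(1) t u(1)]]
    by (rule positive_semigroupD[OF T(2) t u(1,2)])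
qed

text \<open>The bounds are parameters because for \<open>T\<close> they have to be the prescribed
  \<open>K\<close> and \<open>\<omega>\<close>, whereas for \<open>S\<close> any constants from
  \<open>acts_on\<close> will do.\<close>

locale acting_semigroup =
  fixes M :: "'a measure" and S :: "real \<Rightarrow> ('a \<Rightarrow> real) \<Rightarrow> 'a \<Rightarrow> real" and p :: ennreal and Kp wp :: real
  assumes p: "1 \<le> p" "p < \<infinity>" and S: "C0_semigroup M 2 S" and S_pos: "positive_semigroup M 2 S"
    and Kp: "0 \<le> Kp"
    and bd: "\<And>t u. 0 \<le> t \<Longrightarrow> u \<in> Lp M 2 \<Longrightarrow> u \<in> Lp M p \<Longrightarrow>
      S t u \<in> Lp M p \<and> Lp_norm M p (S t u) \<le> Kp * exp (wp * t) * Lp_norm M p u"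
begin

abbreviation "I \<equiv> Lp M 2 \<inter> Lp M p"

lemma S_I: "0 \<le> t \<Longrightarrow> u \<in> I \<Longrightarrow> S t u \<in> I"
  using C0_semigroup_in[OF S] bd by blast

lemma I_diff: "u \<in> I \<Longrightarrow> v \<in> I \<Longrightarrow> (\<lambda>x. u x - v x) \<in> I"
  using Lp_diff[OF p] Lp_diff[OF two_ge_1] by blast

lemma I_scale: "u \<in> I \<Longrightarrow> (\<lambda>x. c * u x) \<in> I"
  using Lp_scale[OF p] Lp_scale[OF two_ge_1] by blast

lemma I_add: "u \<in> I \<Longrightarrow> v \<in> I \<Longrightarrow> (\<lambda>x. u x + v x) \<in> I"
  using Lp_add[OF p] Lp_add[OF two_ge_1] by blast

lemma I_dominated:
  assumes "u \<in> borel_measurable M" "g \<in> I" "AE x in M. \<bar>u x\<bar> \<le> \<bar>g x\<bar>"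
  shows "u \<in> I"
  using Lp_dominated(1)[OF p _ assms(1,3)] Lp_dominated(1)[OF two_ge_1 _ assms(1,3)] assms(2) by blast

lemma S_diff: "0 \<le> t \<Longrightarrow> u \<in> I \<Longrightarrow> v \<in> I \<Longrightarrow> AE x in M. S t (\<lambda>x. u x - v x) x = S t u x - S t v x"
  using operator_diff[OF two_ge_1 C0_semigroupD(1)[OF S]] by blast

lemma S_diff_bound:
  assumes "0 \<le> t" "u \<in> I" "v \<in> I"
  shows "norm (emb M p (S t u) - emb M p (S t v)) \<le> Kp * exp (wp * t) * norm (emb M p u - emb M p v)"
proof -
  have uv: "S t u \<in> Lp M p" "S t v \<in> Lp M p" "u \<in> Lp M p" "v \<in> Lp M p" using S_I assms by blast+
  have d: "(\<lambda>x. u x - v x) \<in> I" by (rule I_diff) (use assms in auto)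
  have "norm (emb M p (S t u) - emb M p (S t v)) = Lp_norm M p (\<lambda>x. S t u x - S t v x)"
    by (simp add: Lp_norm_diff[OF p uv(1,2)])
  also have "\<dots> = Lp_norm M p (S t (\<lambda>x. u x - v x))"
    using S_diff[OF assms] S_I[OF assms(1) d] Lp_measurable[OF uv(1)] Lp_measurable[OF uv(2)]
    by (intro Lp_norm_cong_AE) (auto dest: Lp_measurable)
  also have "\<dots> \<le> Kp * exp (wp * t) * Lp_norm M p (\<lambda>x. u x - v x)" using bd[OF assms(1)] d by blast
  finally show ?thesis by (simp add: Lp_norm_diff[OF p uv(3,4)])
qed

section \<open>Vectors with orbits continuous in L_p\<close>

definition Lp_continuous :: "('a \<Rightarrow> real) \<Rightarrow> bool" where
  "Lp_continuous u \<longleftrightarrow> u \<in> I \<and> ((\<lambda>t. emb M p (S t u)) \<longlongrightarrow> emb M p u) (at_right 0)"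

lemma Lp_continuous_diff:
  assumes u: "Lp_continuous u" and v: "Lp_continuous v"
  shows "Lp_continuous (\<lambda>x. u x - v x)"
proof -
  have uI: "u \<in> I" and vI: "v \<in> I" using u v by (auto simp: Lp_continuous_def)
  have "((\<lambda>t. emb M p (S t u) - emb M p (S t v)) \<longlongrightarrow> emb M p u - emb M p v) (at_right 0)"
    using u v by (intro tendsto_diff) (auto simp: Lp_continuous_def)
  moreover have "\<forall>\<^sub>F t in at_right 0. emb M p (S t u) - emb M p (S t v) = emb M p (S t (\<lambda>x. u x - v x))"
    using eventually_nonneg_at_right
  proof eventually_elim
    case (elim t)
    have L: "S t u \<in> Lp M p" "S t v \<in> Lp M p" "S t (\<lambda>x. u x - v x) \<in> Lp M p"
      using S_I[OF elim uI] S_I[OF elim vI] S_I[OF elim I_diff[OF uI vI]] by auto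
    show ?case
      unfolding emb_diff[OF p L(1,2), symmetric] emb_eq_iff[OF p Lp_diff[OF p L(1,2)] L(3)]
      using S_diff[OF elim uI vI] by eventually_elim simp
  qed
  ultimately show ?thesis
    using I_diff[OF uI vI] uI vI by (auto simp: Lp_continuous_def emb_diff[OF p] intro: Lim_transform_eventually)
qed

lemma Lp_continuous_scale:
  assumes u: "Lp_continuous u"
  shows "Lp_continuous (\<lambda>x. c * u x)"
proof -
  have uI: "u \<in> I" using u by (auto simp: Lp_continuous_def)
  have "((\<lambda>t. c *\<^sub>R emb M p (S t u)) \<longlongrightarrow> c *\<^sub>R emb M p u) (at_right 0)"
    using u by (intro tendsto_scaleR tendsto_const) (auto simp: Lp_continuous_def)
  moreover have "\<forall>\<^sub>F t in at_right 0. c *\<^sub>R emb M p (S t u) = emb M p (S t (\<lambda>x. c * u x))"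
    using eventually_nonneg_at_right
  proof eventually_elim
    case (elim t)
    have L: "S t u \<in> Lp M p" "S t (\<lambda>x. c * u x) \<in> Lp M p"
      using S_I[OF elim uI] S_I[OF elim I_scale[OF uI]] by auto
    have "AE x in M. S t (\<lambda>x. c * u x) x = c * S t u x"
      using bounded_operatorD(4)[OF C0_semigroupD(1)[OF S elim]] uI by blast
    then show ?case
      unfolding emb_scale[OF p L(1), symmetric] emb_eq_iff[OF p Lp_scale[OF p L(1)] L(2)]
      by eventually_elim simp
  qed
  ultimately show ?thesis
    using I_scale[OF uI] uI by (auto simp: Lp_continuous_def emb_scale[OF p] intro: Lim_transform_eventually)
qed

lemma Lp_continuous_closed:
  assumes u: "u \<in> I" and g: "\<And>n::nat. Lp_continuous (g n)" and lim: "(\<lambda>n. emb M p (g n)) \<longlonglongrightarrow> emb M p u"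
  shows "Lp_continuous u"
  unfolding Lp_continuous_def
proof (intro conjI u tendstoI)
  fix e :: real assume e: "0 < e"
  define L where "L = Kp * exp \<bar>wp\<bar> + 2"
  have L: "0 < L" using Kp by (simp add: L_def add_nonneg_pos)
  have eL: "0 < e / L" using e L by simp
  obtain n where n: "dist (emb M p (g n)) (emb M p u) < e / L"
    using eventually_happens[OF tendstoD[OF lim eL]] by auto
  have gI: "g n \<in> I" and glim: "((\<lambda>t. emb M p (S t (g n))) \<longlongrightarrow> emb M p (g n)) (at_right 0)"
    using g[of n] by (auto simp: Lp_continuous_def)
  have "\<forall>\<^sub>F t in at_right (0::real). 0 < t \<and> t < 1"
    using eventually_at_right_real[of 0 1] by (rule eventually_mono) auto
  then show "\<forall>\<^sub>F t in at_right 0. dist (emb M p (S t u)) (emb M p u) < e"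
    using tendstoD[OF glim eL]
  proof eventually_elim
    case (elim t)
    have "wp * t \<le> \<bar>wp\<bar> * 1" using elim by (intro mult_mono) auto
    then have "Kp * exp (wp * t) * norm (emb M p u - emb M p (g n)) \<le> Kp * exp \<bar>wp\<bar> * norm (emb M p u - emb M p (g n))"
      using Kp by (intro mult_right_mono mult_left_mono) auto
    also have "\<dots> \<le> Kp * exp \<bar>wp\<bar> * (e / L)"
      using n Kp by (intro mult_left_mono) (auto simp: dist_norm norm_minus_commute)
    finally have "dist (emb M p (S t u)) (emb M p (S t (g n))) \<le> Kp * exp \<bar>wp\<bar> * (e / L)"
      using S_diff_bound[OF _ u gI, of t] elim by (simp add: dist_norm)
    moreover have "Kp * exp \<bar>wp\<bar> * (e / L) + 2 * (e / L) = L * (e / L)"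
      unfolding L_def by (rule distrib_right[symmetric])
    moreover have "L * (e / L) = e" using L by simp
    moreover have "dist (emb M p (S t u)) (emb M p u) \<le>
        dist (emb M p (S t u)) (emb M p (S t (g n))) + dist (emb M p (S t (g n))) (emb M p (g n)) + dist (emb M p (g n)) (emb M p u)"
      by (meson add_right_mono dist_triangle order_trans)
    ultimately show ?case using elim n by linarith
  qed
qed

text \<open>Positivity of \<open>S (X i) y\<close> bounds the negative part of
  \<open>S (X i) y - y\<close> by the fixed function \<open>y\<close>, so its convergence in
  \<open>L_2\<close> carries over to \<open>L_p\<close>.\<close>

lemma negative_part_null:
  assumes y: "y \<in> I" "AE x in M. 0 \<le> y x" and X: "\<And>i::nat. 0 < X i" "X \<longlonglongrightarrow> 0"
  shows "(\<lambda>i. Lp_norm M p (\<lambda>x. max 0 (y x - S (X i) y x))) \<longlonglongrightarrow> 0"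
    "\<And>i. (\<lambda>x. max 0 (y x - S (X i) y x)) \<in> Lp M p"
proof -
  have X0: "0 \<le> X i" for i using X(1)[of i] by simp
  have yL: "y \<in> Lp M p" "y \<in> Lp M 2" using y by auto
  let ?h = "\<lambda>i x. max 0 (y x - S (X i) y x)"
  have dL: "(\<lambda>x. S (X i) y x - y x) \<in> Lp M 2" for i
    using Lp_diff[OF two_ge_1] S_I[OF X0 y(1)] y by blast
  have hm: "?h i \<in> borel_measurable M" for i
  proof -
    have [measurable]: "S (X i) y \<in> borel_measurable M" "y \<in> borel_measurable M"
      using S_I[OF X0 y(1), of i] y(1) Lp_measurable by blast+
    show ?thesis by measurable
  qed
  have h2: "?h i \<in> Lp M 2" "Lp_norm M 2 (?h i) \<le> Lp_norm M 2 (\<lambda>x. S (X i) y x - y x)" for i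
  proof -
    have "AE x in M. \<bar>?h i x\<bar> \<le> \<bar>S (X i) y x - y x\<bar>" by (rule AE_I2) (auto simp: abs_if max_def)
    then show "?h i \<in> Lp M 2" "Lp_norm M 2 (?h i) \<le> Lp_norm M 2 (\<lambda>x. S (X i) y x - y x)"
      using Lp_dominated[OF two_ge_1 dL hm] by blast+
  qed
  have dom: "AE x in M. \<bar>?h i x\<bar> \<le> y x" for i
    using y(2) positive_semigroupD[OF S_pos X0 yL(2) y(2), of i] by eventually_elim auto
  then have dom': "AE x in M. \<bar>?h i x\<bar> \<le> \<bar>y x\<bar>" for i by (rule AE_mp) (auto intro!: AE_I2)
  show "?h i \<in> Lp M p" for i by (rule Lp_dominated(1)[OF p yL(1) hm dom'])
  have "filterlim X (at_right 0) sequentially"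
    by (rule filterlim_at_right_0_sequentially[OF X])
  then have "(\<lambda>i. Lp_norm M 2 (\<lambda>x. S (X i) y x - y x)) \<longlonglongrightarrow> 0"
    using C0_semigroupD(4)[OF S yL(2)] by (rule filterlim_compose[rotated])
  then have "(\<lambda>i. Lp_norm M 2 (?h i)) \<longlonglongrightarrow> 0"
  proof (rule Lim_null_comparison[rotated])
    show "\<forall>\<^sub>F i in sequentially. norm (Lp_norm M 2 (?h i)) \<le> Lp_norm M 2 (\<lambda>x. S (X i) y x - y x)"
      unfolding real_norm_def abs_of_nonneg[OF Lp_norm_nonneg] by (intro always_eventually allI h2)
  qed
  then show "(\<lambda>i. Lp_norm M p (?h i)) \<longlonglongrightarrow> 0"
    by (rule Lp_norm_dominated_L2_null[OF p yL(1) h2(1) dom])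
qed

text \<open>
  On \<open>L\<^sub>p\<close> the mass of \<open>S t z - z\<close> could escape to infinity, but for positive semigroups its negative part is
  dominated by \<open>z\<close>, and the positive part for \<open>z\<close> is controlled by the negative part for \<open>v - z\<close>.
\<close>

lemma Lp_continuous_hereditary:
  assumes v: "Lp_continuous v" and z: "z \<in> I" and le: "AE x in M. 0 \<le> z x" "AE x in M. z x \<le> v x"
  shows "Lp_continuous z"
  unfolding Lp_continuous_def tendsto_at_iff_sequentially
proof (intro conjI z allI impI)
  fix X :: "nat \<Rightarrow> real" assume "\<forall>i. X i \<in> {0<..} - {0}" and X0: "X \<longlonglongrightarrow> 0"
  then have X: "0 < X i" for i by auto
  then have X': "0 \<le> X i" for i using less_imp_le by blast
  have vI: "v \<in> I" using v by (simp add: Lp_continuous_def)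
  note vz = I_diff[OF vI z]
  have vz0: "AE x in M. 0 \<le> v x - z x" using le(2) by eventually_elim simp
  let ?h = "\<lambda>i x. max 0 (z x - S (X i) z x)" and ?k = "\<lambda>i x. max 0 ((v x - z x) - S (X i) (\<lambda>x. v x - z x) x)"
  let ?d = "\<lambda>i x. S (X i) v x - v x"
  note h = negative_part_null[OF z le(1) X X0]
  note k = negative_part_null[OF vz vz0 X X0]
  have dL: "?d i \<in> Lp M p" for i using Lp_diff[OF p] S_I[OF X' vI] vI by blast
  have SL: "S (X i) z \<in> Lp M p" for i using S_I[OF X' z] by blast
  have zL: "z \<in> Lp M p" using z by blast
  have "filterlim X (at_right 0) sequentially"
    by (rule filterlim_at_right_0_sequentially[OF X X0])
  then have "(\<lambda>i. emb M p (S (X i) v)) \<longlonglongrightarrow> emb M p v"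
    using v filterlim_compose[of "\<lambda>t. emb M p (S t v)" _ "at_right 0" X] unfolding Lp_continuous_def by blast
  then have "(\<lambda>i. norm (emb M p (S (X i) v) - emb M p v)) \<longlonglongrightarrow> 0" by (intro tendsto_norm_zero LIM_zero)
  moreover have "norm (emb M p (S (X i) v) - emb M p v) = Lp_norm M p (?d i)" for i
    using S_I[OF X' vI] vI by (intro Lp_norm_diff[OF p, symmetric]) auto
  ultimately have d: "(\<lambda>i. Lp_norm M p (?d i)) \<longlonglongrightarrow> 0" by simp
  have bound: "norm (emb M p (S (X i) z) - emb M p z) \<le> Lp_norm M p (?d i) + Lp_norm M p (?h i) + Lp_norm M p (?k i)" for i
  proof -
    let ?s = "\<lambda>x. \<bar>?d i x\<bar> + ?h i x + ?k i x"
    have sL: "?s \<in> Lp M p" by (intro Lp_add p Lp_abs dL h(2) k(2))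
    \<comment> \<open>Where \<open>S z - z\<close> is negative, \<open>?h\<close> controls it. Where
      it is positive, it is the increment of \<open>v\<close> minus that of \<open>v - z\<close>,
      and the negative part of the latter is \<open>?k\<close>.\<close>
    have "AE x in M. \<bar>S (X i) z x - z x\<bar> \<le> \<bar>?s x\<bar>"
      using S_diff[OF X' vI z, of i]
    proof eventually_elim
      case (elim x)
      show ?case unfolding elim by (auto simp: abs_if max_def)
    qed
    then have "Lp_norm M p (\<lambda>x. S (X i) z x - z x) \<le> Lp_norm M p ?s"
      by (rule Lp_dominated(2)[OF p sL Lp_measurable[OF Lp_diff[OF p SL zL]]])
    also have "\<dots> \<le> Lp_norm M p (\<lambda>x. \<bar>?d i x\<bar> + ?h i x) + Lp_norm M p (?k i)"
      by (rule Lp_norm_triangle[OF p Lp_add[OF p Lp_abs[OF p dL] h(2)] k(2)])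
    also have "Lp_norm M p (\<lambda>x. \<bar>?d i x\<bar> + ?h i x) \<le> Lp_norm M p (\<lambda>x. \<bar>?d i x\<bar>) + Lp_norm M p (?h i)"
      by (rule Lp_norm_triangle[OF p Lp_abs[OF p dL] h(2)])
    also have "Lp_norm M p (\<lambda>x. \<bar>?d i x\<bar>) = Lp_norm M p (?d i)"
      using ennreal_exponent(3)[OF p] by (simp add: Lp_norm_def)
    finally show ?thesis by (simp add: Lp_norm_diff[OF p SL zL])
  qed
  have "(\<lambda>i. emb M p (S (X i) z) - emb M p z) \<longlonglongrightarrow> 0"
  proof (rule Lim_null_comparison)
    show "(\<lambda>i. Lp_norm M p (?d i) + Lp_norm M p (?h i) + Lp_norm M p (?k i)) \<longlonglongrightarrow> 0"
      using tendsto_add[OF tendsto_add[OF d h(1)] k(1)] by simp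
  qed (use bound in auto)
  then show "((\<lambda>t. emb M p (S t z)) \<circ> X) \<longlonglongrightarrow> emb M p z"
    unfolding o_def by (rule LIM_zero_cancel)
qed

lemma growth_L2:
  obtains K w where "1 \<le> K" "c0_semigroup (emb M 2 ` Lp M 2) (\<lambda>t. lift M 2 (S t)) K w"
proof -
  obtain K w where K: "1 \<le> K" and "\<forall>t\<ge>0. \<forall>u\<in>Lp M 2. Lp_norm M 2 (S t u) \<le> K * exp (w * t) * Lp_norm M 2 u"
    using positive_semigroup_growth[OF two_ge_1 S S_pos] by blast
  then have "c0_semigroup (emb M 2 ` Lp M 2) (\<lambda>t. lift M 2 (S t)) K w"
    by (intro c0_semigroup_lift[OF two_ge_1 S]) auto
  then show ?thesis using that K by blast
qed

lemma Lp_continuous_nonneg: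
  assumes u: "u \<in> I" "AE x in M. 0 \<le> u x"
  shows "Lp_continuous u"
proof -
  obtain K w where c: "c0_semigroup (emb M 2 ` Lp M 2) (\<lambda>t. lift M 2 (S t)) K w" using growth_L2 by metis
  interpret c0_semigroup "emb M 2 ` Lp M 2" "\<lambda>t. lift M 2 (S t)" K w by (rule c)
  note two = two_ge_1
  have u2: "u \<in> Lp M 2" and up: "u \<in> Lp M p" using u by auto
  have uV: "emb M 2 u \<in> emb M 2 ` Lp M 2" using u2 by simp
  have "\<exists>v\<in>Lp M 2. emb M 2 v = orbit_integral (emb M 2 u) t" for t
    using orbit_integral_in[OF uV, of t] unfolding image_iff by metis
  then obtain W where W: "\<And>t. W t \<in> Lp M 2" "\<And>t. emb M 2 (W t) = orbit_integral (emb M 2 u) t" by metis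
  have WL: "W t \<in> Lp M p" "Lp_norm M p (W t) \<le> t * (Kp * exp (\<bar>wp\<bar> * t) * Lp_norm M p u)" if t: "0 \<le> t" for t
    by (rule L2_orbit_integral_Lp[OF p S c _ Kp u2 up t W(1) W(2)[unfolded orbit_integral_def]], use bd in blast)+
  have WI: "W t \<in> I" if "0 \<le> t" for t using WL(1)[OF that] W(1) by blast
  have Wgood: "Lp_continuous (W h)" if h: "0 \<le> h" for h
    unfolding Lp_continuous_def
  proof (intro conjI WI h)
    define C where "C = (Kp * exp (wp * h) + 1) * (Kp * exp \<bar>wp\<bar> * Lp_norm M p u)"
    have "\<forall>\<^sub>F t in at_right (0::real). 0 < t \<and> t < 1"
      using eventually_at_right_real[of 0 1] by (rule eventually_mono) auto
    then have "\<forall>\<^sub>F t in at_right 0. norm (emb M p (S t (W h)) - emb M p (W h)) \<le> C * t"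
    proof eventually_elim
      case (elim t)
      then have t: "0 \<le> t" by simp
      note Sh = S_I[OF h WI[OF t]] and St = S_I[OF t WI[OF h]]
      \<comment> \<open>The shift formula is symmetric in \<open>h\<close> and \<open>t\<close>.
        After the exchange the \<open>L_p\<close> norm of the right side is of order
        \<open>t\<close>, by the bound on \<open>W t\<close>.\<close>
      have "emb M 2 (S t (W h)) - emb M 2 (W h) = emb M 2 (S h (W t)) - emb M 2 (W t)"
        using U_orbit_integral[OF uV t h] U_orbit_integral[OF uV h t]
          lift_emb[OF two C0_semigroupD(1)[OF S t] W(1)] lift_emb[OF two C0_semigroupD(1)[OF S h] W(1)]
        by (simp add: W(2)[symmetric] algebra_simps)
      then have "emb M 2 (\<lambda>x. S t (W h) x - W h x) = emb M 2 (\<lambda>x. S h (W t) x - W t x)"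
        using Sh St W(1) by (simp add: emb_diff[OF two])
      then have ae: "AE x in M. S t (W h) x - W h x = S h (W t) x - W t x"
        using Sh St W(1) by (subst (asm) emb_eq_iff[OF two]) (auto intro: Lp_diff two)
      have "norm (emb M p (S t (W h)) - emb M p (W h)) = Lp_norm M p (\<lambda>x. S t (W h) x - W h x)"
        using St WI[OF h] by (intro Lp_norm_diff[OF p, symmetric]) auto
      also have "\<dots> = Lp_norm M p (\<lambda>x. S h (W t) x - W t x)"
        using ae I_diff[OF St WI[OF h]] I_diff[OF Sh WI[OF t]] by (intro Lp_norm_cong_AE) (auto dest: Lp_measurable)
      also have "\<dots> = norm (emb M p (S h (W t)) - emb M p (W t))"
        using Sh WI[OF t] by (intro Lp_norm_diff[OF p]) auto
      also have "\<dots> \<le> norm (emb M p (S h (W t))) + norm (emb M p (W t))" by (rule norm_triangle_ineq4)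
      also have "\<dots> = Lp_norm M p (S h (W t)) + Lp_norm M p (W t)"
        using Sh WI[OF t] by (simp add: norm_emb[OF p])
      also have "\<dots> \<le> (Kp * exp (wp * h) + 1) * Lp_norm M p (W t)"
        using bd[OF h W(1) WL(1)[OF t]] by (simp add: distrib_right)
      also have "\<dots> \<le> (Kp * exp (wp * h) + 1) * (t * (Kp * exp \<bar>wp\<bar> * Lp_norm M p u))"
      proof (intro mult_left_mono order_trans[OF WL(2)[OF t]])
        have "\<bar>wp\<bar> * t \<le> \<bar>wp\<bar> * 1" using elim by (intro mult_left_mono) auto
        then show "Kp * exp (\<bar>wp\<bar> * t) * Lp_norm M p u \<le> Kp * exp \<bar>wp\<bar> * Lp_norm M p u"
          using Kp Lp_norm_nonneg by (intro mult_right_mono mult_left_mono) auto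
      qed (use Kp t in auto)
      finally show ?case by (simp add: C_def mult_ac)
    qed
    moreover have "((\<lambda>t. C * t) \<longlongrightarrow> 0) (at_right 0)" by (rule tendsto_mult_right_zero[OF tendsto_ident_at])
    ultimately have "((\<lambda>t. emb M p (S t (W h)) - emb M p (W h)) \<longlongrightarrow> 0) (at_right 0)"
      by (rule Lim_null_comparison)
    then show "((\<lambda>t. emb M p (S t (W h))) \<longlongrightarrow> emb M p (W h)) (at_right 0)" by (rule LIM_zero_cancel)
  qed
  have Wpos: "AE x in M. 0 \<le> W h x" for h
  proof -
    have "orbit_integral (emb M 2 u) h \<in> pos_cone M 2"
      unfolding orbit_integral_def
      by (rule has_integral_in_closed_cone[OF closed_pos_cone[OF two] _ _ _ integrable_integral[OF orbit_integrable[OF uV order_refl]]])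
        (use u(2) in \<open>auto simp: pos_cone_iff[OF two u2] intro: pos_cone_cone[OF two] lift_pos_cone[OF two S S_pos]\<close>)
    then show ?thesis using pos_cone_iff[OF two W(1)] by (simp add: W(2))
  qed
  define h where "h = (\<lambda>n::nat. 1 / (real n + 1))"
  define v where "v = (\<lambda>n x. (1 / h n) * W (h n) x)"
  \<comment> \<open>In \<open>L_p\<close> the means \<open>v n\<close> are merely known to be
    bounded, whereas \<open>m n - u\<close> lies between \<open>- u\<close> and 0, which makes the
    passage from \<open>L_2\<close> to \<open>L_p\<close> possible.\<close>
  define m where "m = (\<lambda>n x. min (v n x) (u x))"
  have h0: "0 < h n" for n by (simp add: h_def)
  then have h0': "0 \<le> h n" for n using less_imp_le by blast
  have vI: "v n \<in> I" for n unfolding v_def by (intro I_scale WI h0')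
  have [measurable]: "u \<in> borel_measurable M" "v n \<in> borel_measurable M" for n
    using u2 vI[of n] Lp_measurable by blast+
  have v0: "AE x in M. 0 \<le> v n x" for n using Wpos[of "h n"] by eventually_elim (use h0[of n] in \<open>simp add: v_def zero_le_divide_iff less_imp_le\<close>)
  have mI: "m n \<in> I" for n
  proof (rule I_dominated[OF _ u(1)])
    show "m n \<in> borel_measurable M" unfolding m_def by measurable
    show "AE x in M. \<bar>m n x\<bar> \<le> \<bar>u x\<bar>" using v0[of n] u(2) by eventually_elim (auto simp: m_def)
  qed
  have vgood: "Lp_continuous (v n)" for n
    unfolding v_def by (intro Lp_continuous_scale Wgood h0')
  have mgood: "Lp_continuous (m n)" for n
  proof (rule Lp_continuous_hereditary[OF vgood mI])
    show "AE x in M. 0 \<le> m n x" using v0[of n] u(2) by eventually_elim (auto simp: m_def)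
    show "AE x in M. m n x \<le> v n x" by (auto simp: m_def)
  qed
  have vlim: "(\<lambda>n. Lp_norm M 2 (\<lambda>x. v n x - u x)) \<longlonglongrightarrow> 0"
  proof -
    have "filterlim h (at_right 0) sequentially"
      unfolding h_def by real_asymp
    then have "(\<lambda>n. (1 / h n) *\<^sub>R (orbit_integral (emb M 2 u) (0 + h n) - orbit_integral (emb M 2 u) 0)) \<longlonglongrightarrow> lift M 2 (S 0) (emb M 2 u)"
      by (rule filterlim_compose[OF orbit_integral_derivative[OF uV order_refl]])
    moreover have "orbit_integral (emb M 2 u) 0 = 0" by (simp add: orbit_integral_def)
    moreover have "emb M 2 (v n) = (1 / h n) *\<^sub>R orbit_integral (emb M 2 u) (h n)" for n
      unfolding v_def emb_scale[OF two W(1)] W(2) ..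
    ultimately have "(\<lambda>n. emb M 2 (v n)) \<longlonglongrightarrow> emb M 2 u" using U_0[OF uV] by simp
    then have "(\<lambda>n. norm (emb M 2 (v n) - emb M 2 u)) \<longlonglongrightarrow> 0" by (intro tendsto_norm_zero LIM_zero)
    moreover have "Lp_norm M 2 (\<lambda>x. v n x - u x) = norm (emb M 2 (v n) - emb M 2 u)" for n
      using vI u2 by (intro Lp_norm_diff[OF two]) auto
    ultimately show ?thesis by simp
  qed
  have dL: "(\<lambda>x. m n x - u x) \<in> I" for n by (rule I_diff[OF mI u(1)])
  have d2: "(\<lambda>n. Lp_norm M 2 (\<lambda>x. m n x - u x)) \<longlonglongrightarrow> 0"
  proof (rule Lim_null_comparison[OF _ vlim], rule always_eventually, rule allI)
    fix n
    have "Lp_norm M 2 (\<lambda>x. m n x - u x) \<le> Lp_norm M 2 (\<lambda>x. v n x - u x)"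
      using dL[of n] I_diff[OF vI u(1)] by (intro Lp_dominated(2)[OF two]) (auto dest: Lp_measurable simp: m_def intro: AE_I2)
    then show "norm (Lp_norm M 2 (\<lambda>x. m n x - u x)) \<le> Lp_norm M 2 (\<lambda>x. v n x - u x)"
      unfolding real_norm_def abs_of_nonneg[OF Lp_norm_nonneg] .
  qed
  have "(\<lambda>n. Lp_norm M p (\<lambda>x. m n x - u x)) \<longlonglongrightarrow> 0"
  proof (rule Lp_norm_dominated_L2_null[OF p up _ _ d2])
    show "(\<lambda>x. m n x - u x) \<in> Lp M 2" for n using dL by blast
    show "AE x in M. \<bar>m n x - u x\<bar> \<le> u x" for n
      using v0[of n] u(2) by eventually_elim (auto simp: m_def)
  qed
  moreover have "Lp_norm M p (\<lambda>x. m n x - u x) = norm (emb M p (m n) - emb M p u)" for n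
    using mI up by (intro Lp_norm_diff[OF p]) auto
  ultimately have "(\<lambda>n. norm (emb M p (m n) - emb M p u)) \<longlonglongrightarrow> 0" by simp
  then have "(\<lambda>n. emb M p (m n)) \<longlonglongrightarrow> emb M p u"
    by (rule LIM_zero_cancel[OF tendsto_norm_zero_cancel])
  then show ?thesis by (rule Lp_continuous_closed[OF u(1) mgood])
qed

lemma Lp_continuous_all:
  assumes u: "u \<in> I"
  shows "Lp_continuous u"
proof -
  have [measurable]: "u \<in> borel_measurable M" using u Lp_measurable by blast
  have 1: "Lp_continuous (\<lambda>x. max 0 (u x))"
    by (intro Lp_continuous_nonneg I_dominated[OF _ u]) (auto intro: AE_I2)
  have 2: "Lp_continuous (\<lambda>x. max 0 (- u x))"
    by (intro Lp_continuous_nonneg I_dominated[OF _ u]) (auto intro: AE_I2)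
  have "(\<lambda>x. max 0 (u x) - max 0 (- u x)) = u" by (auto simp: max_def)
  then show ?thesis using Lp_continuous_diff[OF 1 2] by simp
qed

text \<open>The semigroup is extended by density on the embedded side, where truncations show that
  the intersection is dense, and representatives are chosen afterwards. It justifies the choice in
  \<open>Lp_extension\<close>.\<close>

lemma extension_exists:
  "\<exists>T'. C0_semigroup M p T' \<and> (\<forall>t\<ge>0. \<forall>u\<in>I. AE x in M. T' t u x = S t u x)"
proof -
  let ?D = "emb M p ` I"
  define U where "U = (\<lambda>t e. emb M p (S t (inv_into I (emb M p) e)))"
  have U_emb: "U t (emb M p u) = emb M p (S t u)" if t: "0 \<le> t" and u: "u \<in> I" for t u
  proof -
    let ?v = "inv_into I (emb M p) (emb M p u)"
    have v: "?v \<in> I" "emb M p ?v = emb M p u"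
      using inv_into_into[of "emb M p u" "emb M p" I] f_inv_into_f[of "emb M p u" "emb M p" I] u by auto
    have "norm (emb M p (S t ?v) - emb M p (S t u)) \<le> 0"
      using S_diff_bound[OF t v(1) u] v(2) by simp
    then show ?thesis by (simp add: U_def)
  qed
  have Sp: "S t u \<in> Lp M p" if "0 \<le> t" "u \<in> I" for t u using S_I[OF that] by simp
  have "\<exists>U'. c0_semigroup (emb M p ` Lp M p) U' Kp wp \<and> (\<forall>t\<ge>0. \<forall>x\<in>?D. U' t x = U t x)"
  proof (rule c0_semigroup_extension[OF closed_emb[OF p] subspace_emb[OF p] Kp])
    show "?D \<subseteq> emb M p ` Lp M p" by auto
    have "emb M p (\<lambda>x. 0) = 0" using emb_scale[OF p Lp_zero[OF p], of M 0] by simp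
    moreover have "(\<lambda>x. 0) \<in> I" using Lp_zero[OF p, of M] Lp_zero[OF two_ge_1, of M] by simp
    ultimately have "0 \<in> ?D" by (metis imageI)
    then show "subspace ?D"
      by (auto intro!: subspaceI simp: emb_add[OF p, symmetric] emb_scale[OF p, symmetric] I_add[simplified] I_scale[simplified])
    show "emb M p ` Lp M p \<subseteq> closure ?D"
    proof safe
      fix u assume u: "u \<in> Lp M p"
      have "emb M p (trunc n u) \<in> ?D" for n
        using trunc_Lp[OF p u p(1)] trunc_Lp[OF p u two_ge_1(1)] by blast
      then show "emb M p u \<in> closure ?D"
        unfolding closure_sequential using trunc_approx[OF p u] by (intro exI[of _ "\<lambda>n. emb M p (trunc n u)"]) simp
    qed
    fix s t c :: real and x y assume "x \<in> ?D"
    then obtain u where u: "u \<in> I" "x = emb M p u" by auto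
    have up: "u \<in> Lp M p" "u \<in> Lp M 2" using u by auto
    show "U 0 x = x"
      unfolding u(2) U_emb[OF order_refl u(1)] emb_eq_iff[OF p Sp[OF order_refl u(1)] up(1)]
      by (rule C0_semigroupD(2)[OF S up(2)])
    show "((\<lambda>t. U t x) \<longlongrightarrow> x) (at_right 0)"
    proof (rule Lim_transform_eventually)
      show "((\<lambda>t. emb M p (S t u)) \<longlongrightarrow> x) (at_right 0)" using Lp_continuous_all[OF u(1)] by (simp add: Lp_continuous_def u(2))
      show "\<forall>\<^sub>F t in at_right 0. emb M p (S t u) = U t x"
        using eventually_nonneg_at_right by eventually_elim (simp add: u(2) U_emb[OF _ u(1)])
    qed
    assume t: "0 \<le> t"
    show "U t x \<in> ?D" unfolding u(2) U_emb[OF t u(1)] by (intro imageI S_I t u)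
    show "U t (c *\<^sub>R x) = c *\<^sub>R U t x"
      unfolding u(2) emb_scale[OF p up(1), symmetric] U_emb[OF t u(1)] U_emb[OF t I_scale[OF u(1)]]
        emb_scale[OF p Sp[OF t u(1)], symmetric] emb_eq_iff[OF p Sp[OF t I_scale[OF u(1)]] Lp_scale[OF p Sp[OF t u(1)]]]
      by (rule bounded_operatorD(4)[OF C0_semigroupD(1)[OF S t] up(2)])
    show "norm (U t x) \<le> Kp * exp (wp * t) * norm x"
      unfolding u(2) U_emb[OF t u(1)] norm_emb[OF p up(1)] norm_emb[OF p Sp[OF t u(1)]] using bd[OF t up(2,1)] by blast
    show "U t (x + y) = U t x + U t y" if y: "y \<in> ?D"
    proof -
      obtain v where v: "v \<in> I" "y = emb M p v" using y by auto
      have vp: "v \<in> Lp M p" "v \<in> Lp M 2" using v by auto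
      show ?thesis
        unfolding u(2) v(2) emb_add[OF p up(1) vp(1), symmetric] U_emb[OF t u(1)] U_emb[OF t v(1)] U_emb[OF t I_add[OF u(1) v(1)]]
          emb_add[OF p Sp[OF t u(1)] Sp[OF t v(1)], symmetric]
          emb_eq_iff[OF p Sp[OF t I_add[OF u(1) v(1)]] Lp_add[OF p Sp[OF t u(1)] Sp[OF t v(1)]]]
        by (rule bounded_operatorD(3)[OF C0_semigroupD(1)[OF S t] up(2) vp(2)])
    qed
    show "U (s + t) x = U s (U t x)" if s: "0 \<le> s"
      unfolding u(2) U_emb[OF add_nonneg_nonneg[OF s t] u(1)] U_emb[OF t u(1)] U_emb[OF s S_I[OF t u(1)]]
        emb_eq_iff[OF p Sp[OF add_nonneg_nonneg[OF s t] u(1)] Sp[OF s S_I[OF t u(1)]]]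
      by (rule C0_semigroupD(3)[OF S s t up(2)])
  qed
  then obtain U' where c: "c0_semigroup (emb M p ` Lp M p) U' Kp wp" and U': "\<And>t x. 0 \<le> t \<Longrightarrow> x \<in> ?D \<Longrightarrow> U' t x = U t x"
    by blast
  interpret c0_semigroup "emb M p ` Lp M p" U' Kp wp by (rule c)
  define T where "T = (\<lambda>t u. inv_into (Lp M p) (emb M p) (U' t (emb M p u)))"
  have T: "T t u \<in> Lp M p" "emb M p (T t u) = U' t (emb M p u)" if "0 \<le> t" "u \<in> Lp M p" for t u
  proof -
    have "U' t (emb M p u) \<in> emb M p ` Lp M p" using that by (intro U_in) auto
    then show "T t u \<in> Lp M p" "emb M p (T t u) = U' t (emb M p u)"
      unfolding T_def
      using inv_into_into[of "U' t (emb M p u)" "emb M p" "Lp M p"] f_inv_into_f[of "U' t (emb M p u)" "emb M p" "Lp M p"] by auto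
  qed
  have AE_I: "AE x in M. a x = b x" if "a \<in> Lp M p" "b \<in> Lp M p" "emb M p a = emb M p b" for a b
    using emb_eq_iff[OF p that(1,2)] that(3) by simp
  have "C0_semigroup M p T"
    unfolding C0_semigroup_def
  proof (intro conjI allI ballI impI)
    fix t :: real assume t: "0 \<le> t"
    show "bounded_operator M p (T t)"
      unfolding bounded_operator_def
    proof (intro conjI ballI allI impI)
      fix u v c assume u: "u \<in> Lp M p"
      show "T t u \<in> Lp M p" by (rule T(1)[OF t u])
      show "AE x in M. T t (\<lambda>y. c * u y) x = c * T t u x"
        by (rule AE_I[OF T(1)[OF t Lp_scale[OF p u]] Lp_scale[OF p T(1)[OF t u]]])
          (use u in \<open>simp add: emb_scale[OF p T(1)[OF t u]] emb_scale[OF p u] T(2)[OF t u] T(2)[OF t Lp_scale[OF p u]] U_scale[OF t]\<close>)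
      assume v: "v \<in> Lp M p"
      show "AE x in M. T t u x = T t v x" if "AE x in M. u x = v x"
        by (rule AE_I[OF T(1)[OF t u] T(1)[OF t v]])
          (use that in \<open>simp add: T(2)[OF t u] T(2)[OF t v] emb_eq_iff[OF p u v, THEN iffD2]\<close>)
      show "AE x in M. T t (\<lambda>y. u y + v y) x = T t u x + T t v x"
        by (rule AE_I[OF T(1)[OF t Lp_add[OF p u v]] Lp_add[OF p T(1)[OF t u] T(1)[OF t v]]])
          (use u v in \<open>simp add: emb_add[OF p T(1)[OF t u] T(1)[OF t v]] emb_add[OF p u v] T(2)[OF t u] T(2)[OF t v]
            T(2)[OF t Lp_add[OF p u v]] U_add[OF t]\<close>)
    next
      have "Lp_norm M p (T t u) \<le> (Kp * exp (wp * t)) * Lp_norm M p u" if u: "u \<in> Lp M p" for u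
        unfolding norm_emb[OF p u, symmetric] norm_emb[OF p T(1)[OF t u], symmetric] T(2)[OF t u]
        using u by (intro U_bound t) simp
      then show "\<exists>K. \<forall>u\<in>Lp M p. Lp_norm M p (T t u) \<le> K * Lp_norm M p u" by blast
    qed
  next
    fix u assume u: "u \<in> Lp M p"
    have uV: "emb M p u \<in> emb M p ` Lp M p" using u by simp
    show "AE x in M. T 0 u x = u x"
      by (rule AE_I[OF T(1)[OF order_refl u] u]) (simp add: T(2)[OF order_refl u] U_0[OF uV])
    show "AE x in M. T (s + t) u x = T s (T t u) x" if st: "0 \<le> s" "0 \<le> t" for s t
      by (rule AE_I[OF T(1)[OF add_nonneg_nonneg[OF st] u] T(1)[OF st(1) T(1)[OF st(2) u]]])
        (simp add: T(2)[OF add_nonneg_nonneg[OF st] u] T(2)[OF st(1) T(1)[OF st(2) u]] T(2)[OF st(2) u] U_plus[OF st uV])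
    show "((\<lambda>t. Lp_norm M p (\<lambda>x. T t u x - u x)) \<longlongrightarrow> 0) (at_right 0)"
    proof (rule Lim_transform_eventually)
      show "((\<lambda>t. norm (U' t (emb M p u) - emb M p u)) \<longlongrightarrow> 0) (at_right 0)"
        by (intro tendsto_norm_zero LIM_zero U_tendsto uV)
      show "\<forall>\<^sub>F t in at_right 0. norm (U' t (emb M p u) - emb M p u) = Lp_norm M p (\<lambda>x. T t u x - u x)"
        using eventually_nonneg_at_right by eventually_elim (simp add: Lp_norm_diff[OF p T(1)[OF _ u] u] T(2)[OF _ u])
    qed
  qed
  moreover have "AE x in M. T t u x = S t u x" if t: "0 \<le> t" and u: "u \<in> I" for t u
  proof (rule AE_I[OF T(1)[OF t] Sp[OF t u]])
    show "emb M p (T t u) = emb M p (S t u)" using T(2)[OF t, of u] U'[OF t, of "emb M p u"] U_emb[OF t u] u by simp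
  qed (use u in simp)
  ultimately show ?thesis by blast
qed

lemma extension:
  "C0_semigroup M p (Lp_extension M p S)"
  "0 \<le> t \<Longrightarrow> u \<in> Lp M 2 \<Longrightarrow> u \<in> Lp M p \<Longrightarrow> AE x in M. Lp_extension M p S t u x = S t u x"
  using someI_ex[OF extension_exists] unfolding Lp_extension_def by blast+

text \<open>A chosen extension comes with some operator bound only. That bound gives continuity
  along truncations, on which the extension agrees with \<open>S\<close>, and so the constants
  \<open>Kp\<close> and \<open>wp\<close> are inherited.\<close>

lemma extension_bound:
  assumes t: "0 \<le> t" and u: "u \<in> Lp M p"
  shows "Lp_norm M p (Lp_extension M p S t u) \<le> Kp * exp (wp * t) * Lp_norm M p u"
proof -
  let ?T = "Lp_extension M p S t"
  note E = C0_semigroupD(1)[OF extension(1) t]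
  note Tin = bounded_operatorD(1)[OF E]
  have tI: "trunc n u \<in> Lp M 2" "trunc n u \<in> Lp M p" for n
    using trunc_Lp[OF p u p(1)] trunc_Lp[OF p u two_ge_1(1)] by auto
  obtain L where L: "\<And>u. u \<in> Lp M p \<Longrightarrow> Lp_norm M p (?T u) \<le> L * Lp_norm M p u" using bounded_operatorD(5)[OF E] by blast
  have "(\<lambda>n. emb M p (?T (trunc n u))) \<longlonglongrightarrow> emb M p (?T u)"
  proof (rule LIM_zero_cancel, rule tendsto_0_le)
    show "(\<lambda>n. emb M p (trunc n u) - emb M p u) \<longlonglongrightarrow> 0" by (rule LIM_zero[OF trunc_approx[OF p u]])
    have "norm (emb M p (?T (trunc n u)) - emb M p (?T u)) \<le> norm (emb M p (trunc n u) - emb M p u) * L" for n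
    proof -
      have "norm (emb M p (?T (trunc n u)) - emb M p (?T u)) = Lp_norm M p (\<lambda>x. ?T (trunc n u) x - ?T u x)"
        by (rule Lp_norm_diff[OF p Tin[OF tI(2)] Tin[OF u], symmetric])
      also have "\<dots> = Lp_norm M p (?T (\<lambda>x. trunc n u x - u x))"
        using operator_diff[OF p E tI(2) u, of n] Lp_diff[OF p Tin[OF tI(2)] Tin[OF u], of n] Tin[OF Lp_diff[OF p tI(2) u], of n]
        by (intro Lp_norm_cong_AE) (auto dest: Lp_measurable)
      also have "\<dots> \<le> L * Lp_norm M p (\<lambda>x. trunc n u x - u x)" by (rule L[OF Lp_diff[OF p tI(2) u]])
      finally show ?thesis by (simp add: Lp_norm_diff[OF p tI(2) u] mult.commute)
    qed
    then show "\<forall>\<^sub>F n in sequentially. norm (emb M p (?T (trunc n u)) - emb M p (?T u)) \<le> norm (emb M p (trunc n u) - emb M p u) * L"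
      by simp
  qed
  then have lim1: "(\<lambda>n. norm (emb M p (?T (trunc n u)))) \<longlonglongrightarrow> norm (emb M p (?T u))" by (rule tendsto_norm)
  have lim2: "(\<lambda>n. Kp * exp (wp * t) * norm (emb M p (trunc n u))) \<longlonglongrightarrow> Kp * exp (wp * t) * norm (emb M p u)"
    by (intro tendsto_mult tendsto_const tendsto_norm trunc_approx p u)
  have le: "norm (emb M p (?T (trunc n u))) \<le> Kp * exp (wp * t) * norm (emb M p (trunc n u))" for n
  proof -
    have "Lp_norm M p (?T (trunc n u)) = Lp_norm M p (S t (trunc n u))"
      using extension(2)[OF t tI] Tin[OF tI(2)] bd[OF t tI] by (intro Lp_norm_cong_AE) (auto dest: Lp_measurable)
    then show ?thesis using bd[OF t tI, of n] norm_emb[OF p tI(2)] norm_emb[OF p Tin[OF tI(2)]] by auto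
  qed
  have "norm (emb M p (?T u)) \<le> Kp * exp (wp * t) * norm (emb M p u)"
    using LIMSEQ_le[OF lim1 lim2] le by blast
  then show ?thesis by (simp add: norm_emb[OF p u] norm_emb[OF p Tin[OF u]])
qed

end

section \<open>Duality and domination\<close>

text \<open>With the growth constants on \<open>L_2\<close> as parameters as well, the calculus of
  semigroups is available for \<open>L_2\<close> and \<open>L_p\<close> side by side.\<close>

locale acting_semigroup_L2 = acting_semigroup +
  fixes K2 w2 :: real
  assumes c2: "c0_semigroup (emb M 2 ` Lp M 2) (\<lambda>t. lift M 2 (S t)) K2 w2"
begin

sublocale base: c0_semigroup "emb M 2 ` Lp M 2" "\<lambda>t. lift M 2 (S t)" K2 w2
  by (rule c2)

sublocale ext: c0_semigroup "emb M p ` Lp M p" "\<lambda>t. lift M p (Lp_extension M p S t)" Kp wp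
  by (rule c0_semigroup_lift[OF p extension(1) Kp extension_bound])

abbreviation "U2 t \<equiv> lift M 2 (S t)"
abbreviation "Up t \<equiv> lift M p (Lp_extension M p S t)"
abbreviation "R2 \<equiv> resolvent M (generator M 2 S)"
abbreviation "Rp \<equiv> resolvent M (generator M p (Lp_extension M p S))"

lemmas R2 = resolvent_eq_resolv[OF two_ge_1 S c2]
lemmas Rp = resolvent_eq_resolv[OF p extension(1) ext.c0_semigroup_axioms]
lemmas lift2 = lift_emb[OF two_ge_1 C0_semigroupD(1)[OF S]]
lemmas liftp = lift_emb[OF p C0_semigroupD(1)[OF extension(1)]]

lemma base_gen: "u \<in> Lp M 2 \<Longrightarrow> y \<in> Lp M 2 \<Longrightarrow> (u, y) \<in> generator M 2 S \<longleftrightarrow> base.gen (emb M 2 u) (emb M 2 y)"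
  by (rule generator_iff_gen[OF two_ge_1 S c2])

lemma emb_extension: "0 \<le> t \<Longrightarrow> u \<in> I \<Longrightarrow> emb M p (Lp_extension M p S t u) = emb M p (S t u)"
  using emb_eq_iff[OF p C0_semigroup_in[OF extension(1)], of t u "S t u"] extension(2)[of t u] S_I[of t u] by simp

text \<open>Both resolvents are Laplace transforms, and the pairings with indicator functions agree.\<close>

lemma resolvents_consistent:
  assumes l: "w2 < l" "wp < l" and u: "u \<in> I"
  shows "AE x in M. R2 l u x = Rp l u x"
proof -
  have u2: "u \<in> Lp M 2" and up: "u \<in> Lp M p" using u by auto
  note r2 = R2[OF l(1) u2] and rp = Rp[OF l(2) up]
  have uV2: "emb M 2 u \<in> emb M 2 ` Lp M 2" and uVp: "emb M p u \<in> emb M p ` Lp M p" using u2 up by auto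
  have eq: "(\<integral>x. R2 l u x * indicator A x \<partial>M) = (\<integral>x. Rp l u x * indicator A x \<partial>M)"
    if A: "A \<in> sets M" "emeasure M A < \<infinity>" for A
  proof -
    let ?g = "indicator A :: 'a \<Rightarrow> real"
    obtain p' :: ennreal where p': "1 / p + 1 / p' = 1" using conjugate_exponent_exists[OF p] by blast
    obtain \<phi> where \<phi>: "bounded_linear \<phi>" "\<And>u. u \<in> Lp M 2 \<Longrightarrow> \<phi> (emb M 2 u) = pairing M u ?g"
      using pairing_functional[OF two_ge_1 conjugate_exponent_2 indicator_Lp[OF two_ge_1(1) A]] by blast
    obtain \<psi> where \<psi>: "bounded_linear \<psi>" "\<And>u. u \<in> Lp M p \<Longrightarrow> \<psi> (emb M p u) = pairing M u ?g"
      using pairing_functional[OF p p' indicator_Lp[OF conjugate_exponent_ge_1[OF p p'] A]] by blast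
    let ?F = "\<lambda>s. exp (- (l * s)) *\<^sub>R U2 s (emb M 2 u)"
    let ?G = "\<lambda>s. exp (- (l * s)) *\<^sub>R Up s (emb M p u)"
    have "\<phi> (integral {0..real n} ?F) = \<psi> (integral {0..real n} ?G)" for n
    proof -
      have iF: "?F integrable_on {0..real n}"
        using c0_semigroup.orbit_integrable[OF base.rescaled uV2 order_refl] .
      have iG: "?G integrable_on {0..real n}"
        using c0_semigroup.orbit_integrable[OF ext.rescaled uVp order_refl] .
      have "\<phi> (integral {0..real n} ?F) = integral {0..real n} (\<phi> \<circ> ?F)"
        by (rule integral_linear[OF iF \<phi>(1), symmetric])
      also have "\<dots> = integral {0..real n} (\<psi> \<circ> ?G)"
      proof (rule integral_cong)
        fix s assume "s \<in> {0..real n}"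
        then have s: "0 \<le> s" by simp
        have "\<phi> (U2 s (emb M 2 u)) = \<psi> (Up s (emb M p u))"
          using S_I[OF s u] by (simp add: lift2[OF s u2] liftp[OF s up] emb_extension[OF s u] \<phi>(2) \<psi>(2))
        then show "(\<phi> \<circ> ?F) s = (\<psi> \<circ> ?G) s"
          by (simp add: linear_scale[OF bounded_linear.linear[OF \<phi>(1)]] linear_scale[OF bounded_linear.linear[OF \<psi>(1)]])
      qed
      also have "\<dots> = \<psi> (integral {0..real n} ?G)" by (rule integral_linear[OF iG \<psi>(1)])
      finally show ?thesis .
    qed
    then have "(\<lambda>n. \<phi> (integral {0..real n} ?F)) \<longlonglongrightarrow> \<psi> (ext.resolv l (emb M p u))"
      using bounded_linear.tendsto[OF \<psi>(1) ext.resolv_limit[OF l(2) uVp]] by simp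
    then have "\<phi> (base.resolv l (emb M 2 u)) = \<psi> (ext.resolv l (emb M p u))"
      by (rule LIMSEQ_unique[OF bounded_linear.tendsto[OF \<phi>(1) base.resolv_limit[OF l(1) uV2]]])
    then show ?thesis using r2(2) rp(2) \<phi>(2)[OF r2(1)] \<psi>(2)[OF rp(1)] by (simp add: pairing_def)
  qed
  \<comment> \<open>The difference is a sum of a function in \<open>L_2\<close> and one in
    \<open>L_p\<close>, the situation for which the test was made.\<close>
  have "AE x in M. R2 l u x + (- 1) * Rp l u x \<le> 0"
    by (rule AE_nonpos_test[OF two_ge_1 p r2(1) Lp_scale[OF p rp(1)]]) (use eq in simp)
  moreover have "AE x in M. (- 1) * R2 l u x + Rp l u x \<le> 0"
    by (rule AE_nonpos_test[OF two_ge_1 p Lp_scale[OF two_ge_1 r2(1)] rp(1)]) (use eq in simp)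
  ultimately show ?thesis by eventually_elim simp
qed

lemma R2_Lp:
  assumes l: "w2 < l" "wp < l" and u: "u \<in> I"
  shows "R2 l u \<in> Lp M p" "emb M p (R2 l u) = ext.resolv l (emb M p u)"
    "Lp_norm M p (R2 l u) \<le> Kp / (l - wp) * Lp_norm M p u"
proof -
  have u2: "u \<in> Lp M 2" and up: "u \<in> Lp M p" using u by auto
  note r2 = R2[OF l(1) u2] and rp = Rp[OF l(2) up]
  note ae = resolvents_consistent[OF l u]
  show rL: "R2 l u \<in> Lp M p"
    by (rule Lp_AE_cong[OF p rp(1) Lp_measurable[OF r2(1)]]) (use ae in \<open>eventually_elim, simp\<close>)
  show e: "emb M p (R2 l u) = ext.resolv l (emb M p u)"
    using emb_eq_iff[OF p rL rp(1)] ae rp(2) by simp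
  show "Lp_norm M p (R2 l u) \<le> Kp / (l - wp) * Lp_norm M p u"
    using ext.resolv_bound[OF l(2), of "emb M p u"] up by (simp add: norm_emb[OF p rL, symmetric] norm_emb[OF p up] e)
qed

lemma R2_nonneg:
  assumes l: "w2 < l" and u: "u \<in> Lp M 2" "AE x in M. 0 \<le> u x"
  shows "AE x in M. 0 \<le> R2 l u x"
proof -
  have "base.resolv l (emb M 2 u) \<in> pos_cone M 2"
    by (rule base.resolv_cone[OF closed_pos_cone[OF two_ge_1] _ _ _ _ _ l])
      (use u in \<open>auto simp: pos_cone_iff[OF two_ge_1] intro: pos_cone_cone[OF two_ge_1] lift_pos_cone[OF two_ge_1 S S_pos]
         subsetD[OF pos_cone_cone(1)[OF two_ge_1]]\<close>)
  then show ?thesis using pos_cone_iff[OF two_ge_1 R2(1)[OF l u(1)]] R2(2)[OF l u(1)] by simp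
qed

text \<open>The exponents trade places: boundedness of the functional in the \<open>L_p\<close> norm
  puts its representative into the dual space. Indicators detect the sign.\<close>

lemma dual_representation:
  assumes conj: "1 / p + 1 / p' = 1"
    and add: "\<And>u v. u \<in> Lp M 2 \<Longrightarrow> v \<in> Lp M 2 \<Longrightarrow> \<phi> (\<lambda>x. u x + v x) = \<phi> u + \<phi> v"
    and scale: "\<And>c u. u \<in> Lp M 2 \<Longrightarrow> \<phi> (\<lambda>x. c * u x) = c * \<phi> u"
    and bd2: "\<And>u. u \<in> Lp M 2 \<Longrightarrow> \<bar>\<phi> u\<bar> \<le> L * Lp_norm M 2 u"
    and bdp: "\<And>u. u \<in> I \<Longrightarrow> \<bar>\<phi> u\<bar> \<le> C * Lp_norm M p u" and C: "0 \<le> C"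
    and pos: "\<And>u. u \<in> Lp M 2 \<Longrightarrow> AE x in M. 0 \<le> u x \<Longrightarrow> 0 \<le> \<phi> u"
  shows "\<exists>v. v \<in> Lp M 2 \<and> v \<in> Lp M p' \<and> (AE x in M. 0 \<le> v x) \<and> (\<forall>u\<in>Lp M 2. \<phi> u = pairing M u v)"
proof -
  obtain v where v: "v \<in> Lp M 2" "\<And>u. u \<in> Lp M 2 \<Longrightarrow> \<phi> u = pairing M u v"
    using Riesz_L2[of M \<phi> L, OF add scale bd2] by blast
  have bd': "\<bar>pairing M v g\<bar> \<le> C * Lp_norm M p g" if "g \<in> Lp M 2" "g \<in> Lp M p" for g
    using bdp[of g] v(2)[of g] that by (simp add: pairing_def mult.commute)
  have "v \<in> Lp M p'"
  proof (rule conjugate_exponent_cases[OF p conj])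
    assume inf: "p' = \<infinity>" "enn2real p = 1"
    have p1: "p = 1" using ennreal_exponent(2)[OF p] inf by simp
    show ?thesis unfolding inf(1) by (rule converse_Holder_infinity[OF v(1) C bd'[unfolded p1]])
  next
    assume fin: "1 \<le> p'" "p' < \<infinity>"
    show ?thesis by (rule converse_Holder(1)[OF fin conjugate_exponent_sym[OF conj] v(1) C bd'])
  qed
  moreover have "AE x in M. (- 1) * v x + 0 \<le> 0"
  proof (rule AE_nonpos_test[OF two_ge_1 two_ge_1 Lp_scale[OF two_ge_1 v(1)] Lp_zero[OF two_ge_1]])
    fix A assume A: "A \<in> sets M" "emeasure M A < \<infinity>"
    have "0 \<le> \<phi> (indicator A)" by (intro pos indicator_Lp two_ge_1 A) (auto simp: indicator_def)
    then show "(\<integral>x. (- 1) * v x * indicator A x \<partial>M) + (\<integral>x. 0 * indicator A x \<partial>M) \<le> 0"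
      using v(2)[OF indicator_Lp[OF two_ge_1(1) A]] by (simp add: pairing_def mult.commute)
  qed
  ultimately show ?thesis using v by (intro exI[of _ v]) auto
qed

text \<open>The source of the test functions for (b): \<open>v'\<close> is the adjoint of
  \<open>S t\<close> composed with the resolvent, applied to \<open>v\<close>, and \<open>z\<close>
  is the value of the dual generator there. The last property extends the defining pairing to all of
  \<open>L_p\<close>, since \<open>f\<close> need not belong to \<open>L_2\<close>.\<close>

lemma dual_resolvent_element:
  assumes conj: "1 / p + 1 / p' = 1" and l: "w2 < l" "wp < l" and t: "0 \<le> t"
    and v: "v \<in> Lp M 2" "v \<in> Lp M p'" "AE x in M. 0 \<le> v x"
    and \<phi>: "bounded_linear \<phi>" "\<And>u. u \<in> Lp M 2 \<Longrightarrow> \<phi> (emb M 2 u) = pairing M u v"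
    and \<psi>: "bounded_linear \<psi>" "\<And>u. u \<in> Lp M p \<Longrightarrow> \<psi> (emb M p u) = pairing M u v"
  shows "\<exists>v' z. (v', z) \<in> weak_star_generator M S \<and> v' \<in> Lp M p' \<and> (AE x in M. 0 \<le> v' x) \<and>
    (\<forall>u\<in>Lp M 2. pairing M u v' = \<phi> (U2 t (base.resolv l (emb M 2 u)))) \<and>
    (\<forall>u\<in>Lp M 2. pairing M u z =
       \<phi> (U2 t (l *\<^sub>R base.resolv l (emb M 2 u) - emb M 2 u))) \<and>
    (\<forall>f\<in>Lp M p. pairing M f v' = \<psi> (ext.resolv l (Up t (emb M p f))))"
proof -
  note two = two_ge_1
  interpret \<phi>: bounded_linear \<phi> by (rule \<phi>(1))
  interpret \<psi>: bounded_linear \<psi> by (rule \<psi>(1))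
  have V: "emb M 2 u \<in> emb M 2 ` Lp M 2" if "u \<in> Lp M 2" for u using that by simp
  have Vp: "emb M p u \<in> emb M p ` Lp M p" if "u \<in> Lp M p" for u using that by simp
  define B where "B = (\<lambda>u. U2 t (base.resolv l (emb M 2 u)))"
  have Bemb: "B u = emb M 2 (S t (R2 l u))" if "u \<in> Lp M 2" for u
    unfolding B_def R2(2)[OF l(1) that, symmetric] by (rule lift2[OF t R2(1)[OF l(1) that]])
  \<comment> \<open>On the intersection both semigroups and both resolvents agree. Hence the
    functional defined through \<open>L_2\<close> is also bounded in the \<open>L_p\<close>
    norm.\<close>
  have SRp: "\<psi> (ext.resolv l (Up t (emb M p u))) = \<phi> (B u)" if u: "u \<in> I" for u
  proof -
    have up: "u \<in> Lp M p" and u2: "u \<in> Lp M 2" using u by auto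
    have rI: "R2 l u \<in> I" using R2(1)[OF l(1) u2] R2_Lp(1)[OF l u] by simp
    have "ext.resolv l (Up t (emb M p u)) = Up t (emb M p (R2 l u))"
      unfolding R2_Lp(2)[OF l u] by (rule ext.U_resolv[OF l(2) Vp[OF up] t, symmetric])
    also have "\<dots> = emb M p (S t (R2 l u))"
      using rI by (simp add: liftp[OF t] emb_extension[OF t rI])
    finally show ?thesis
      using S_I[OF t rI] by (simp add: Bemb[OF u2] \<phi>(2) \<psi>(2))
  qed
  obtain L where L: "\<And>x. norm (\<phi> x) \<le> norm x * L" "0 \<le> L" using \<phi>.nonneg_bounded by blast
  obtain L' where L': "\<And>x. norm (\<psi> x) \<le> norm x * L'" "0 \<le> L'" using \<psi>.nonneg_bounded by blast
  have Badd: "B (\<lambda>x. u x + v x) = B u + B v" if "u \<in> Lp M 2" "v \<in> Lp M 2" for u v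
    using that by (simp add: B_def emb_add[OF two] base.resolv_add[OF l(1)] base.U_add[OF t] base.resolv_in[OF l(1)])
  have Bscale: "B (\<lambda>x. c * u x) = c *\<^sub>R B u" if "u \<in> Lp M 2" for u c
    using that by (simp add: B_def emb_scale[OF two] base.resolv_scale[OF l(1)] base.U_scale[OF t] base.resolv_in[OF l(1)])
  have Bbd: "\<bar>\<phi> (B u)\<bar> \<le> (K2 * exp (w2 * t) * (K2 / (l - w2)) * L) * Lp_norm M 2 u" if u: "u \<in> Lp M 2" for u
  proof -
    have "norm (B u) \<le> K2 * exp (w2 * t) * norm (base.resolv l (emb M 2 u))"
      unfolding B_def by (rule base.U_bound[OF t base.resolv_in[OF l(1) V[OF u]]])
    also have "\<dots> \<le> K2 * exp (w2 * t) * (K2 / (l - w2) * norm (emb M 2 u))"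
      using base.K_nonneg by (intro mult_left_mono base.resolv_bound l V u) auto
    finally have "norm (B u) * L \<le> K2 * exp (w2 * t) * (K2 / (l - w2) * norm (emb M 2 u)) * L"
      using L(2) by (rule mult_right_mono)
    then show ?thesis using L(1)[of "B u"] by (simp add: norm_emb[OF two u] mult_ac)
  qed
  have Bbdp: "\<bar>\<phi> (B u)\<bar> \<le> (Kp / (l - wp) * (Kp * exp (wp * t)) * L') * Lp_norm M p u" if u: "u \<in> I" for u
  proof -
    have up: "u \<in> Lp M p" using u by auto
    let ?e = "Up t (emb M p u)"
    have "norm (ext.resolv l ?e) \<le> Kp / (l - wp) * norm ?e"
      by (rule ext.resolv_bound[OF l(2) ext.U_in[OF t Vp[OF up]]])
    also have "\<dots> \<le> Kp / (l - wp) * (Kp * exp (wp * t) * norm (emb M p u))"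
      using Kp l by (intro mult_left_mono ext.U_bound t Vp up) auto
    finally have "norm (ext.resolv l ?e) * L' \<le> Kp / (l - wp) * (Kp * exp (wp * t) * norm (emb M p u)) * L'"
      using L'(2) by (rule mult_right_mono)
    then show ?thesis using L'(1)[of "ext.resolv l ?e"] SRp[OF u] by (simp add: norm_emb[OF p up] mult_ac)
  qed
  have Bpos: "0 \<le> \<phi> (B u)" if u: "u \<in> Lp M 2" "AE x in M. 0 \<le> u x" for u
  proof -
    have "AE x in M. 0 \<le> S t (R2 l u) x"
      by (rule positive_semigroupD[OF S_pos t R2(1)[OF l(1) u(1)] R2_nonneg[OF l(1) u]])
    then have "AE x in M. 0 \<le> S t (R2 l u) x * v x" using v(3) by eventually_elim simp
    then show ?thesis
      using \<phi>(2)[OF C0_semigroup_in[OF S t R2(1)[OF l(1) u(1)]]]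
      by (simp add: Bemb[OF u(1)] pairing_def integral_nonneg_AE)
  qed
  have C0: "0 \<le> Kp / (l - wp) * (Kp * exp (wp * t)) * L'" using Kp l L'(2) by simp
  obtain v' where v': "v' \<in> Lp M 2" "v' \<in> Lp M p'" "AE x in M. 0 \<le> v' x" "\<And>u. u \<in> Lp M 2 \<Longrightarrow> \<phi> (B u) = pairing M u v'"
    using dual_representation[OF conj, of "\<lambda>u. \<phi> (B u)", OF _ _ Bbd Bbdp C0 Bpos]
    by (auto simp: Badd Bscale \<phi>.add \<phi>.scaleR)
  have "\<exists>v''\<in>Lp M 2. \<forall>u\<in>Lp M 2. \<phi> (U2 t (emb M 2 u)) = pairing M u v''"
  proof (rule Riesz_L2[where L = "K2 * exp (w2 * t) * L"])
    fix u assume u: "u \<in> Lp M 2"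
    have "norm (U2 t (emb M 2 u)) * L \<le> K2 * exp (w2 * t) * norm (emb M 2 u) * L"
      by (intro mult_right_mono base.U_bound t V u L(2))
    then show "\<bar>\<phi> (U2 t (emb M 2 u))\<bar> \<le> K2 * exp (w2 * t) * L * Lp_norm M 2 u"
      using L(1)[of "U2 t (emb M 2 u)"] by (simp add: norm_emb[OF two u] mult_ac)
  qed (simp_all add: emb_add[OF two] emb_scale[OF two] base.U_add[OF t] base.U_scale[OF t] \<phi>.add \<phi>.scaleR)
  then obtain v'' where v'': "v'' \<in> Lp M 2" "\<And>u. u \<in> Lp M 2 \<Longrightarrow> \<phi> (U2 t (emb M 2 u)) = pairing M u v''" by blast
  \<comment> \<open>The adjoint of \<open>l R - 1\<close>, with \<open>R\<close> the resolvent at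
    \<open>l\<close>, in two pieces: \<open>v'\<close> carries the resolvent and \<open>v''\<close>
    represents the adjoint of \<open>S t\<close> alone.\<close>
  define z where "z = (\<lambda>x. l * v' x - v'' x)"
  have zL: "z \<in> Lp M 2" unfolding z_def by (intro Lp_diff Lp_scale two v' v'')
  have zp: "pairing M u z = \<phi> (U2 t (l *\<^sub>R base.resolv l (emb M 2 u) - emb M 2 u))" if u: "u \<in> Lp M 2" for u
  proof -
    have i: "integrable M (\<lambda>x. u x * v' x)" "integrable M (\<lambda>x. u x * v'' x)"
      by (rule Holder_inequality(1)[OF two conjugate_exponent_2 u v'(1)], rule Holder_inequality(1)[OF two conjugate_exponent_2 u v''(1)])
    have "(\<integral>x. u x * z x \<partial>M) = (\<integral>x. l * (u x * v' x) - u x * v'' x \<partial>M)"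
      by (intro Bochner_Integration.integral_cong) (auto simp: z_def algebra_simps)
    then have "pairing M u z = l * pairing M u v' - pairing M u v''" using i by (simp add: pairing_def)
    then show ?thesis
      by (simp add: v'(4)[OF u, symmetric] v''(2)[OF u, symmetric] B_def base.U_diff[OF t] base.U_scale[OF t] V[OF u]
          base.resolv_in[OF l(1)] base.V_scale \<phi>.diff \<phi>.scaleR)
  qed
  have wsg: "(v', z) \<in> weak_star_generator M S"
    unfolding weak_star_generator_def
  proof (intro CollectI case_prodI conjI ballI v' zL)
    fix u assume u: "u \<in> Lp M 2"
    let ?r = "base.resolv l (emb M 2 u)"
    have rV: "?r \<in> emb M 2 ` Lp M 2" by (rule base.resolv_in[OF l(1) V[OF u]])
    have g: "base.gen (U2 t ?r) (U2 t (l *\<^sub>R ?r - emb M 2 u))"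
      by (rule base.gen_U[OF base.gen_resolv[OF l(1) V[OF u]] t])
    then have "((\<lambda>h. (1 / h) *\<^sub>R (U2 h (U2 t ?r) - U2 t ?r)) \<longlongrightarrow>
        U2 t (l *\<^sub>R ?r - emb M 2 u)) (at_right 0)"
      by (simp add: base.gen_def)
    then have "((\<lambda>h. \<phi> ((1 / h) *\<^sub>R (U2 h (U2 t ?r) - U2 t ?r))) \<longlongrightarrow>
        pairing M u z) (at_right 0)"
      unfolding zp[OF u] by (rule \<phi>.tendsto)
    moreover have "\<forall>\<^sub>F h in at_right 0. \<phi> ((1 / h) *\<^sub>R (U2 h (U2 t ?r) - U2 t ?r)) =
       (1 / h) * (dual_operator (S h) (\<lambda>h. pairing M h v') u - pairing M u v')"
      using eventually_nonneg_at_right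
    proof eventually_elim
      case (elim h)
      have "U2 h (U2 t ?r) = U2 t (U2 h ?r)"
        using base.U_plus[OF elim t rV] base.U_plus[OF t elim rV] by (simp add: add.commute)
      also have "U2 h ?r = base.resolv l (emb M 2 (S h u))"
        unfolding base.U_resolv[OF l(1) V[OF u] elim] lift2[OF elim u] ..
      finally have "\<phi> (U2 h (U2 t ?r)) = pairing M (S h u) v'"
        using v'(4)[OF C0_semigroup_in[OF S elim u]] by (simp add: B_def)
      moreover have "\<phi> (U2 t ?r) = pairing M u v'"
        using v'(4)[OF u] by (simp add: B_def)
      ultimately show ?case by (simp add: \<phi>.scaleR \<phi>.diff dual_operator_def)
    qed
    ultimately show "((\<lambda>t. (1 / t) * (dual_operator (S t) (\<lambda>h. pairing M h v') u - pairing M u v')) \<longlongrightarrow> pairing M u z) (at_right 0)"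
      by (rule Lim_transform_eventually)
  qed
  \<comment> \<open>Both sides are continuous in \<open>f\<close> with respect to \<open>L_p\<close>
    and agree on truncations, which lie in the intersection.\<close>
  have fp: "pairing M f v' = \<psi> (ext.resolv l (Up t (emb M p f)))" if f: "f \<in> Lp M p" for f
  proof -
    obtain \<theta> where \<theta>: "bounded_linear \<theta>" "\<And>u. u \<in> Lp M p \<Longrightarrow> \<theta> (emb M p u) = pairing M u v'"
      using pairing_functional[OF p conj v'(2)] by blast
    have tI: "trunc n f \<in> I" for n using trunc_Lp[OF p f p(1)] trunc_Lp[OF p f two_ge_1(1)] by simp
    have "(\<lambda>n. \<theta> (emb M p (trunc n f))) \<longlonglongrightarrow> \<theta> (emb M p f)"
      by (rule bounded_linear.tendsto[OF \<theta>(1) trunc_approx[OF p f]])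
    moreover have "\<theta> (emb M p (trunc n f)) = \<psi> (ext.resolv l (Up t (emb M p (trunc n f))))" for n
      using tI[of n] \<theta>(2)[of "trunc n f"] v'(4)[of "trunc n f"] SRp[OF tI] by simp
    ultimately have 1: "(\<lambda>n. \<psi> (ext.resolv l (Up t (emb M p (trunc n f))))) \<longlonglongrightarrow> pairing M f v'"
      using \<theta>(2)[OF f] by simp
    have tV: "emb M p (trunc n f) \<in> emb M p ` Lp M p" for n using tI by auto
    have "(\<lambda>n. Up t (emb M p (trunc n f))) \<longlonglongrightarrow> Up t (emb M p f)"
      by (rule ext.U_tendsto_joint[OF tendsto_const trunc_approx[OF p f]]) (use t tV Vp[OF f] in auto)
    then have "(\<lambda>n. ext.resolv l (Up t (emb M p (trunc n f)))) \<longlonglongrightarrow>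
        ext.resolv l (Up t (emb M p f))"
      by (rule ext.resolv_tendsto[OF l(2)]) (use ext.U_in[OF t tV] ext.U_in[OF t Vp[OF f]] in auto)
    then have "(\<lambda>n. \<psi> (ext.resolv l (Up t (emb M p (trunc n f))))) \<longlonglongrightarrow>
        \<psi> (ext.resolv l (Up t (emb M p f)))"
      by (rule \<psi>.tendsto)
    then show ?thesis by (rule LIMSEQ_unique[OF 1])
  qed
  show ?thesis
    using wsg v'(2,3) v'(4) zp fp by (intro exI[of _ v'] exI[of _ z]) (auto simp: B_def)
qed

text \<open>Both sides are limits of the same real difference quotient, read once as a norm limit
  paired with \<open>v\<close> and once as a weak* limit applied to \<open>u\<close>.\<close>

lemma generator_weak_star_dual:
  assumes u: "(u, y) \<in> generator M 2 S" and v: "(v, z) \<in> weak_star_generator M S"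
  shows "pairing M y v = pairing M u z"
proof -
  have L: "u \<in> Lp M 2" "y \<in> Lp M 2" "v \<in> Lp M 2" using u v by (auto simp: generator_def weak_star_generator_def)
  obtain \<phi> where \<phi>: "bounded_linear \<phi>" "\<And>u. u \<in> Lp M 2 \<Longrightarrow> \<phi> (emb M 2 u) = pairing M u v"
    using pairing_functional[OF two_ge_1 conjugate_exponent_2 L(3)] by blast
  interpret \<phi>: bounded_linear \<phi> by (rule \<phi>(1))
  have "base.gen (emb M 2 u) (emb M 2 y)" using base_gen[OF L(1,2)] u by simp
  then have "((\<lambda>t. \<phi> ((1 / t) *\<^sub>R (U2 t (emb M 2 u) - emb M 2 u))) \<longlongrightarrow> \<phi> (emb M 2 y)) (at_right 0)"
    by (intro \<phi>.tendsto) (simp add: base.gen_def)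
  moreover have "\<forall>\<^sub>F t in at_right 0. \<phi> ((1 / t) *\<^sub>R (U2 t (emb M 2 u) - emb M 2 u)) =
      (1 / t) * (dual_operator (S t) (\<lambda>h. pairing M h v) u - pairing M u v)"
    using eventually_nonneg_at_right
    by eventually_elim (simp add: lift2[OF _ L(1)] \<phi>.scaleR \<phi>.diff \<phi>(2) L C0_semigroup_in[OF S] dual_operator_def)
  ultimately have "((\<lambda>t. (1 / t) * (dual_operator (S t) (\<lambda>h. pairing M h v) u - pairing M u v)) \<longlongrightarrow> \<phi> (emb M 2 y)) (at_right 0)"
    by (rule Lim_transform_eventually)
  moreover have "((\<lambda>t. (1 / t) * (dual_operator (S t) (\<lambda>h. pairing M h v) u - pairing M u v)) \<longlongrightarrow> pairing M u z) (at_right 0)"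
    using v L(1) by (simp add: weak_star_generator_def)
  ultimately have "\<phi> (emb M 2 y) = pairing M u z"
    by (rule tendsto_unique[rotated]) simp
  then show ?thesis using \<phi>(2)[OF L(2)] by simp
qed

end

section \<open>Integrals of L_p-valued functions\<close>

lemma has_Lp_integral_iff:
  assumes p: "1 \<le> p" "p < \<infinity>" and F: "\<And>s. s \<in> {a..b} \<Longrightarrow> F s \<in> Lp M p"
  shows "has_Lp_integral M p F g a b \<longleftrightarrow> g \<in> Lp M p \<and> ((\<lambda>s. emb M p (F s)) has_integral emb M p g) {a..b}"
proof (cases "g \<in> Lp M p")
  case g: True
  have "\<forall>\<^sub>F D in division_filter (cbox a b).
     Lp_norm M p (\<lambda>x. (\<Sum>(s, k)\<in>D. measure lborel k * F s x) - g x) =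
     norm ((\<Sum>(s, k)\<in>D. measure lborel k *\<^sub>R emb M p (F s)) - emb M p g)"
    using eventually_division_filter_tagged_division[of "cbox a b"]
  proof eventually_elim
    case (elim D)
    have Fz: "F s \<in> Lp M p" if "(s, k) \<in> D" for s k
      using that tag_in_interval[OF elim] F by fastforce
    have *: "(\<lambda>x. \<Sum>(s, k)\<in>Q. measure lborel k * F s x) \<in> Lp M p \<and>
        emb M p (\<lambda>x. \<Sum>(s, k)\<in>Q. measure lborel k * F s x) = (\<Sum>(s, k)\<in>Q. measure lborel k *\<^sub>R emb M p (F s))"
      if "finite Q" "Q \<subseteq> D" for Q
      using that
    proof (induction Q)
      case empty
      have "emb M p (\<lambda>x. 0) = 0" using emb_scale[OF p Lp_zero[OF p], of M 0] by simp
      then show ?case using Lp_zero[OF p] by simp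
    next
      case (insert z Q)
      obtain s k where z: "z = (s, k)" by (metis surj_pair)
      have Fs: "F s \<in> Lp M p" using Fz insert z by blast
      have IH: "(\<lambda>x. \<Sum>(s, k)\<in>Q. measure lborel k * F s x) \<in> Lp M p"
        "emb M p (\<lambda>x. \<Sum>(s, k)\<in>Q. measure lborel k * F s x) = (\<Sum>(s, k)\<in>Q. measure lborel k *\<^sub>R emb M p (F s))"
        using insert by auto
      show ?case
        using Lp_add[OF p Lp_scale[OF p Fs, of "measure lborel k"] IH(1)] emb_add[OF p Lp_scale[OF p Fs, of "measure lborel k"] IH(1)]
          emb_scale[OF p Fs, of "measure lborel k"] IH(2) insert(1,2) by (simp add: z)
    qed
    have D: "(\<lambda>x. \<Sum>(s, k)\<in>D. measure lborel k * F s x) \<in> Lp M p"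
      "emb M p (\<lambda>x. \<Sum>(s, k)\<in>D. measure lborel k * F s x) = (\<Sum>(s, k)\<in>D. measure lborel k *\<^sub>R emb M p (F s))"
      using *[of D] elim by auto
    show ?case unfolding Lp_norm_diff[OF p D(1) g] D(2) ..
  qed
  then have "((\<lambda>D. Lp_norm M p (\<lambda>x. (\<Sum>(s, k)\<in>D. measure lborel k * F s x) - g x)) \<longlongrightarrow> 0) (division_filter (cbox a b)) \<longleftrightarrow>
     ((\<lambda>D. norm ((\<Sum>(s, k)\<in>D. measure lborel k *\<^sub>R emb M p (F s)) - emb M p g)) \<longlongrightarrow> 0) (division_filter (cbox a b))"
    by (rule tendsto_cong)
  also have "\<dots> \<longleftrightarrow> ((\<lambda>D. \<Sum>(s, k)\<in>D. measure lborel k *\<^sub>R emb M p (F s)) \<longlongrightarrow> emb M p g) (division_filter (cbox a b))"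
    by (simp only: tendsto_norm_zero_iff LIM_zero_iff)
  also have "\<dots> \<longleftrightarrow> ((\<lambda>s. emb M p (F s)) has_integral emb M p g) {a..b}"
    by (metis has_integral_cbox box_real(2))
  finally show ?thesis using g by (simp add: has_Lp_integral_def)
qed (simp add: has_Lp_integral_def)

lemma Lp_integral_emb:
  assumes p: "1 \<le> p" "p < \<infinity>" and F: "\<And>s. s \<in> {a..b} \<Longrightarrow> F s \<in> Lp M p"
    and int: "((\<lambda>s. emb M p (F s)) has_integral i) {a..b}"
  shows "Lp_integral M p a b F \<in> Lp M p" "emb M p (Lp_integral M p a b F) = i"
proof -
  have "i \<in> emb M p ` Lp M p"
    by (rule has_integral_in_closed_cone[OF closed_emb[OF p] subspace_0[OF subspace_emb[OF p]]
      subspace_add[OF subspace_emb[OF p]] subspace_scale[OF subspace_emb[OF p]] int]) (use F in auto)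
  then obtain g where "g \<in> Lp M p" "i = emb M p g" by auto
  moreover have iff: "has_Lp_integral M p F g a b \<longleftrightarrow> g \<in> Lp M p \<and> ((\<lambda>s. emb M p (F s)) has_integral emb M p g) {a..b}" for g
    by (rule has_Lp_integral_iff[OF p]) (rule F)
  ultimately have "\<exists>g. has_Lp_integral M p F g a b" using int by blast
  then have "has_Lp_integral M p F (Lp_integral M p a b F) a b"
    unfolding Lp_integral_def by (rule someI_ex)
  then show "Lp_integral M p a b F \<in> Lp M p" "emb M p (Lp_integral M p a b F) = i"
    using iff has_integral_unique[OF int] by blast+
qed

locale two_semigroups =
  S: acting_semigroup_L2 M S p Kp wp K2 w2 + T: acting_semigroup_L2 M T q K \<omega> K3 w3
  for M :: "'a measure" and S T p q Kp wp K2 w2 K \<omega> K3 w3 +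
  fixes p' :: ennreal and f :: "'a \<Rightarrow> real"
  assumes conj: "1 / p + 1 / p' = 1" and f: "f \<in> Lp M p" and f_nonneg: "AE x in M. 0 \<le> f x"
begin

text \<open>This and the next two definitions repeat the conditions (a), (b) and (c) in the exact
  form of the theorem, so that unfolding them closes its proof.\<close>

definition semigroup_bound :: bool where
  "semigroup_bound \<longleftrightarrow> (\<exists>C\<ge>0. \<forall>t\<ge>0. \<forall>u\<in>Lp M 2 \<inter> Lp M q. (AE x in M. 0 \<le> u x) \<longrightarrow>
     (AE x in M. T t u x \<le> S t u x +
        C * Lp_integral M p 0 t
              (\<lambda>s y. exp (\<omega> * (t - s)) * Lp_norm M q u * Lp_extension M p S s f y) x))"

definition generator_bound :: bool where
  "generator_bound \<longleftrightarrow> (\<exists>C\<ge>0. \<forall>(u, ATu)\<in>generator M 2 T. \<forall>(v, ASv)\<in>weak_star_generator M S.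
     u \<in> Lp M q \<longrightarrow> (AE x in M. 0 \<le> u x) \<longrightarrow>
     v \<in> Lp M p' \<longrightarrow> (AE x in M. 0 \<le> v x) \<longrightarrow>
     pairing M ATu v \<le> pairing M u ASv + C * Lp_norm M q u * pairing M f v)"

definition resolvent_bound :: bool where
  "resolvent_bound \<longleftrightarrow> (\<exists>C\<ge>0. \<forall>\<^sub>F l in at_top. \<forall>u\<in>Lp M 2 \<inter> Lp M q. (AE x in M. 0 \<le> u x) \<longrightarrow>
     (AE x in M. resolvent M (generator M 2 T) l u x \<le>
        resolvent M (generator M 2 S) l u x +
        C / (l - \<omega>) * Lp_norm M q u *
          resolvent M (generator M p (Lp_extension M p S)) l f x))"

text \<open>The integral of (a) without the factor \<open>exp (\<omega> * t)\<close> and the norm of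
  \<open>u\<close>. It does not depend on \<open>u\<close> and is the orbit integral of the
  semigroup rescaled by \<open>\<omega>\<close>, so its derivative at 0 is available.\<close>

definition scaled_orbit_integral :: "real \<Rightarrow> 'a lp_rep" where
  "scaled_orbit_integral t = integral {0..t} (\<lambda>s. exp (- (\<omega> * s)) *\<^sub>R S.Up s (emb M p f))"

lemma fV: "emb M p f \<in> emb M p ` Lp M p"
  using f by simp

lemma scaled_orbit_has_integral:
  "((\<lambda>s. exp (- (\<omega> * s)) *\<^sub>R S.Up s (emb M p f)) has_integral scaled_orbit_integral t) {0..t}"
  unfolding scaled_orbit_integral_def
  by (rule integrable_integral[OF c0_semigroup.orbit_integrable[OF S.ext.rescaled fV order_refl]])

lemma scaled_orbit_integral_in: "scaled_orbit_integral t \<in> emb M p ` Lp M p"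
proof -
  interpret R: c0_semigroup "emb M p ` Lp M p" "\<lambda>t x. exp (- (\<omega> * t)) *\<^sub>R S.Up t x" Kp "wp - \<omega>"
    by (rule S.ext.rescaled)
  show ?thesis
    using R.orbit_integral_in[OF fV, of t] by (simp add: R.orbit_integral_def scaled_orbit_integral_def)
qed

lemma scaled_orbit_integral_derivative:
  "((\<lambda>t. (1 / t) *\<^sub>R scaled_orbit_integral t) \<longlongrightarrow> emb M p f) (at_right 0)"
proof -
  interpret R: c0_semigroup "emb M p ` Lp M p" "\<lambda>t x. exp (- (\<omega> * t)) *\<^sub>R S.Up t x" Kp "wp - \<omega>"
    by (rule S.ext.rescaled)
  have eq: "R.orbit_integral (emb M p f) = scaled_orbit_integral"
    by (rule ext) (simp add: R.orbit_integral_def scaled_orbit_integral_def)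
  have "scaled_orbit_integral 0 = 0" by (simp add: scaled_orbit_integral_def)
  then show ?thesis
    using R.orbit_integral_derivative[OF fV order_refl] unfolding eq by (simp add: S.ext.U_0[OF fV])
qed

lemma Lp_integral_scaled_orbit:
  fixes N t :: real
  defines "g \<equiv> Lp_integral M p 0 t (\<lambda>s y. exp (\<omega> * (t - s)) * N * Lp_extension M p S s f y)"
  shows "g \<in> Lp M p" "emb M p g = (N * exp (\<omega> * t)) *\<^sub>R scaled_orbit_integral t"
proof -
  have L: "Lp_extension M p S s f \<in> Lp M p" if "s \<in> {0..t}" for s
    using that by (intro C0_semigroup_in[OF S.extension(1) _ f]) auto
  have F: "(\<lambda>y. exp (\<omega> * (t - s)) * N * Lp_extension M p S s f y) \<in> Lp M p" if "s \<in> {0..t}" for s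
    by (rule Lp_scale[OF S.p L[OF that]])
  have "((\<lambda>s. (N * exp (\<omega> * t)) *\<^sub>R (exp (- (\<omega> * s)) *\<^sub>R S.Up s (emb M p f))) has_integral
     (N * exp (\<omega> * t)) *\<^sub>R scaled_orbit_integral t) {0..t}"
    by (intro has_integral_cmul scaled_orbit_has_integral)
  moreover have "emb M p (\<lambda>y. exp (\<omega> * (t - s)) * N * Lp_extension M p S s f y) =
     (N * exp (\<omega> * t)) *\<^sub>R (exp (- (\<omega> * s)) *\<^sub>R S.Up s (emb M p f))" if "s \<in> {0..t}" for s
  proof -
    have "exp (\<omega> * (t - s)) = exp (\<omega> * t) * exp (- (\<omega> * s))" by (simp add: exp_add[symmetric] algebra_simps)
    moreover have "0 \<le> s" using that by simp
    ultimately show ?thesis unfolding emb_scale[OF S.p L[OF that]] by (simp add: S.liftp[OF _ f] mult_ac)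
  qed
  ultimately have "((\<lambda>s. emb M p (\<lambda>y. exp (\<omega> * (t - s)) * N * Lp_extension M p S s f y)) has_integral
     (N * exp (\<omega> * t)) *\<^sub>R scaled_orbit_integral t) {0..t}"
    by (subst has_integral_cong) auto
  from Lp_integral_emb[OF S.p F this] show "g \<in> Lp M p" "emb M p g = (N * exp (\<omega> * t)) *\<^sub>R scaled_orbit_integral t"
    by (auto simp: g_def)
qed

section \<open>Inequalities tested by pairings\<close>

lemma functionals:
  assumes "v \<in> Lp M 2" "v \<in> Lp M p'"
  obtains \<phi> \<psi> where "bounded_linear \<phi>" "\<And>u. u \<in> Lp M 2 \<Longrightarrow> \<phi> (emb M 2 u) = pairing M u v"
    "bounded_linear \<psi>" "\<And>u. u \<in> Lp M p \<Longrightarrow> \<psi> (emb M p u) = pairing M u v"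
  using pairing_functional[OF two_ge_1 conjugate_exponent_2 assms(1)] pairing_functional[OF S.p conj assms(2)] by blast

lemma pairing_mono:
  assumes le: "AE x in M. a x \<le> b x + c * g x" and v: "v \<in> Lp M 2" "v \<in> Lp M p'" "AE x in M. 0 \<le> v x"
    and L: "a \<in> Lp M 2" "b \<in> Lp M 2" "g \<in> Lp M p"
  shows "pairing M a v \<le> pairing M b v + c * pairing M g v"
proof -
  have i: "integrable M (\<lambda>x. a x * v x)" "integrable M (\<lambda>x. b x * v x)" "integrable M (\<lambda>x. g x * v x)"
    by (rule Holder_inequality(1)[OF two_ge_1 conjugate_exponent_2 L(1) v(1)],
        rule Holder_inequality(1)[OF two_ge_1 conjugate_exponent_2 L(2) v(1)],
        rule Holder_inequality(1)[OF S.p conj L(3) v(2)])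
  have "(\<integral>x. a x * v x \<partial>M) \<le> (\<integral>x. b x * v x + c * (g x * v x) \<partial>M)"
  proof (rule integral_mono_AE)
    show "AE x in M. a x * v x \<le> b x * v x + c * (g x * v x)"
      using le v(3)
    proof eventually_elim
      case (elim x)
      then have "a x * v x \<le> (b x + c * g x) * v x" by (rule mult_right_mono)
      then show ?case by (simp add: algebra_simps)
    qed
  qed (use i in auto)
  then show ?thesis using i by (simp add: pairing_def)
qed

lemma AE_le_test:
  assumes L: "a \<in> Lp M 2" "b \<in> Lp M 2" "g \<in> Lp M p"
    and test: "\<And>v. v \<in> Lp M 2 \<Longrightarrow> v \<in> Lp M p' \<Longrightarrow> (AE x in M. 0 \<le> v x) \<Longrightarrow> pairing M a v \<le> pairing M b v + c * pairing M g v"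
  shows "AE x in M. a x \<le> b x + c * g x"
proof -
  have "AE x in M. (a x - b x) + (- c) * g x \<le> 0"
  proof (rule AE_nonpos_test[OF two_ge_1 S.p Lp_diff[OF two_ge_1 L(1,2)] Lp_scale[OF S.p L(3)]])
    fix A assume A: "A \<in> sets M" "emeasure M A < \<infinity>"
    let ?v = "indicator A :: 'a \<Rightarrow> real"
    have v: "?v \<in> Lp M 2" "?v \<in> Lp M p'"
      by (intro indicator_Lp A two_ge_1 conjugate_exponent_ge_1[OF S.p conj])+
    have le: "pairing M a ?v \<le> pairing M b ?v + c * pairing M g ?v" by (rule test[OF v]) auto
    have i: "integrable M (\<lambda>x. a x * ?v x)" "integrable M (\<lambda>x. b x * ?v x)"
      by (rule Holder_inequality(1)[OF two_ge_1 conjugate_exponent_2 L(1) v(1)],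
          rule Holder_inequality(1)[OF two_ge_1 conjugate_exponent_2 L(2) v(1)])
    have "(\<integral>x. (a x - b x) * ?v x \<partial>M) = pairing M a ?v - pairing M b ?v"
      using i by (simp add: pairing_def left_diff_distrib)
    moreover have "(\<integral>x. (- c) * g x * ?v x \<partial>M) = (- c) * pairing M g ?v"
      unfolding pairing_def mult.assoc by (rule integral_mult_right_zero)
    ultimately show "(\<integral>x. (a x - b x) * ?v x \<partial>M) + (\<integral>x. (- c) * g x * ?v x \<partial>M) \<le> 0" using le by simp
  qed
  then show ?thesis by eventually_elim simp
qed

section \<open>The implications between the three conditions\<close>

lemma semigroup_imp_generator: "semigroup_bound \<Longrightarrow> generator_bound"
proof -
  assume semigroup_bound
  then obtain C where C: "0 \<le> C" and a: "\<And>t u. 0 \<le> t \<Longrightarrow> u \<in> Lp M 2 \<inter> Lp M q \<Longrightarrow> (AE x in M. 0 \<le> u x) \<Longrightarrow>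
     (AE x in M. T t u x \<le> S t u x +
        C * Lp_integral M p 0 t (\<lambda>s y. exp (\<omega> * (t - s)) * Lp_norm M q u * Lp_extension M p S s f y) x)"
    unfolding semigroup_bound_def by blast
  have "pairing M y v \<le> pairing M u z + C * Lp_norm M q u * pairing M f v"
    if g: "(u, y) \<in> generator M 2 T" "(v, z) \<in> weak_star_generator M S" and u: "u \<in> Lp M q" "AE x in M. 0 \<le> u x"
      and v: "v \<in> Lp M p'" "AE x in M. 0 \<le> v x" for u y v z
  proof -
    have L: "u \<in> Lp M 2" "y \<in> Lp M 2" "v \<in> Lp M 2" using g by (auto simp: generator_def weak_star_generator_def)
    obtain \<phi> \<psi> where \<phi>: "bounded_linear \<phi>" "\<And>u. u \<in> Lp M 2 \<Longrightarrow> \<phi> (emb M 2 u) = pairing M u v"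
      and \<psi>: "bounded_linear \<psi>" "\<And>u. u \<in> Lp M p \<Longrightarrow> \<psi> (emb M p u) = pairing M u v"
      using functionals[OF L(3) v(1)] by metis
    interpret \<phi>: bounded_linear \<phi> by (rule \<phi>(1))
    interpret \<psi>: bounded_linear \<psi> by (rule \<psi>(1))
    define N where "N = Lp_norm M q u"
    have "T.base.gen (emb M 2 u) (emb M 2 y)" using T.base_gen[OF L(1,2)] g(1) by simp
    then have lim1: "((\<lambda>t. \<phi> ((1 / t) *\<^sub>R (T.U2 t (emb M 2 u) - emb M 2 u))) \<longlongrightarrow> \<phi> (emb M 2 y)) (at_right 0)"
      by (intro \<phi>.tendsto) (simp add: T.base.gen_def)
    \<comment> \<open>For \<open>S\<close> the quotient converges only after pairing with
      \<open>v\<close>: it is \<open>v\<close>, not \<open>u\<close>, that belongs to the domain of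
      the dual generator.\<close>
    have lim2: "((\<lambda>t. (1 / t) * (dual_operator (S t) (\<lambda>h. pairing M h v) u - pairing M u v)) \<longlongrightarrow> pairing M u z) (at_right 0)"
      using g(2) L(1) by (simp add: weak_star_generator_def)
    have "((\<lambda>t. exp (\<omega> * t)) \<longlongrightarrow> exp (\<omega> * 0)) (at_right 0)"
      by (intro tendsto_intros)
    then have lim3: "((\<lambda>t. C * N * exp (\<omega> * t) * \<psi> ((1 / t) *\<^sub>R scaled_orbit_integral t)) \<longlongrightarrow> C * N * exp (\<omega> * 0) * \<psi> (emb M p f)) (at_right 0)"
      by (intro tendsto_mult tendsto_const \<psi>.tendsto scaled_orbit_integral_derivative)
    have "\<forall>\<^sub>F t in at_right 0. \<phi> ((1 / t) *\<^sub>R (T.U2 t (emb M 2 u) - emb M 2 u)) \<le>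
        (1 / t) * (dual_operator (S t) (\<lambda>h. pairing M h v) u - pairing M u v) +
        C * N * exp (\<omega> * t) * \<psi> ((1 / t) *\<^sub>R scaled_orbit_integral t)"
      using eventually_nonneg_at_right
    proof eventually_elim
      case (elim t)
      note I = Lp_integral_scaled_orbit[of t N]
      let ?g = "Lp_integral M p 0 t (\<lambda>s y. exp (\<omega> * (t - s)) * N * Lp_extension M p S s f y)"
      have "AE x in M. T t u x \<le> S t u x + C * ?g x"
        unfolding N_def by (rule a[OF elim]) (use L u in auto)
      then have "pairing M (T t u) v \<le> pairing M (S t u) v + C * pairing M ?g v"
        by (rule pairing_mono[OF _ L(3) v C0_semigroup_in[OF T.S elim L(1)] C0_semigroup_in[OF S.S elim L(1)] I(1)])
      also have "pairing M ?g v = N * exp (\<omega> * t) * \<psi> (scaled_orbit_integral t)"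
        unfolding \<psi>(2)[OF I(1), symmetric] I(2) by (simp add: \<psi>.scaleR)
      finally have "(1 / t) * (pairing M (T t u) v - pairing M u v) \<le>
         (1 / t) * (pairing M (S t u) v - pairing M u v + C * (N * exp (\<omega> * t) * \<psi> (scaled_orbit_integral t)))"
        using elim by (intro mult_left_mono) auto
      then show ?case
        using C0_semigroup_in[OF T.S elim L(1)] L(1)
        by (simp add: \<phi>.scaleR \<phi>.diff \<phi>(2) T.lift2[OF elim L(1)] dual_operator_def \<psi>.scaleR distrib_left mult_ac)
    qed
    then have "\<phi> (emb M 2 y) \<le> pairing M u z + C * N * exp (\<omega> * 0) * \<psi> (emb M p f)"
      by (rule tendsto_le[OF trivial_limit_at_right_real tendsto_add[OF lim2 lim3] lim1])
    then show ?thesis by (simp add: \<phi>(2)[OF L(2)] \<psi>(2)[OF f] N_def)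
  qed
  then show generator_bound
    unfolding generator_bound_def using C by (intro exI[of _ C]) auto
qed

lemma generator_imp_resolvent: "generator_bound \<Longrightarrow> resolvent_bound"
proof -
  assume generator_bound
  then obtain C where C: "0 \<le> C" and b: "\<And>u y v z. (u, y) \<in> generator M 2 T \<Longrightarrow> (v, z) \<in> weak_star_generator M S \<Longrightarrow>
     u \<in> Lp M q \<Longrightarrow> (AE x in M. 0 \<le> u x) \<Longrightarrow> v \<in> Lp M p' \<Longrightarrow> (AE x in M. 0 \<le> v x) \<Longrightarrow>
     pairing M y v \<le> pairing M u z + C * Lp_norm M q u * pairing M f v"
    unfolding generator_bound_def by blast
  have "AE x in M. T.R2 l u x \<le> S.R2 l u x + (C * K) / (l - \<omega>) * Lp_norm M q u * S.Rp l f x"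
    if l: "w2 < l" "wp < l" "w3 < l" "\<omega> < l" and u: "u \<in> T.I" "AE x in M. 0 \<le> u x" for l u
  proof -
    have u2: "u \<in> Lp M 2" using u by simp
    note r = T.R2[OF l(3) u2] and s = S.R2[OF l(1) u2] and rf = S.Rp[OF l(2) f]
    note rq = T.R2_Lp[OF l(3,4) u(1)]
    show ?thesis
    proof (rule AE_le_test[OF r(1) s(1) rf(1)])
      fix v assume v: "v \<in> Lp M 2" "v \<in> Lp M p'" "AE x in M. 0 \<le> v x"
      obtain \<phi> \<psi> where \<phi>: "bounded_linear \<phi>" "\<And>u. u \<in> Lp M 2 \<Longrightarrow> \<phi> (emb M 2 u) = pairing M u v"
        and \<psi>: "bounded_linear \<psi>" "\<And>u. u \<in> Lp M p \<Longrightarrow> \<psi> (emb M p u) = pairing M u v"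
        using functionals[OF v(1,2)] by metis
      interpret \<phi>: bounded_linear \<phi> by (rule \<phi>(1))
      \<comment> \<open>At time 0 the construction gives the adjoint of the resolvent alone.\<close>
      obtain v' z where wsg: "(v', z) \<in> weak_star_generator M S" and v': "v' \<in> Lp M p'" "AE x in M. 0 \<le> v' x"
        and pv: "\<And>u. u \<in> Lp M 2 \<Longrightarrow> pairing M u v' = \<phi> (S.U2 0 (S.base.resolv l (emb M 2 u)))"
        and pz: "\<And>u. u \<in> Lp M 2 \<Longrightarrow> pairing M u z = \<phi> (S.U2 0 (l *\<^sub>R S.base.resolv l (emb M 2 u) - emb M 2 u))"
        and pf: "\<And>f. f \<in> Lp M p \<Longrightarrow> pairing M f v' = \<psi> (S.ext.resolv l (S.Up 0 (emb M p f)))"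
        using S.dual_resolvent_element[OF conj l(1,2) order_refl v \<phi> \<psi>] by metis
      have V: "emb M 2 h \<in> emb M 2 ` Lp M 2" if "h \<in> Lp M 2" for h using that by simp
      have pv': "pairing M h v' = \<phi> (S.base.resolv l (emb M 2 h))" if "h \<in> Lp M 2" for h
        unfolding pv[OF that] by (simp add: S.base.U_0[OF S.base.resolv_in[OF l(1) V[OF that]]])
      have pz': "pairing M h z = l * pairing M h v' - pairing M h v" if "h \<in> Lp M 2" for h
        unfolding pz[OF that] pv'[OF that] using V[OF that] S.base.resolv_in[OF l(1) V[OF that]]
        by (simp add: S.base.U_0 S.base.V_diff S.base.V_scale \<phi>.diff \<phi>.scaleR \<phi>(2)[OF that])
      have pf': "pairing M f v' = pairing M (S.Rp l f) v"
        unfolding pf[OF f] by (simp add: S.ext.U_0[OF fV] rf(2)[symmetric] \<psi>(2)[OF rf(1)])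
      \<comment> \<open>In (b) both sides contain \<open>l\<close> times the pairing of
        \<open>T.R2 l u\<close> with \<open>v'\<close>. These terms cancel, and what remains is the
        pairing of the two resolvents of \<open>u\<close> with \<open>v\<close>.\<close>
      have "pairing M (\<lambda>x. l * T.R2 l u x - u x) v' \<le> pairing M (T.R2 l u) z + C * Lp_norm M q (T.R2 l u) * pairing M f v'"
        by (rule b[OF r(3) wsg rq(1) T.R2_nonneg[OF l(3) u2 u(2)] v'])
      moreover have "pairing M (\<lambda>x. l * T.R2 l u x - u x) v' = l * pairing M (T.R2 l u) v' - pairing M (S.R2 l u) v"
      proof -
        have "emb M 2 (\<lambda>x. l * T.R2 l u x - u x) = l *\<^sub>R emb M 2 (T.R2 l u) - emb M 2 u"
          by (simp add: emb_diff[OF two_ge_1 Lp_scale[OF two_ge_1 r(1)] u2] emb_scale[OF two_ge_1 r(1)])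
        then show ?thesis
          unfolding pv'[OF Lp_diff[OF two_ge_1 Lp_scale[OF two_ge_1 r(1)] u2]] pv'[OF r(1)]
          using V[OF r(1)] V[OF u2]
          by (simp add: S.base.resolv_diff[OF l(1)] S.base.resolv_scale[OF l(1)] S.base.V_scale \<phi>.diff \<phi>.scaleR
              s(2)[symmetric] \<phi>(2)[OF s(1)])
      qed
      ultimately have "pairing M (T.R2 l u) v \<le> pairing M (S.R2 l u) v + C * Lp_norm M q (T.R2 l u) * pairing M f v'"
        using pz'[OF r(1)] by simp
      also have "C * Lp_norm M q (T.R2 l u) * pairing M f v' \<le> C * (K / (l - \<omega>) * Lp_norm M q u) * pairing M f v'"
      proof (intro mult_right_mono mult_left_mono rq(3) C)
        have "AE x in M. 0 \<le> f x * v' x" using f_nonneg v'(2) by eventually_elim simp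
        then show "0 \<le> pairing M f v'" unfolding pairing_def by (rule integral_nonneg_AE)
      qed
      finally show "pairing M (T.R2 l u) v \<le> pairing M (S.R2 l u) v + (C * K) / (l - \<omega>) * Lp_norm M q u * pairing M (S.Rp l f) v"
        by (simp add: pf')
    qed
  qed
  moreover have "\<forall>\<^sub>F l in at_top. w2 < l \<and> wp < l \<and> w3 < l \<and> \<omega> < l"
    by (intro eventually_conj eventually_gt_at_top)
  ultimately have "\<forall>\<^sub>F l in at_top. \<forall>u\<in>T.I. (AE x in M. 0 \<le> u x) \<longrightarrow>
     (AE x in M. T.R2 l u x \<le> S.R2 l u x + (C * K) / (l - \<omega>) * Lp_norm M q u * S.Rp l f x)"
    by (elim eventually_mono) blast
  moreover have "0 \<le> C * K" using C T.Kp by simp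
  ultimately show resolvent_bound unfolding resolvent_bound_def by blast
qed

lemma resolvent_imp_generator: "resolvent_bound \<Longrightarrow> generator_bound"
proof -
  assume resolvent_bound
  then obtain C where C: "0 \<le> C" and c: "\<forall>\<^sub>F l in at_top. \<forall>u\<in>T.I. (AE x in M. 0 \<le> u x) \<longrightarrow>
     (AE x in M. T.R2 l u x \<le> S.R2 l u x + C / (l - \<omega>) * Lp_norm M q u * S.Rp l f x)"
    unfolding resolvent_bound_def by blast
  have "pairing M y v \<le> pairing M u z + C * Lp_norm M q u * pairing M f v"
    if g: "(u, y) \<in> generator M 2 T" "(v, z) \<in> weak_star_generator M S" and u: "u \<in> Lp M q" "AE x in M. 0 \<le> u x"
      and v: "v \<in> Lp M p'" "AE x in M. 0 \<le> v x" for u y v z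
  proof -
    have L: "u \<in> Lp M 2" "y \<in> Lp M 2" "v \<in> Lp M 2" "z \<in> Lp M 2" using g by (auto simp: generator_def weak_star_generator_def)
    have uI: "u \<in> T.I" using u L by simp
    obtain \<phi> \<psi> where \<phi>: "bounded_linear \<phi>" "\<And>u. u \<in> Lp M 2 \<Longrightarrow> \<phi> (emb M 2 u) = pairing M u v"
      and \<psi>: "bounded_linear \<psi>" "\<And>u. u \<in> Lp M p \<Longrightarrow> \<psi> (emb M p u) = pairing M u v"
      using functionals[OF L(3) v(1)] by metis
    obtain \<theta> where \<theta>: "bounded_linear \<theta>" "\<And>u. u \<in> Lp M 2 \<Longrightarrow> \<theta> (emb M 2 u) = pairing M u z"
      using pairing_functional[OF two_ge_1 conjugate_exponent_2 L(4)] by blast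
    interpret \<phi>: bounded_linear \<phi> by (rule \<phi>(1))
    interpret \<psi>: bounded_linear \<psi> by (rule \<psi>(1))
    interpret \<theta>: bounded_linear \<theta> by (rule \<theta>(1))
    define N where "N = Lp_norm M q u"
    have gT: "T.base.gen (emb M 2 u) (emb M 2 y)" using T.base_gen[OF L(1,2)] g(1) by simp
    have uV: "emb M 2 u \<in> emb M 2 ` Lp M 2" using L by simp
    have lim1: "((\<lambda>l. \<phi> (l *\<^sub>R (l *\<^sub>R T.base.resolv l (emb M 2 u) - emb M 2 u))) \<longlongrightarrow> \<phi> (emb M 2 y)) at_top"
      by (intro \<phi>.tendsto T.base.resolv_approx_gen gT)
    have lim2: "((\<lambda>l. \<theta> (l *\<^sub>R S.base.resolv l (emb M 2 u))) \<longlongrightarrow> \<theta> (emb M 2 u)) at_top"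
      by (intro \<theta>.tendsto S.base.resolv_approx uV)
    have "((\<lambda>l. l / (l - \<omega>)) \<longlongrightarrow> 1) at_top" by real_asymp
    then have lim3: "((\<lambda>l. C * N * (l / (l - \<omega>)) * \<psi> (l *\<^sub>R S.ext.resolv l (emb M p f))) \<longlongrightarrow> C * N * 1 * \<psi> (emb M p f)) at_top"
      by (intro tendsto_mult tendsto_const \<psi>.tendsto S.ext.resolv_approx fV)
    have "\<forall>\<^sub>F l in at_top. w2 < l \<and> wp < l \<and> w3 < l \<and> \<omega> < l \<and> 0 < l"
      by (intro eventually_conj eventually_gt_at_top)
    then have "\<forall>\<^sub>F l in at_top. \<phi> (l *\<^sub>R (l *\<^sub>R T.base.resolv l (emb M 2 u) - emb M 2 u)) \<le>
      \<theta> (l *\<^sub>R S.base.resolv l (emb M 2 u)) + C * N * (l / (l - \<omega>)) * \<psi> (l *\<^sub>R S.ext.resolv l (emb M p f))"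
      using c
    proof eventually_elim
      case (elim l)
      then have l: "w2 < l" "wp < l" "w3 < l" "\<omega> < l" "0 < l" by auto
      note r = T.R2[OF l(3) L(1)] and s = S.R2[OF l(1) L(1)] and rf = S.Rp[OF l(2) f]
      have "AE x in M. T.R2 l u x \<le> S.R2 l u x + (C / (l - \<omega>) * N) * S.Rp l f x"
        using elim(2) uI u(2) unfolding N_def by blast
      then have le: "pairing M (T.R2 l u) v \<le> pairing M (S.R2 l u) v + (C / (l - \<omega>) * N) * pairing M (S.Rp l f) v"
        by (rule pairing_mono[OF _ L(3) v r(1) s(1) rf(1)])
      \<comment> \<open>The generator of \<open>S\<close> at the resolvent is moved to
        \<open>v\<close>, because the quotient on the side of \<open>S\<close> has no limit in norm
        when \<open>u\<close> is outside the domain.\<close>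
      have "pairing M (\<lambda>x. l * S.R2 l u x - u x) v = pairing M (S.R2 l u) z"
        by (rule S.generator_weak_star_dual[OF s(3) g(2)])
      moreover have "pairing M (\<lambda>x. l * S.R2 l u x - u x) v = l * pairing M (S.R2 l u) v - pairing M u v"
        using \<phi>(2)[OF Lp_diff[OF two_ge_1 Lp_scale[OF two_ge_1 s(1)] L(1)], of l]
        by (simp add: emb_diff[OF two_ge_1 Lp_scale[OF two_ge_1 s(1)] L(1)] emb_scale[OF two_ge_1 s(1)] \<phi>.diff \<phi>.scaleR \<phi>(2) s(1) L(1))
      ultimately have sz: "l * pairing M (S.R2 l u) v - pairing M u v = pairing M (S.R2 l u) z" by simp
      \<comment> \<open>The resolvent inequality is multiplied by \<open>l\<close>, the pairing of
        \<open>u\<close> with \<open>v\<close> is subtracted, and another factor \<open>l\<close>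
        turns the left side into an approximation of the generator of \<open>T\<close>. The last
        term then carries \<open>l / (l - \<omega>)\<close>, which tends to 1.\<close>
      have "l * (l * pairing M (T.R2 l u) v - pairing M u v) \<le>
         l * (l * (pairing M (S.R2 l u) v + (C / (l - \<omega>) * N) * pairing M (S.Rp l f) v) - pairing M u v)"
        using le l by (intro mult_left_mono diff_right_mono) auto
      also have "\<dots> = l * pairing M (S.R2 l u) z + C * N * (l / (l - \<omega>)) * (l * pairing M (S.Rp l f) v)"
        unfolding sz[symmetric] by (simp add: algebra_simps)
      finally show ?case
        by (simp add: r(2)[symmetric] s(2)[symmetric] rf(2)[symmetric] \<phi>.diff \<phi>.scaleR \<psi>.scaleR \<theta>.scaleR
            \<phi>(2)[OF r(1)] \<phi>(2)[OF L(1)] \<theta>(2)[OF s(1)] \<psi>(2)[OF rf(1)])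
    qed
    then have "\<phi> (emb M 2 y) \<le> \<theta> (emb M 2 u) + C * N * 1 * \<psi> (emb M p f)"
      by (rule tendsto_le[OF trivial_limit_at_top_linorder tendsto_add[OF lim2 lim3] lim1])
    then show ?thesis by (simp add: \<phi>(2)[OF L(2)] \<theta>(2)[OF L(1)] \<psi>(2)[OF f] N_def)
  qed
  then show generator_bound
    unfolding generator_bound_def using C by (intro exI[of _ C]) auto
qed

text \<open>
  The resolvent of \<open>A\<^sub>S\<close>, removed at the end by \<open>l \<rightarrow> \<infinity>\<close>, makes the factor \<open>S(s)\<close> differentiable.
\<close>

lemma generator_bound_orbit:
  assumes C: "0 \<le> C" and b: "\<And>u y v z. (u, y) \<in> generator M 2 T \<Longrightarrow> (v, z) \<in> weak_star_generator M S \<Longrightarrow>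
     u \<in> Lp M q \<Longrightarrow> (AE x in M. 0 \<le> u x) \<Longrightarrow> v \<in> Lp M p' \<Longrightarrow> (AE x in M. 0 \<le> v x) \<Longrightarrow>
     pairing M y v \<le> pairing M u z + C * Lp_norm M q u * pairing M f v"
    and t: "0 \<le> t" and g: "(u, y) \<in> generator M 2 T" and u: "u \<in> Lp M q" "AE x in M. 0 \<le> u x"
    and v: "v \<in> Lp M 2" "v \<in> Lp M p'" "AE x in M. 0 \<le> v x"
    and \<phi>: "bounded_linear \<phi>" "\<And>u. u \<in> Lp M 2 \<Longrightarrow> \<phi> (emb M 2 u) = pairing M u v"
    and \<psi>: "bounded_linear \<psi>" "\<And>u. u \<in> Lp M p \<Longrightarrow> \<psi> (emb M p u) = pairing M u v"
  shows "\<phi> (T.U2 t (emb M 2 u)) \<le> \<phi> (S.U2 t (emb M 2 u)) +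
    C * K * Lp_norm M q u * exp (\<omega> * t) * \<psi> (scaled_orbit_integral t)"
proof -
  interpret \<phi>: bounded_linear \<phi> by (rule \<phi>(1))
  interpret \<psi>: bounded_linear \<psi> by (rule \<psi>(1))
  have L: "u \<in> Lp M 2" "y \<in> Lp M 2" using g by (auto simp: generator_def)
  have uI: "u \<in> T.I" using u L by simp
  have uV: "emb M 2 u \<in> emb M 2 ` Lp M 2" using L by auto
  have gT: "T.base.gen (emb M 2 u) (emb M 2 y)" using T.base_gen[OF L] g by simp
  define N where "N = Lp_norm M q u"
  define c where "c = C * K * N * exp (\<omega> * t)"
  let ?e = "emb M 2 u"
  have main: "\<phi> (S.base.resolv l (T.U2 t ?e)) \<le>
      \<phi> (S.base.resolv l (S.U2 t ?e)) + c * \<psi> (S.ext.resolv l (scaled_orbit_integral t))"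
    if l: "w2 < l" "wp < l" for l
  proof -
    let ?R = "S.base.resolv l"
    \<comment> \<open>A path from the resolvent of \<open>T t u\<close> at \<open>s = 0\<close> to
      that of \<open>S t u\<close> at \<open>s = t\<close>.\<close>
    define G where "G = (\<lambda>s. S.U2 s (?R (T.U2 (t - s) ?e)))"
    define D where "D = (\<lambda>s. S.U2 s (l *\<^sub>R ?R (T.U2 (t - s) ?e) - T.U2 (t - s) ?e) -
      S.U2 s (?R (T.U2 (t - s) (emb M 2 y))))"
    have "(G has_vector_derivative D s) (at s within {0..t})" if "s \<in> {0..t}" for s
      unfolding G_def D_def by (rule mixed_orbit_derivative[OF S.c2 T.c2 l(1) gT that])
    then have "((\<lambda>s. \<phi> (G s)) has_vector_derivative \<phi> (D s)) (at s within {0..t})" if "s \<in> {0..t}" for s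
      using that by (intro \<phi>.has_vector_derivative)
    then have int1: "((\<lambda>s. \<phi> (D s)) has_integral (\<phi> (G t) - \<phi> (G 0))) {0..t}"
      by (intro fundamental_theorem_of_calculus t)
    let ?h = "\<lambda>s. exp (- (\<omega> * s)) *\<^sub>R S.Up s (emb M p f)"
    have hV: "S.Up s (emb M p f) \<in> emb M p ` Lp M p" if "s \<in> {0..t}" for s
      using that by (intro S.ext.U_in fV) auto
    \<comment> \<open>The term with \<open>f\<close> receives the same resolvent. Pulled under the
      integral, it can be compared with the derivative of the path for each
      \<open>s\<close>.\<close>
    have "((\<lambda>s. S.ext.resolv l (?h s)) has_integral S.ext.resolv l (scaled_orbit_integral t)) {0..t}"
    proof (rule has_integral_linear_on_subspace[OF S.ext.closed_V S.ext.subspace_V _ _ _ scaled_orbit_has_integral])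
      show "norm (S.ext.resolv l x) \<le> Kp / (l - wp) * norm x" if "x \<in> emb M p ` Lp M p" for x
        by (rule S.ext.resolv_bound[OF l(2) that])
    qed (simp_all add: S.ext.resolv_add[OF l(2)] S.ext.resolv_scale[OF l(2)] S.ext.V_scale hV)
    from has_integral_linear[OF this \<psi>(1)]
    have "((\<lambda>s. \<psi> (S.ext.resolv l (?h s))) has_integral \<psi> (S.ext.resolv l (scaled_orbit_integral t))) {0..t}"
      by (simp add: o_def)
    then have int2: "((\<lambda>s. (- c) * \<psi> (S.ext.resolv l (?h s))) has_integral (- c) * \<psi> (S.ext.resolv l (scaled_orbit_integral t))) {0..t}"
      by (rule has_integral_mult_right)
    \<comment> \<open>For the test function built at time \<open>s\<close>,
      \<open>\<phi> (D s)\<close> is the pairing of \<open>T (t - s) u\<close> with \<open>z\<close>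
      minus that of \<open>T (t - s) y\<close> with \<open>v'\<close>, exactly the difference that
      (b) bounds from below.\<close>
    have le: "(- c) * \<psi> (S.ext.resolv l (?h s)) \<le> \<phi> (D s)" if s: "s \<in> {0..t}" for s
    proof -
      have s0: "0 \<le> s" and ts: "0 \<le> t - s" using s by auto
      obtain v' z where wsg: "(v', z) \<in> weak_star_generator M S" and v': "v' \<in> Lp M p'" "AE x in M. 0 \<le> v' x"
        and pv: "\<And>u. u \<in> Lp M 2 \<Longrightarrow> pairing M u v' = \<phi> (S.U2 s (?R (emb M 2 u)))"
        and pz: "\<And>u. u \<in> Lp M 2 \<Longrightarrow> pairing M u z = \<phi> (S.U2 s (l *\<^sub>R ?R (emb M 2 u) - emb M 2 u))"
        and pf: "\<And>f. f \<in> Lp M p \<Longrightarrow> pairing M f v' = \<psi> (S.ext.resolv l (S.Up s (emb M p f)))"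
        using S.dual_resolvent_element[OF conj l s0 v \<phi> \<psi>] by metis
      have TL: "T (t - s) u \<in> Lp M 2" "T (t - s) y \<in> Lp M 2" by (rule C0_semigroup_in[OF T.S ts L(1)], rule C0_semigroup_in[OF T.S ts L(2)])
      have "(T (t - s) u, T (t - s) y) \<in> generator M 2 T"
        unfolding T.base_gen[OF TL] T.lift2[OF ts L(1), symmetric] T.lift2[OF ts L(2), symmetric] by (rule T.base.gen_U[OF gT ts])
      moreover have "T (t - s) u \<in> Lp M q" using T.S_I[OF ts uI] by simp
      moreover have "AE x in M. 0 \<le> T (t - s) u x" by (rule positive_semigroupD[OF T.S_pos ts L(1) u(2)])
      ultimately have "pairing M (T (t - s) y) v' \<le> pairing M (T (t - s) u) z + C * Lp_norm M q (T (t - s) u) * pairing M f v'"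
        by (intro b wsg v')
      also have "C * Lp_norm M q (T (t - s) u) * pairing M f v' \<le> C * (K * exp (\<omega> * (t - s)) * N) * pairing M f v'"
      proof (intro mult_right_mono mult_left_mono C)
        show "Lp_norm M q (T (t - s) u) \<le> K * exp (\<omega> * (t - s)) * N" using T.bd[OF ts L(1) u(1)] by (simp add: N_def)
        have "AE x in M. 0 \<le> f x * v' x" using f_nonneg v'(2) by eventually_elim simp
        then show "0 \<le> pairing M f v'" unfolding pairing_def by (rule integral_nonneg_AE)
      qed
      also have "C * (K * exp (\<omega> * (t - s)) * N) * pairing M f v' = c * \<psi> (S.ext.resolv l (?h s))"
      proof -
        have "exp (\<omega> * (t - s)) = exp (\<omega> * t) * exp (- (\<omega> * s))" by (simp add: exp_add[symmetric] algebra_simps)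
        then show ?thesis
          by (simp add: pf[OF f] S.ext.resolv_scale[OF l(2) hV[OF s]] \<psi>.scaleR c_def mult_ac)
      qed
      finally show ?thesis
        by (simp add: D_def \<phi>.diff pv[OF TL(2)] pz[OF TL(1)] T.lift2[OF ts] L)
    qed
    have "(- c) * \<psi> (S.ext.resolv l (scaled_orbit_integral t)) \<le> \<phi> (G t) - \<phi> (G 0)"
      by (rule has_integral_le[OF int2 int1 le])
    moreover have "G t = ?R (S.U2 t ?e)"
      unfolding G_def by (simp add: T.base.U_0[OF uV] S.base.U_resolv[OF l(1) uV t])
    moreover have "G 0 = ?R (T.U2 t ?e)"
      unfolding G_def by (simp add: S.base.U_0 S.base.resolv_in[OF l(1)] T.base.U_in[OF t uV])
    ultimately show ?thesis by simp
  qed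
  have lim1: "((\<lambda>l. \<phi> (l *\<^sub>R S.base.resolv l (T.U2 t ?e))) \<longlongrightarrow> \<phi> (T.U2 t ?e)) at_top"
    by (intro \<phi>.tendsto S.base.resolv_approx T.base.U_in t uV)
  have lim2: "((\<lambda>l. \<phi> (l *\<^sub>R S.base.resolv l (S.U2 t ?e))) \<longlongrightarrow> \<phi> (S.U2 t ?e)) at_top"
    by (intro \<phi>.tendsto S.base.resolv_approx S.base.U_in t uV)
  have lim3: "((\<lambda>l. c * \<psi> (l *\<^sub>R S.ext.resolv l (scaled_orbit_integral t))) \<longlongrightarrow> c * \<psi> (scaled_orbit_integral t)) at_top"
    by (intro tendsto_mult tendsto_const \<psi>.tendsto S.ext.resolv_approx scaled_orbit_integral_in)
  have "\<forall>\<^sub>F l in at_top. w2 < l \<and> wp < l \<and> 0 < l" by (intro eventually_conj eventually_gt_at_top)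
  then have "\<forall>\<^sub>F l in at_top. \<phi> (l *\<^sub>R S.base.resolv l (T.U2 t ?e)) \<le>
     \<phi> (l *\<^sub>R S.base.resolv l (S.U2 t ?e)) + c * \<psi> (l *\<^sub>R S.ext.resolv l (scaled_orbit_integral t))"
  proof eventually_elim
    case (elim l)
    then have "l * \<phi> (S.base.resolv l (T.U2 t ?e)) \<le>
        l * (\<phi> (S.base.resolv l (S.U2 t ?e)) + c * \<psi> (S.ext.resolv l (scaled_orbit_integral t)))"
      by (intro mult_left_mono main) auto
    then show ?case by (simp add: \<phi>.scaleR \<psi>.scaleR algebra_simps)
  qed
  then have "\<phi> (T.U2 t ?e) \<le> \<phi> (S.U2 t ?e) + c * \<psi> (scaled_orbit_integral t)"
    by (rule tendsto_le[OF trivial_limit_at_top_linorder tendsto_add[OF lim2 lim3] lim1])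
  then show ?thesis by (simp add: c_def N_def)
qed

lemma generator_imp_semigroup: "generator_bound \<Longrightarrow> semigroup_bound"
proof -
  assume generator_bound
  then obtain C where C: "0 \<le> C" and b: "\<And>u y v z. (u, y) \<in> generator M 2 T \<Longrightarrow> (v, z) \<in> weak_star_generator M S \<Longrightarrow>
     u \<in> Lp M q \<Longrightarrow> (AE x in M. 0 \<le> u x) \<Longrightarrow> v \<in> Lp M p' \<Longrightarrow> (AE x in M. 0 \<le> v x) \<Longrightarrow>
     pairing M y v \<le> pairing M u z + C * Lp_norm M q u * pairing M f v"
    unfolding generator_bound_def by blast
  have "AE x in M. T t u x \<le> S t u x +
        C * K * Lp_integral M p 0 t (\<lambda>s y. exp (\<omega> * (t - s)) * Lp_norm M q u * Lp_extension M p S s f y) x"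
    if t: "0 \<le> t" and uI: "u \<in> T.I" and u0: "AE x in M. 0 \<le> u x" for t u
  proof -
    have u: "u \<in> Lp M 2" "u \<in> Lp M q" using uI by auto
    have uV: "emb M 2 u \<in> emb M 2 ` Lp M 2" "emb M q u \<in> emb M q ` Lp M q" using u by auto
    note I = Lp_integral_scaled_orbit[of t "Lp_norm M q u"]
    show ?thesis
    proof (rule AE_le_test[OF C0_semigroup_in[OF T.S t u(1)] C0_semigroup_in[OF S.S t u(1)] I(1)])
      fix v assume v: "v \<in> Lp M 2" "v \<in> Lp M p'" "AE x in M. 0 \<le> v x"
      obtain \<phi> \<psi> where \<phi>: "bounded_linear \<phi>" "\<And>u. u \<in> Lp M 2 \<Longrightarrow> \<phi> (emb M 2 u) = pairing M u v"
        and \<psi>: "bounded_linear \<psi>" "\<And>u. u \<in> Lp M p \<Longrightarrow> \<psi> (emb M p u) = pairing M u v"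
        using functionals[OF v(1,2)] by metis
      interpret \<phi>: bounded_linear \<phi> by (rule \<phi>(1))
      interpret \<psi>: bounded_linear \<psi> by (rule \<psi>(1))
      let ?r = "\<lambda>l. l *\<^sub>R T.base.resolv l (emb M 2 u)"
      have lim: "(?r \<longlongrightarrow> emb M 2 u) at_top" by (rule T.base.resolv_approx[OF uV(1)])
      \<comment> \<open>The bound contains the \<open>L_q\<close> norm of the vector, so the
        approximation of \<open>u\<close> inside the domain must converge in \<open>L_q\<close> as
        well as in \<open>L_2\<close>. Multiples of resolvents do both and stay nonnegative.\<close>
      have limq: "((\<lambda>l. norm (l *\<^sub>R T.ext.resolv l (emb M q u))) \<longlongrightarrow> norm (emb M q u)) at_top"
        by (intro tendsto_norm T.ext.resolv_approx uV)
      have large: "\<forall>\<^sub>F l in at_top. w3 < l \<and> \<omega> < l \<and> 0 < l" by (intro eventually_conj eventually_gt_at_top)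
      have rV: "\<forall>\<^sub>F l in at_top. ?r l \<in> emb M 2 ` Lp M 2"
        using large by (rule eventually_mono) (intro T.base.V_scale T.base.resolv_in uV, auto)
      have lim1: "((\<lambda>l. \<phi> (T.U2 t (?r l))) \<longlongrightarrow> \<phi> (T.U2 t (emb M 2 u))) at_top"
        by (intro \<phi>.tendsto T.base.U_tendsto_joint[OF tendsto_const lim _ rV t uV(1)]) (simp add: t)
      have lim2: "((\<lambda>l. \<phi> (S.U2 t (?r l))) \<longlongrightarrow> \<phi> (S.U2 t (emb M 2 u))) at_top"
        by (intro \<phi>.tendsto S.base.U_tendsto_joint[OF tendsto_const lim _ rV t uV(1)]) (simp add: t)
      have lim3: "((\<lambda>l. C * K * norm (l *\<^sub>R T.ext.resolv l (emb M q u)) * exp (\<omega> * t) * \<psi> (scaled_orbit_integral t)) \<longlongrightarrow>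
          C * K * norm (emb M q u) * exp (\<omega> * t) * \<psi> (scaled_orbit_integral t)) at_top"
        by (intro tendsto_mult tendsto_const limq)
      have "\<forall>\<^sub>F l in at_top. \<phi> (T.U2 t (?r l)) \<le> \<phi> (S.U2 t (?r l)) +
          C * K * norm (l *\<^sub>R T.ext.resolv l (emb M q u)) * exp (\<omega> * t) * \<psi> (scaled_orbit_integral t)"
        using large
      proof eventually_elim
        case (elim l)
        then have l: "w3 < l" "\<omega> < l" "0 < l" by auto
        note r = T.R2[OF l(1) u(1)] and rq = T.R2_Lp[OF l(1,2) uI]
        let ?w = "\<lambda>x. l * T.R2 l u x"
        have wL: "?w \<in> Lp M 2" "?w \<in> Lp M q" by (rule Lp_scale[OF two_ge_1 r(1)], rule Lp_scale[OF T.p rq(1)])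
        have e2: "emb M 2 ?w = ?r l" by (simp add: emb_scale[OF two_ge_1 r(1)] r(2))
        have eq: "Lp_norm M q ?w = norm (l *\<^sub>R T.ext.resolv l (emb M q u))"
          unfolding norm_emb[OF T.p wL(2), symmetric] by (simp add: emb_scale[OF T.p rq(1)] rq(2))
        have yL: "(\<lambda>x. l * T.R2 l u x - u x) \<in> Lp M 2" by (rule Lp_diff[OF two_ge_1 wL(1) u(1)])
        have "T.base.gen (l *\<^sub>R emb M 2 (T.R2 l u)) (l *\<^sub>R emb M 2 (\<lambda>x. l * T.R2 l u x - u x))"
          using T.base_gen[OF r(1) yL] r(3) by (intro T.base.gen_scale) simp
        then have "(?w, \<lambda>x. l * (l * T.R2 l u x - u x)) \<in> generator M 2 T"
          unfolding T.base_gen[OF wL(1) Lp_scale[OF two_ge_1 yL]] emb_scale[OF two_ge_1 r(1)] emb_scale[OF two_ge_1 yL] .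
        moreover have "AE x in M. 0 \<le> ?w x"
          using T.R2_nonneg[OF l(1) u(1) u0] by eventually_elim (use l in simp)
        ultimately show ?case
          using generator_bound_orbit[OF C b t _ wL(2) _ v \<phi> \<psi>] unfolding e2 eq by blast
      qed
      then have "\<phi> (T.U2 t (emb M 2 u)) \<le> \<phi> (S.U2 t (emb M 2 u)) +
          C * K * norm (emb M q u) * exp (\<omega> * t) * \<psi> (scaled_orbit_integral t)"
        by (rule tendsto_le[OF trivial_limit_at_top_linorder tendsto_add[OF lim2 lim3] lim1])
      moreover have "pairing M (Lp_integral M p 0 t (\<lambda>s y. exp (\<omega> * (t - s)) * Lp_norm M q u * Lp_extension M p S s f y)) v =
          Lp_norm M q u * exp (\<omega> * t) * \<psi> (scaled_orbit_integral t)"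
        unfolding \<psi>(2)[OF I(1), symmetric] I(2) by (simp add: \<psi>.scaleR)
      ultimately show "pairing M (T t u) v \<le> pairing M (S t u) v + C * K *
          pairing M (Lp_integral M p 0 t (\<lambda>s y. exp (\<omega> * (t - s)) * Lp_norm M q u * Lp_extension M p S s f y)) v"
        by (simp add: T.lift2[OF t u(1)] S.lift2[OF t u(1)] \<phi>(2) C0_semigroup_in[OF T.S t u(1)] C0_semigroup_in[OF S.S t u(1)]
            norm_emb[OF T.p u(2)] mult_ac)
    qed
  qed
  moreover have "0 \<le> C * K" using C T.Kp by simp
  ultimately show semigroup_bound unfolding semigroup_bound_def by blast
qed

end

theorem corollary3p6:
  fixes M :: "'a measure"
    and p p' q :: ennreal
    and S T :: "real \<Rightarrow> ('a \<Rightarrow> real) \<Rightarrow> 'a \<Rightarrow> real"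
    and K \<omega> :: real
    and f :: "'a \<Rightarrow> real"
  assumes "localizable M"
    and "1 \<le> p" and "p < \<infinity>" and "1 \<le> q" and "q < \<infinity>"
    and "1 / p + 1 / p' = 1"
    and "C0_semigroup M 2 S" and "positive_semigroup M 2 S"
    and "C0_semigroup M 2 T" and "positive_semigroup M 2 T"
    and "acts_on M S p"
    and "acts_on M T q"
    and "K \<ge> 1"
    and "\<And>t u. t \<ge> 0 \<Longrightarrow> u \<in> Lp M q \<Longrightarrow>
           Lp_norm M q (Lp_extension M q T t u) \<le> K * exp (\<omega> * t) * Lp_norm M q u"
    and "f \<in> Lp M p" and "AE x in M. 0 \<le> f x"
  shows
    "((\<exists>C\<ge>0. \<forall>t\<ge>0. \<forall>u\<in>Lp M 2 \<inter> Lp M q. (AE x in M. 0 \<le> u x) \<longrightarrow>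
         (AE x in M. T t u x \<le> S t u x +
            C * Lp_integral M p 0 t
                  (\<lambda>s y. exp (\<omega> * (t - s)) * Lp_norm M q u * Lp_extension M p S s f y) x))
      \<longleftrightarrow>
      (\<exists>C\<ge>0. \<forall>(u, ATu)\<in>generator M 2 T. \<forall>(v, ASv)\<in>weak_star_generator M S.
         u \<in> Lp M q \<longrightarrow> (AE x in M. 0 \<le> u x) \<longrightarrow>
         v \<in> Lp M p' \<longrightarrow> (AE x in M. 0 \<le> v x) \<longrightarrow>
         pairing M ATu v \<le> pairing M u ASv + C * Lp_norm M q u * pairing M f v))
     \<and>
     ((\<exists>C\<ge>0. \<forall>(u, ATu)\<in>generator M 2 T. \<forall>(v, ASv)\<in>weak_star_generator M S.
         u \<in> Lp M q \<longrightarrow> (AE x in M. 0 \<le> u x) \<longrightarrow>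
         v \<in> Lp M p' \<longrightarrow> (AE x in M. 0 \<le> v x) \<longrightarrow>
         pairing M ATu v \<le> pairing M u ASv + C * Lp_norm M q u * pairing M f v)
      \<longleftrightarrow>
      (\<exists>C\<ge>0. \<forall>\<^sub>F l in at_top. \<forall>u\<in>Lp M 2 \<inter> Lp M q. (AE x in M. 0 \<le> u x) \<longrightarrow>
         (AE x in M. resolvent M (generator M 2 T) l u x \<le>
            resolvent M (generator M 2 S) l u x +
            C / (l - \<omega>) * Lp_norm M q u *
              resolvent M (generator M p (Lp_extension M p S)) l f x)))"
proof -
  note p = assms(2,3) and q = assms(4,5)
  obtain Kp wp where Kp: "1 \<le> Kp" and Kp_bound: "\<forall>t\<ge>0. \<forall>u\<in>Lp M 2 \<inter> Lp M p.
      S t u \<in> Lp M p \<and> Lp_norm M p (S t u) \<le> Kp * exp (wp * t) * Lp_norm M p u"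
    using assms(11) unfolding acts_on_def by blast
  obtain Kq wq where Kq: "1 \<le> Kq" and Kq_bound: "\<forall>t\<ge>0. \<forall>u\<in>Lp M 2 \<inter> Lp M q.
      T t u \<in> Lp M q \<and> Lp_norm M q (T t u) \<le> Kq * exp (wq * t) * Lp_norm M q u"
    using assms(12) unfolding acts_on_def by blast
  interpret S0: acting_semigroup M S p Kp wp
    by standard (use p assms(7,8) Kp Kp_bound in auto)
  \<comment> \<open>Two instances for \<open>T\<close>: constants from \<open>acts_on\<close> first
    show that \<open>Lp_extension\<close> agrees with \<open>T\<close> on the intersection. This
    carries the prescribed bound over to \<open>T\<close> itself, and the second instance then has
    the constants \<open>K\<close> and \<open>\<omega>\<close>.\<close>
  interpret T0: acting_semigroup M T q Kq wq
    by standard (use q assms(9,10) Kq Kq_bound in auto)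
  have T_bound: "T t u \<in> Lp M q \<and> Lp_norm M q (T t u) \<le> K * exp (\<omega> * t) * Lp_norm M q u"
    if t: "0 \<le> t" and u: "u \<in> Lp M 2" "u \<in> Lp M q" for t u
  proof -
    have TL: "T t u \<in> Lp M q" using Kq_bound t u by blast
    moreover have "Lp_norm M q (T t u) = Lp_norm M q (Lp_extension M q T t u)"
      by (rule Lp_norm_cong_AE[symmetric, OF _ _ T0.extension(2)[OF t u]])
        (rule Lp_measurable[OF C0_semigroup_in[OF T0.extension(1) t u(2)]], rule Lp_measurable[OF TL])
    ultimately show ?thesis using assms(14)[OF t u(2)] by simp
  qed
  interpret T1: acting_semigroup M T q K \<omega>
    by standard (use q assms(9,10,13) T_bound in auto)
  obtain K2 w2 where c2: "c0_semigroup (emb M 2 ` Lp M 2) (\<lambda>t. lift M 2 (S t)) K2 w2" using S0.growth_L2 by metis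
  obtain K3 w3 where c3: "c0_semigroup (emb M 2 ` Lp M 2) (\<lambda>t. lift M 2 (T t)) K3 w3" using T0.growth_L2 by metis
  interpret two_semigroups M S T p q Kp wp K2 w2 K \<omega> K3 w3 p' f
    by (intro two_semigroups.intro acting_semigroup_L2.intro acting_semigroup_L2_axioms.intro two_semigroups_axioms.intro
      S0.acting_semigroup_axioms T1.acting_semigroup_axioms c2 c3 assms(6,15,16))
  have "(semigroup_bound \<longleftrightarrow> generator_bound) \<and> (generator_bound \<longleftrightarrow> resolvent_bound)"
    using semigroup_imp_generator generator_imp_semigroup generator_imp_resolvent resolvent_imp_generator by blast
  then show ?thesis
    unfolding semigroup_bound_def generator_bound_def resolvent_bound_def .
qed

end
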